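(* Let $X\in\mathbb{R}^p$ be a random vector with two representations $$A^{(1)}Z^{(1)}+E^{(1)} \;=\; X \;=\; A^{(2)}Z^{(2)}+E^{(2)},$$ such that for $i=1,2$: (i) $A^{(i)}\in\mathbb{R}^{p\times k^{(i)}}$ is a (non-random) matrix whose columns are non-zero and pairwise non-proportional; (ii) $E^{(i)}\sim\mathcal{N}(\mu^{(i)},\Sigma^{(i)})$ is a (possibly degenerate) Gaussian random vector in $\mathbb{R}^p$; (iii) $Z^{(i)}\in\mathbb{R}^{k^{(i)}}$ is a random vector with mutually independent components, each of which is a (non-constant) non-Gaussian random variable; (iv) $E^{(i)}$ is independent of $Z^{(i)}$. (Under these assumptions $k^{(1)}=k^{(2)}=:k$ and $\operatorname{rank}(A^{(1)})=\operatorname{rank}(A^{(2)})$.) Assume furthermore that $A^{(1)}$ (equivalently $A^{(2)}$) has full column rank, $\operatorname{rank}(A^{(1)})=k\le p$. (1) If all components of $Z^{(1)}$ are Gaussian-free, then there exist a permutation matrix $P\in\mathbb{R}^{k\times k}$, an invertible diagonal matrix $\Lambda\in\mathbb{R}^{k\times k}$ and a (possibly degenerate) Gaussian random vector $H\sim\mathcal{N}(\xi,\Delta)$ with mean vector $\xi\in\mathbb{R}^k$ and diagonal, possibly degenerate, covariance matrix $\Delta\in\mathbb{R}^{k\times k}$, independent of the pair $(Z^{(1)},E^{(2)})$, such that $$A^{(2)}=A^{(1)}P\Lambda,\qquad Z^{(2)}\stackrel{d}{=}\Lambda^{-1}P^{-1}\bigl(Z^{(1)}+H\bigr),\qquad E^{(1)}\stackrel{d}{=}A^{(1)}H+E^{(2)},$$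 $$\mu^{(1)}=A^{(1)}\xi+\mu^{(2)},\qquad \Sigma^{(1)}=A^{(1)}\Delta A^{(1)\mathsf T}+\Sigma^{(2)}.$$ (2) If, in addition, all components of $Z^{(2)}$ are Gaussian-free as well, then $H=\xi$ and $\Delta=0$, and we further get $$Z^{(2)}\stackrel{d}{=}\Lambda^{-1}P^{-1}\bigl(Z^{(1)}+\xi\bigr),\qquad E^{(2)}\stackrel{d}{=}E^{(1)}-A^{(1)}\xi,\qquad \Sigma^{(2)}=\Sigma^{(1)}.$$
   Context: $\stackrel{d}{=}$ means equality in law. A random vector $E$ in $\mathbb{R}^p$ is (possibly degenerate) Gaussian, $E\sim\mathcal{N}(\mu,\Sigma)$ with $\Sigma$ positive semi-definite (possibly singular), if its characteristic function is $\exp(it^{\mathsf T}\mu-\tfrac12t^{\mathsf T}\Sigma t)$; constants count as (degenerate) Gaussian. Two vectors $a,b$ are proportional if $a=\lambda b$ with $\lambda\in\mathbb{R}\setminus\{0\}$. A real-valued random variable $Z$ is called Gaussian-free if its law has no non-degenerate Gaussian convolution factor, i.e. there are no $\sigma>0$ and no independent real random variables $Y$ and $G\sim\mathcal{N}(0,\sigma^2)$ with $Z\stackrel{d}{=}Y+G$. The assertions on $H$ are statements about laws: to realise $H$ independent of $(Z^{(1)},E^{(2)})$, the underlying probability space may be enlarged (e.g. $\Omega$ replaced by $\Omega\times[0,1]$). *)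

theory Defs
  imports "HOL-Probability.Probability"
begin

definition proportional :: "real ^ 'n \<Rightarrow> real ^ 'n \<Rightarrow> bool" where
  "proportional a b \<longleftrightarrow> (\<exists>c. c \<noteq> 0 \<and> a = c *\<^sub>R b)"

definition diagonal_matrix :: "real ^ 'n ^ 'n \<Rightarrow> bool" where
  "diagonal_matrix D \<longleftrightarrow> (\<forall>i j. i \<noteq> j \<longrightarrow> D $ i $ j = 0)"

definition pos_semidef :: "real ^ 'n ^ 'n \<Rightarrow> bool" where
  "pos_semidef S \<longleftrightarrow> transpose S = S \<and> (\<forall>x. 0 \<le> x \<bullet> (S *v x))"

(* Rows and columns may be indexed by two different types; existence of the
   bijection then forces these types to have the same cardinality. *)
definition permutation_matrix :: "real ^ 'l ^ 'k \<Rightarrow> bool" where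
  "permutation_matrix P \<longleftrightarrow>
     (\<exists>\<pi> :: 'l \<Rightarrow> 'k. bij \<pi> \<and> P = (\<chi> i j. if i = \<pi> j then 1 else 0))"

definition gaussian_vector ::
    "'a measure \<Rightarrow> ('a \<Rightarrow> real ^ 'n) \<Rightarrow> real ^ 'n \<Rightarrow> real ^ 'n ^ 'n \<Rightarrow> bool" where
  "gaussian_vector M E \<mu> \<Sigma> \<longleftrightarrow>
     E \<in> borel_measurable M \<and> pos_semidef \<Sigma> \<and>
     (\<forall>t. (LINT \<omega>|M. iexp (t \<bullet> E \<omega>)) =
          exp (\<i> * complex_of_real (t \<bullet> \<mu>) - complex_of_real (t \<bullet> (\<Sigma> *v t)) / 2))"

(* Variance v = 0 is allowed, so almost surely constant variables count as Gaussian. *)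
definition gaussian_rv :: "'a measure \<Rightarrow> ('a \<Rightarrow> real) \<Rightarrow> bool" where
  "gaussian_rv M Z \<longleftrightarrow>
     Z \<in> borel_measurable M \<and>
     (\<exists>m v. 0 \<le> v \<and>
       (\<forall>t. char (distr M borel Z) t =
            exp (\<i> * complex_of_real (t * m) - complex_of_real (v * t\<^sup>2) / 2)))"

(* The measure N is the law of Y in a decomposition of the law of Z as that of Y + G,
   with Y independent of G, and G centred normal with standard deviation \<sigma>. *)
definition gaussian_free :: "'a measure \<Rightarrow> ('a \<Rightarrow> real) \<Rightarrow> bool" where
  "gaussian_free M Z \<longleftrightarrow>
     \<not> (\<exists>\<sigma>>0. \<exists>N :: real measure. prob_space N \<and> sets N = sets borel \<and>
          distr M borel Z = (N \<star> density lborel (normal_density 0 \<sigma>)))"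

(* The library's indep_var requires both variables to have the same type. *)
definition indep_rv ::
    "'a measure \<Rightarrow> ('a \<Rightarrow> 'b::topological_space) \<Rightarrow> ('a \<Rightarrow> 'c::topological_space) \<Rightarrow> bool" where
  "indep_rv M X Y \<longleftrightarrow>
     X \<in> borel_measurable M \<and> Y \<in> borel_measurable M \<and>
     prob_space.indep_set M {X -` S \<inter> space M | S. S \<in> sets borel}
                            {Y -` T \<inter> space M | T. T \<in> sets borel}"

definition representation ::
    "'a measure \<Rightarrow> ('a \<Rightarrow> real ^ 'p) \<Rightarrow> real ^ 'k ^ 'p \<Rightarrow> ('a \<Rightarrow> real ^ 'k) \<Rightarrow>
     ('a \<Rightarrow> real ^ 'p) \<Rightarrow> real ^ 'p \<Rightarrow> real ^ 'p ^ 'p \<Rightarrow> bool" where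
  "representation M X A Z E \<mu> \<Sigma> \<longleftrightarrow>
     (AE \<omega> in M. X \<omega> = A *v Z \<omega> + E \<omega>) \<and>
     (\<forall>j. column j A \<noteq> 0) \<and>
     (\<forall>i j. i \<noteq> j \<longrightarrow> \<not> proportional (column i A) (column j A)) \<and>
     gaussian_vector M E \<mu> \<Sigma> \<and>
     Z \<in> borel_measurable M \<and>
     prob_space.indep_vars M (\<lambda>_. borel) (\<lambda>j \<omega>. Z \<omega> $ j) UNIV \<and>
     (\<forall>j. \<not> gaussian_rv M (\<lambda>\<omega>. Z \<omega> $ j)) \<and>
     indep_rv M E Z"

(* The Gaussian vector H lives on the enlargement of the probability space M by a
   second probability space N; variables on M are lifted along fst. *)
definition gaussian_shift_relation ::
    "'a measure \<Rightarrow>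
     real ^ 'k ^ 'p \<Rightarrow> ('a \<Rightarrow> real ^ 'k) \<Rightarrow> ('a \<Rightarrow> real ^ 'p) \<Rightarrow> real ^ 'p \<Rightarrow> real ^ 'p ^ 'p \<Rightarrow>
     real ^ 'l ^ 'p \<Rightarrow> ('a \<Rightarrow> real ^ 'l) \<Rightarrow> ('a \<Rightarrow> real ^ 'p) \<Rightarrow> real ^ 'p \<Rightarrow> real ^ 'p ^ 'p \<Rightarrow>
     real ^ 'l ^ 'k \<Rightarrow> real ^ 'l ^ 'l \<Rightarrow>
     'b measure \<Rightarrow> ('a \<times> 'b \<Rightarrow> real ^ 'k) \<Rightarrow> real ^ 'k \<Rightarrow> real ^ 'k ^ 'k \<Rightarrow> bool" where
  "gaussian_shift_relation M A1 Z1 E1 \<mu>1 \<Sigma>1 A2 Z2 E2 \<mu>2 \<Sigma>2 P \<Lambda> N H \<xi> \<Delta> \<longleftrightarrow>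
     permutation_matrix P \<and>
     diagonal_matrix \<Lambda> \<and> invertible \<Lambda> \<and>
     prob_space N \<and>
     gaussian_vector (M \<Otimes>\<^sub>M N) H \<xi> \<Delta> \<and> diagonal_matrix \<Delta> \<and>
     indep_rv (M \<Otimes>\<^sub>M N) H (\<lambda>\<omega>. (Z1 (fst \<omega>), E2 (fst \<omega>))) \<and>
     A2 = A1 ** P ** \<Lambda> \<and>
     distr M borel Z2 =
       distr (M \<Otimes>\<^sub>M N) borel (\<lambda>\<omega>. matrix_inv \<Lambda> *v (matrix_inv P *v (Z1 (fst \<omega>) + H \<omega>))) \<and>
     distr M borel E1 = distr (M \<Otimes>\<^sub>M N) borel (\<lambda>\<omega>. A1 *v H \<omega> + E2 (fst \<omega>)) \<and>
     \<mu>1 = A1 *v \<xi> + \<mu>2 \<and>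
     \<Sigma>1 = A1 ** \<Delta> ** transpose A1 + \<Sigma>2"

end

theory Submission
  imports Defs "HOL-Complex_Analysis.Conformal_Mappings"
begin

text \<open>
Everything is read off characteristic functions. By independence the two representations of \<open>X\<close>
give one functional equation: with \<open>a\<^sub>j\<close>, \<open>b\<^sub>l\<close> the columns of the two matrices, \<open>\<phi>\<^sub>j\<close>, \<open>\<psi>\<^sub>l\<close> the
characteristic functions of the components and \<open>g\<^sub>1\<close>, \<open>g\<^sub>2\<close> those of the Gaussian parts,
\<open>(\<Prod>j. \<phi>\<^sub>j (a\<^sub>j \<bullet> t)) * g\<^sub>1 t = (\<Prod>l. \<psi>\<^sub>l (b\<^sub>l \<bullet> t)) * g\<^sub>2 t\<close> (\<open>representation_char\<close>).

Matching the columns. Near \<open>t = 0\<close> no factor vanishes, so logarithms turn the equation into: a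
sum of functions, each depending on \<open>t\<close> through one direction only, equals a quadratic polynomial.
Suppose that some \<open>a\<^sub>j\<close> is proportional to no \<open>b\<^sub>l\<close>. Then for each other direction \<open>c\<close> there is a
vector \<open>w\<close> with \<open>c \<bullet> w = 0\<close> and \<open>a\<^sub>j \<bullet> w = 1\<close>; differencing the equation along \<open>h w\<close> removes the
function of \<open>c \<bullet> t\<close> and takes an ordinary difference with step \<open>h\<close> of \<open>ln \<phi>\<^sub>j\<close>. Three more
differences remove the quadratic polynomial. So some iterated difference of \<open>ln \<phi>\<^sub>j\<close> vanishes near
0, which makes \<open>ln \<phi>\<^sub>j\<close> a polynomial near 0 (\<open>sum_of_ridge_functions_imp_poly\<close>). By the theorem of
Marcinkiewicz a characteristic function which is \<open>exp p\<close> near 0 for a polynomial \<open>p\<close> belongs to a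
Gaussian law, but the components are not Gaussian. Hence the columns correspond bijectively up to
scalars (\<open>column_proportional\<close>, \<open>columns_correspond\<close>), and numbers of columns and ranks agree.

The theorem of Marcinkiewicz. All moments are bounded by the derivatives of the entire function
\<open>exp p\<close> near 0, hence by Cauchy's inequalities \<open>E exp (r \<bar>Z\<bar>)\<close> is finite for every \<open>r\<close> and
\<open>E exp (\<i> z Z)\<close> is an entire function; it is \<open>exp (p z)\<close>. Such a transform satisfies
\<open>\<bar>F z\<bar> \<le> F (\<i> Im z)\<close>, and the inequality \<open>Re (p z) \<le> Re (p (\<i> Im z))\<close> is impossible for
polynomials of degree 3 or more.

Full column rank. The columns of the first matrix then have a dual family, and inserting
multiples of a dual vector isolates one matched pair of components:
\<open>\<psi>\<^sub>l (\<kappa> s) = \<phi>\<^sub>k s * exp (\<i> m s - v s\<^sup>2 / 2)\<close>. A negative \<open>v\<close> would exhibit a normal convolution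
factor of the first component, so \<open>v \<ge> 0\<close> by Gaussian-freeness, and the numbers \<open>m\<close>, \<open>v\<close> are the
means and variances of the components of \<open>H\<close>. Putting this back into the functional equation and
cancelling the non-zero product near 0 identifies the parameters of the Gaussian parts. The
equalities in law follow from the uniqueness theorem for characteristic functions of random
vectors, which is derived below from the one-dimensional one. Conversely, in any relation as in
the conclusion a positive variance of a component of \<open>H\<close> exhibits a normal convolution factor of a
component of the second source vector; if these components are Gaussian-free as well, \<open>H\<close> is
constant.
\<close>

section \<open>Vanishing differences and polynomials\<close>

text \<open>One definition serves functions on the line, on the complex plane and on Euclidean space.\<close>

definition fdiff :: "'a::ab_group_add \<Rightarrow> ('a \<Rightarrow> 'b::ab_group_add) \<Rightarrow> 'a \<Rightarrow> 'b" where
  "fdiff h f s = f (s + h) - f s"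

lemma fdiff_funpow_Suc:
  "(fdiff h ^^ Suc m) f s = (fdiff h ^^ m) f (s + h) - (fdiff h ^^ m) f s"
  by (simp add: fdiff_def)

lemma fdiff_funpow_diff:
  "(fdiff h ^^ m) (\<lambda>s. f s - g s) s = (fdiff h ^^ m) f s - (fdiff h ^^ m) g s"
  by (induction m arbitrary: s) (simp_all add: fdiff_funpow_Suc del: funpow.simps(2))

lemma fdiff_funpow_zero: "(fdiff h ^^ m) (\<lambda>s. 0) s = 0"
  by (induction m arbitrary: s) (simp_all add: fdiff_funpow_Suc del: funpow.simps(2))

lemma fdiff_funpow_fdiff:
  "(fdiff h ^^ m) (fdiff u f) s = (fdiff h ^^ m) f (s + u) - (fdiff h ^^ m) f s"
proof (induction m arbitrary: s)
  case (Suc m)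
  show ?case by (simp add: fdiff_funpow_Suc Suc.IH add_ac del: funpow.simps(2))
qed (simp add: fdiff_def)

text \<open>An iterated difference only looks at the values along an arithmetic progression. This lets a
difference on the line be computed along a line in a larger space, and a local identity between
functions be differenced.\<close>

lemma fdiff_funpow_cong:
  fixes h s :: "'a::real_vector" and u t :: "'b::real_vector"
  assumes "\<And>k. k \<le> n \<Longrightarrow> f (s + real k *\<^sub>R h) = g (t + real k *\<^sub>R u)"
  shows "(fdiff h ^^ n) f s = (fdiff u ^^ n) g t"
  using assms
proof (induction n arbitrary: s t)
  case (Suc n)
  have "(fdiff h ^^ n) f (s + h) = (fdiff u ^^ n) g (t + u)"
    by (rule Suc.IH) (use Suc.prems[of "Suc _"] in \<open>auto simp: algebra_simps\<close>)
  moreover have "(fdiff h ^^ n) f s = (fdiff u ^^ n) g t"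
    by (rule Suc.IH) (use Suc.prems in auto)
  ultimately show ?case by (simp add: fdiff_funpow_Suc del: funpow.simps(2))
qed simp

lemma fdiff_funpow_poly:
  fixes p :: "complex poly" and h :: real
  assumes "degree p < m"
  shows "(fdiff h ^^ m) (\<lambda>s. poly p (of_real s)) s = 0"
  using assms
proof (induction m arbitrary: p s)
  case 0
  then show ?case by simp
next
  case (Suc m)
  define q where "q = pcompose p [:of_real h, 1:] - p"
  have fd: "fdiff h (\<lambda>s. poly p (of_real s)) = (\<lambda>s. poly q (of_real s))"
    by (auto simp: fdiff_def q_def poly_pcompose fun_eq_iff algebra_simps)
  show ?case
  proof (cases "degree p = 0")
    case True
    then obtain c where "p = [:c:]" by (metis degree_eq_zeroE)
    then have "q = 0" by (simp add: q_def)
    then have "fdiff h (\<lambda>s. poly p (of_real s)) = (\<lambda>s. 0)" using fd by simp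
    then show ?thesis by (simp add: fdiff_funpow_zero funpow_Suc_right del: funpow.simps(2))
  next
    case False
    have "degree q < degree p"
    proof (rule degree_lessI)
      show "\<forall>k\<ge>degree p. coeff q k = 0"
      proof safe
        fix k assume k: "k \<ge> degree p"
        have dg: "degree (pcompose p [:of_real h, 1:]) = degree p" by (simp add: degree_pcompose)
        have lc: "lead_coeff (pcompose p [:of_real h, 1:]) = lead_coeff p"
          by (subst lead_coeff_comp) auto
        show "coeff q k = 0"
          using k dg lc by (cases "k = degree p") (auto simp: q_def coeff_eq_0)
      qed
    qed (use False in auto)
    then have "degree q < m" using Suc.prems by simp
    then show ?thesis using Suc.IH[of q] fd by (simp add: funpow_Suc_right del: funpow.simps(2))
  qed
qed

text \<open>The coefficient of the last of the \<open>m + 1\<close> values entering an \<open>m\<close>-fold difference is 1. Hence a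
function with vanishing \<open>m\<close>-fold differences is determined on an arithmetic progression by its
first \<open>m\<close> values.\<close>

lemma fdiff_funpow_vanishing_prefix:
  fixes f :: "real \<Rightarrow> complex"
  assumes "\<And>k. k < m \<Longrightarrow> f (s + real k * h) = 0"
  shows "(fdiff h ^^ m) f s = f (s + real m * h)"
  using assms
proof (induction m arbitrary: s)
  case (Suc m)
  have "(fdiff h ^^ m) f (s + h) = f (s + h + real m * h)"
    by (rule Suc.IH) (use Suc.prems[of "Suc _"] in \<open>auto simp: algebra_simps\<close>)
  moreover have "(fdiff h ^^ m) f s = f (s + real m * h)"
    by (rule Suc.IH) (use Suc.prems in auto)
  ultimately show ?case using Suc.prems[of m] by (simp add: fdiff_funpow_Suc algebra_simps del: funpow.simps(2))
qed simp

lemma interpolation_poly_exists: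
  fixes f :: "'a::field \<Rightarrow> 'a"
  assumes "finite S"
  shows "\<exists>p. degree p \<le> card S - 1 \<and> (\<forall>x\<in>S. poly p x = f x)"
  using assms
proof (induction S rule: finite_induct)
  case empty
  then show ?case by (intro exI[of _ 0]) auto
next
  case (insert x S)
  then obtain p where p: "degree p \<le> card S - 1" "\<forall>x\<in>S. poly p x = f x" by blast
  define w where "w = (\<Prod>y\<in>S. [:-y, 1:])"
  have wx: "poly w x \<noteq> 0" using insert by (auto simp: w_def poly_prod)
  have wS: "poly w y = 0" if "y \<in> S" for y
    using insert that by (auto simp: w_def poly_prod)
  have dw: "degree w = card S" by (simp add: w_def degree_prod_eq_sum_degree)
  define q where "q = p + smult ((f x - poly p x) / poly w x) w"
  have "degree q \<le> card S"
    unfolding q_def by (rule degree_add_le) (use p dw in \<open>auto intro: order_trans[OF degree_smult_le]\<close>)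
  moreover have "\<forall>y\<in>insert x S. poly q y = f y"
    using p wx wS by (auto simp: q_def)
  ultimately show ?case using insert by (intro exI[of _ q]) auto
qed

lemma poly_eqI_card:
  fixes p q :: "'a::idom poly"
  assumes "degree p \<le> n" "degree q \<le> n" "n < card S" "\<And>x. x \<in> S \<Longrightarrow> poly p x = poly q x"
  shows "p = q"
proof (rule ccontr)
  assume "p \<noteq> q"
  then have nz: "p - q \<noteq> 0" by simp
  have "S \<subseteq> {x. poly (p - q) x = 0}" using assms by auto
  then have "card S \<le> card {x. poly (p - q) x = 0}"
    using nz by (intro card_mono poly_roots_finite)
  also have "\<dots> \<le> degree (p - q)" using nz by (rule card_poly_roots_bound)
  also have "\<dots> \<le> n" using assms by (intro degree_diff_le)
  finally show False using assms by simp
qed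

text \<open>The difference of \<open>f\<close> and the interpolating polynomial satisfies the same linear recurrence with
zero initial values.\<close>

lemma vanishing_fdiff_imp_poly_grid:
  fixes f :: "real \<Rightarrow> complex" and a h :: real
  assumes van: "\<And>k. k \<le> K \<Longrightarrow> (fdiff h ^^ m) f (a + real k * h) = 0"
    and deg: "degree p < m" and init: "\<And>k. k < m \<Longrightarrow> f (a + real k * h) = poly p (of_real (a + real k * h))"
    and k: "k \<le> K"
  shows "f (a + real k * h) = poly p (of_real (a + real k * h))"
  using k
proof (induction k rule: less_induct)
  case (less k)
  show ?case
  proof (cases "k < m")
    case False
    define g where "g = (\<lambda>s. f s - poly p (of_real s))"
    define s where "s = a + real (k - m) * h"
    have eq: "s + real j * h = a + real (k - m + j) * h" for j
      by (simp add: s_def algebra_simps)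
    have "(fdiff h ^^ m) g s = (fdiff h ^^ m) f s - 0"
      by (simp add: g_def fdiff_funpow_diff fdiff_funpow_poly deg)
    also have "\<dots> = 0" using van[of "k - m"] less.prems by (simp add: s_def)
    finally have "(fdiff h ^^ m) g s = 0" .
    moreover have "(fdiff h ^^ m) g s = g (s + real m * h)"
    proof (rule fdiff_funpow_vanishing_prefix)
      fix j assume j: "j < m"
      show "g (s + real j * h) = 0"
        unfolding eq g_def using less.IH[of "k - m + j"] j False less.prems by simp
    qed
    ultimately have "g (a + real k * h) = 0" using eq[of m] False by simp
    then show ?thesis by (simp add: g_def)
  qed (use init in auto)
qed

text \<open>Fix an interval around 0. On every sufficiently fine evenly spaced grid of it \<open>f\<close> is a polynomial
of degree less than \<open>m\<close>. A grid that refines the coarsest one, of \<open>m + 1\<close> points, shares with it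
more points than the degree, so all these polynomials are the same one. The grids together are
dense, and \<open>f\<close> is continuous.\<close>

lemma continuous_vanishing_fdiff_imp_poly:
  fixes f :: "real \<Rightarrow> complex"
  assumes d: "0 < \<delta>" and cont: "continuous_on {-\<delta><..<\<delta>} f" and m: "0 < m"
    and van: "\<And>h s. \<bar>h\<bar> < \<delta> \<Longrightarrow> \<bar>s\<bar> < \<delta> \<Longrightarrow> (fdiff h ^^ m) f s = 0"
  shows "\<exists>p \<epsilon>. 0 < \<epsilon> \<and> (\<forall>s. \<bar>s\<bar> < \<epsilon> \<longrightarrow> f s = poly p (of_real s))"
proof -
  define \<eta> where "\<eta> = \<delta> / 3"
  have eta: "0 < \<eta>" "2 * \<eta> < \<delta>" using d by (auto simp: \<eta>_def)
  \<comment> \<open>\<open>pt\<close> parametrises \<open>{-\<eta>..\<eta>}\<close> by \<open>{0..1}\<close>; the grids consist of the points \<open>pt (k / (m * N))\<close>.\<close>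
  define pt where "pt q = - \<eta> + q * (2 * \<eta>)" for q :: real
  have pt_inj: "inj pt" using eta by (auto simp: pt_def inj_def)
  have interp: "\<exists>p. degree p < m \<and> (\<forall>k<m. f (pt (c * real k)) = poly p (of_real (pt (c * real k))))"
    if "c > 0" for c
  proof -
    let ?S = "(\<lambda>k. complex_of_real (pt (c * real k))) ` {..<m}"
    have "inj_on (\<lambda>k. complex_of_real (pt (c * real k))) {..<m}"
    proof (rule inj_onI)
      fix i j assume "complex_of_real (pt (c * real i)) = complex_of_real (pt (c * real j))"
      then have "pt (c * real i) = pt (c * real j)" by (simp only: of_real_eq_iff)
      then have "c * real i = c * real j" using pt_inj by (simp add: inj_eq)
      then show "i = j" using that by simp
    qed
    then have "card ?S = m" by (simp add: card_image)
    moreover obtain p where p: "degree p \<le> card ?S - 1" "\<forall>x\<in>?S. poly p x = f (Re x)"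
      using interpolation_poly_exists[of ?S "\<lambda>z. f (Re z)"] by blast
    ultimately have "degree p < m" using m by linarith
    moreover have "f (pt (c * real k)) = poly p (of_real (pt (c * real k)))" if "k < m" for k
      using bspec[OF p(2), of "complex_of_real (pt (c * real k))"] that by simp
    ultimately show ?thesis by blast
  qed
  have ex: "\<exists>p. degree p < m \<and> (\<forall>k\<le>m * N. f (pt (real k / (m * N))) = poly p (of_real (pt (real k / (m * N)))))"
    if N: "N > 0" for N :: nat
  proof -
    define h where "h = 2 * \<eta> / (real m * real N)"
    have "1 \<le> real m * real N" using m N by (metis of_nat_mult of_nat_le_iff Suc_leI nat_0_less_mult_iff One_nat_def of_nat_1)
    then have h: "0 < h" "h < \<delta>" using eta unfolding h_def
      by (auto simp: pos_divide_less_eq intro: less_le_trans[of _ "\<delta> * 1"])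
    have pth: "pt (real k / (m * N)) = - \<eta> + real k * h" for k
      using m N by (simp add: pt_def h_def)
    obtain p where p: "degree p < m" "\<And>k. k < m \<Longrightarrow> f (- \<eta> + real k * h) = poly p (of_real (- \<eta> + real k * h))"
    proof -
      have "0 < 1 / real (m * N)" using m N by simp
      from interp[OF this] obtain p where p: "degree p < m"
        "\<forall>k<m. f (pt (1 / real (m * N) * real k)) = poly p (of_real (pt (1 / real (m * N) * real k)))" by blast
      have "1 / real (m * N) * real k = real k / (m * N)" for k by simp
      with p pth that show ?thesis by metis
    qed
    have "f (- \<eta> + real k * h) = poly p (of_real (- \<eta> + real k * h))" if k: "k \<le> m * N" for k
    proof (rule vanishing_fdiff_imp_poly_grid[OF _ p k])
      fix j assume "j \<le> m * N"
      then have "real j \<le> real (m * N)" by (simp only: of_nat_le_iff)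
      then have "0 \<le> real j * h" "real j * h \<le> real (m * N) * h"
        using h by (auto intro: mult_right_mono simp del: of_nat_mult)
      moreover have "real (m * N) * h = 2 * \<eta>" using m N by (simp add: h_def)
      ultimately show "(fdiff h ^^ m) f (- \<eta> + real j * h) = 0"
        using h eta by (intro van; linarith)
    qed
    then show ?thesis using p pth by auto
  qed
  obtain p where p: "degree p < m" "\<And>k. k \<le> m \<Longrightarrow> f (pt (real k / m)) = poly p (of_real (pt (real k / m)))"
    using ex[of 1] by auto
  have rat: "f (pt (real k / real n)) = poly p (of_real (pt (real k / real n)))" if n: "n > 0" "k \<le> n" for k n
  proof -
    obtain q where q: "degree q < m" "\<And>k. k \<le> m * n \<Longrightarrow> f (pt (real k / (m * n))) = poly q (of_real (pt (real k / (m * n))))"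
      using ex[OF n(1)] by blast
    have "q = p"
    proof (rule poly_eqI_card[where n = "m - 1" and S = "(\<lambda>k. complex_of_real (pt (real k / m))) ` {..<m}"])
      show "m - 1 < card ((\<lambda>k. complex_of_real (pt (real k / m))) ` {..<m})"
      proof -
        have "inj_on (\<lambda>k. complex_of_real (pt (real k / m))) {..<m}"
        proof (rule inj_onI)
          fix i j assume "complex_of_real (pt (real i / m)) = complex_of_real (pt (real j / m))"
          then have "pt (real i / m) = pt (real j / m)" by (simp only: of_real_eq_iff)
          then have "real i / m = real j / m" using pt_inj by (simp add: inj_eq)
          then show "i = j" using m by simp
        qed
        then show ?thesis using m by (simp add: card_image)
      qed
      fix x assume "x \<in> (\<lambda>k. complex_of_real (pt (real k / m))) ` {..<m}"
      then obtain k where k: "k < m" "x = complex_of_real (pt (real k / m))" by auto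
      have eq: "real (k * n) / (m * n) = real k / m" using n by simp
      have "k * n \<le> m * n" using k by simp
      from q(2)[OF this] have "f (pt (real k / m)) = poly q (of_real (pt (real k / m)))"
        unfolding eq .
      then show "poly q x = poly p x" using p(2)[of k] k by simp
    qed (use p q in auto)
    moreover have "real (m * k) / (m * n) = real k / n" using m by simp
    moreover have "m * k \<le> m * n" using n by simp
    ultimately show ?thesis using q(2)[of "m * k"] by metis
  qed
  have "f s = poly p (of_real s)" if s: "\<bar>s\<bar> < \<eta>" for s
  proof (rule ccontr)
    assume ne: "f s \<noteq> poly p (of_real s)"
    define g where "g = (\<lambda>s. f s - poly p (of_real s))"
    have "continuous_on {-\<delta><..<\<delta>} g"
      unfolding g_def by (intro continuous_intros cont)
    moreover have "s \<in> {-\<delta><..<\<delta>}" using s eta by auto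
    ultimately have "isCont g s" by (simp only: continuous_on_eq_continuous_at[OF open_greaterThanLessThan])
    moreover have "g s \<noteq> 0" using ne by (simp add: g_def)
    ultimately obtain e where e: "e > 0" "\<And>y. dist s y < e \<Longrightarrow> g y \<noteq> 0"
      using continuous_at_avoid by blast
    define lo where "lo = (s + \<eta>) / (2 * \<eta>)"
    define hi where "hi = min 1 ((s + e + \<eta>) / (2 * \<eta>))"
    have "lo < 1" "0 < lo" using s eta by (auto simp: lo_def field_simps)
    moreover have "lo < (s + e + \<eta>) / (2 * \<eta>)" using e eta by (auto simp: lo_def divide_strict_right_mono)
    ultimately have "lo < hi" by (auto simp: hi_def)
    then obtain r where r: "r \<in> \<rat>" "lo < r" "r < hi" using Rats_dense_in_real by blast
    have r01: "0 < r" "r < 1" using r \<open>0 < lo\<close> by (auto simp: hi_def)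
    from r(1) obtain i n where rn: "r = real_of_int i / real n" "n > 0"
      by (metis Rats_cases' of_nat_0_less_iff of_int_of_nat_eq zero_less_imp_eq_int)
    have "i > 0" using r01 rn by (simp add: zero_less_divide_iff)
    then obtain k where k: "i = int k" by (metis zero_less_imp_eq_int)
    have "r = real k / real n" "k \<le> n" using rn k r01 by auto
    then have "f (pt r) = poly p (of_real (pt r))" using rat[of n k] rn by simp
    then have "g (pt r) = 0" by (simp add: g_def)
    moreover have "dist s (pt r) < e"
    proof -
      have "s < pt r" using r(2) eta by (simp add: pt_def lo_def field_simps)
      moreover have "pt r < s + e" using r(3) eta by (simp add: pt_def hi_def field_simps)
      ultimately show ?thesis by (simp add: dist_real_def)
    qed
    ultimately show False using e by blast
  qed
  then show ?thesis using eta by blast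
qed

section \<open>Sums of functions of linear forms\<close>

text \<open>A substitute for being a polynomial of degree at most 2 which is visibly stable under
differencing.\<close>

definition vanishing_third_differences :: "('v::ab_group_add \<Rightarrow> complex) \<Rightarrow> bool" where
  "vanishing_third_differences Q \<longleftrightarrow> (\<forall>u t. (fdiff u ^^ 3) Q t = 0)"

lemma vanishing_third_differences_fdiff:
  "vanishing_third_differences Q \<Longrightarrow> vanishing_third_differences (fdiff u Q)"
  by (simp add: vanishing_third_differences_def fdiff_funpow_fdiff)

text \<open>A difference along \<open>h w\<close> with \<open>c \<bullet> w = 0\<close> and \<open>a \<bullet> w = 1\<close> does not see a function of \<open>c \<bullet> t\<close> and
acts on a function of \<open>a \<bullet> t\<close> as a difference with step \<open>h\<close>. The remaining terms keep their form,
so the directions can be removed one after the other; each step costs \<open>\<bar>h\<bar> * norm w\<close> of the radius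
on which the equation is known.\<close>

lemma fdiff_eliminates_other_directions:
  fixes a :: "'v::real_inner" and c w :: "'i \<Rightarrow> 'v" and g :: "real \<Rightarrow> complex"
  assumes "finite I" "\<And>i. i \<in> I \<Longrightarrow> c i \<bullet> w i = 0" "\<And>i. i \<in> I \<Longrightarrow> a \<bullet> w i = 1"
    "vanishing_third_differences Q"
    "\<And>t. norm t < r + \<bar>h\<bar> * (\<Sum>i\<in>I. norm (w i)) \<Longrightarrow> g (a \<bullet> t) + (\<Sum>i\<in>I. F i (c i \<bullet> t)) = Q t"
  shows "\<exists>R. vanishing_third_differences R \<and> (\<forall>t. norm t < r \<longrightarrow> (fdiff h ^^ card I) g (a \<bullet> t) = R t)"
  using assms
proof (induction I arbitrary: g F Q rule: finite_induct)
  case empty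
  then show ?case by auto
next
  case (insert i I)
  let ?u = "h *\<^sub>R w i"
  have "\<exists>R. vanishing_third_differences R \<and> (\<forall>t. norm t < r \<longrightarrow> (fdiff h ^^ card I) (fdiff h g) (a \<bullet> t) = R t)"
  proof (rule insert.IH)
    show "vanishing_third_differences (fdiff ?u Q)"
      by (rule vanishing_third_differences_fdiff) (use insert in auto)
    fix t :: 'v assume t: "norm t < r + \<bar>h\<bar> * (\<Sum>i\<in>I. norm (w i))"
    have S: "(\<Sum>i\<in>insert i I. norm (w i)) = norm (w i) + (\<Sum>i\<in>I. norm (w i))"
      using insert by simp
    have "norm (t + ?u) \<le> norm t + norm ?u" by (rule norm_triangle_ineq)
    then have "norm (t + ?u) < r + \<bar>h\<bar> * (\<Sum>i\<in>insert i I. norm (w i))"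
      unfolding S using t by (simp add: algebra_simps)
    from insert.prems(4)[OF this]
    have 1: "g (a \<bullet> t + h) + (\<Sum>j\<in>insert i I. F j (c j \<bullet> (t + ?u))) = Q (t + ?u)"
      using insert.prems(2)[of i] by (simp add: inner_add_right)
    have "\<bar>h\<bar> * (\<Sum>i\<in>I. norm (w i)) \<le> \<bar>h\<bar> * (\<Sum>i\<in>insert i I. norm (w i))"
      by (intro mult_left_mono) (auto simp: S)
    then have "norm t < r + \<bar>h\<bar> * (\<Sum>i\<in>insert i I. norm (w i))"
      using t by linarith
    from insert.prems(4)[OF this]
    have 2: "g (a \<bullet> t) + (\<Sum>j\<in>insert i I. F j (c j \<bullet> t)) = Q t" .
    have 3: "F i (c i \<bullet> (t + ?u)) = F i (c i \<bullet> t)"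
      using insert.prems(1)[of i] by (simp add: inner_add_right)
    have "fdiff ?u Q t = fdiff h g (a \<bullet> t) + (\<Sum>j\<in>I. F j (c j \<bullet> (t + ?u)) - F j (c j \<bullet> t))"
      using 1 2 3 insert(1,2) by (simp add: fdiff_def sum_subtractf algebra_simps flip: 1 2)
    then show "fdiff h g (a \<bullet> t) + (\<Sum>j\<in>I. fdiff (h * (c j \<bullet> w i)) (F j) (c j \<bullet> t)) = fdiff ?u Q t"
      by (simp add: fdiff_def inner_add_right)
  qed (use insert in auto)
  then show ?case using insert(1,2) by (simp add: funpow_Suc_right del: funpow.simps(2))
qed

text \<open>After the elimination of the other directions, the iterated difference of \<open>g\<close> at \<open>a \<bullet> t\<close> is a
function of \<open>t\<close> whose third differences vanish. Three more differences along a vector \<open>v\<close> with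
\<open>a \<bullet> v = 1\<close> give zero.\<close>

lemma sum_of_ridge_functions_imp_poly:
  fixes a :: "'v::real_inner" and c w :: "'i \<Rightarrow> 'v" and g :: "real \<Rightarrow> complex"
  assumes fin: "finite I" and w: "\<And>i. i \<in> I \<Longrightarrow> c i \<bullet> w i = 0" "\<And>i. i \<in> I \<Longrightarrow> a \<bullet> w i = 1"
    and v: "a \<bullet> v = 1"
    and Q: "vanishing_third_differences Q" and \<epsilon>: "0 < \<epsilon>" and cont: "continuous_on {-\<epsilon><..<\<epsilon>} g"
    and eq: "\<And>t. norm t < \<epsilon> \<Longrightarrow> g (a \<bullet> t) + (\<Sum>i\<in>I. F i (c i \<bullet> t)) = Q t"
  shows "\<exists>p \<delta>. 0 < \<delta> \<and> (\<forall>s. \<bar>s\<bar> < \<delta> \<longrightarrow> g s = poly p (of_real s))"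
proof -
  \<comment> \<open>\<open>W\<close> bounds the displacement of the argument per unit of \<open>h\<close> and \<open>s\<close>: one shift along each \<open>w i\<close>,
    the base point \<open>s v\<close> and three shifts along \<open>v\<close>.\<close>
  define W where "W = 1 + (\<Sum>i\<in>I. norm (w i)) + 4 * norm v"
  have W: "W \<ge> 1" by (simp add: W_def sum_nonneg)
  define \<delta> where "\<delta> = \<epsilon> / (2 * W)"
  have d: "0 < \<delta>" "\<delta> \<le> \<epsilon> / 2" "\<delta> * W = \<epsilon> / 2" using W \<epsilon> by (auto simp: \<delta>_def field_simps)
  have "(fdiff h ^^ (3 + card I)) g s = 0" if hs: "\<bar>h\<bar> < \<delta>" "\<bar>s\<bar> < \<delta>" for h s
  proof -
    have "\<bar>h\<bar> * (\<Sum>i\<in>I. norm (w i)) \<le> \<delta> * W"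
      using hs by (intro mult_mono) (auto simp: W_def sum_nonneg)
    then have "\<exists>R. vanishing_third_differences R \<and> (\<forall>t. norm t < \<epsilon> / 2 \<longrightarrow> (fdiff h ^^ card I) g (a \<bullet> t) = R t)"
      using fdiff_eliminates_other_directions[OF fin w Q, where F = F and r = "\<epsilon> / 2" and h = h] eq d
      by fastforce
    then obtain R where R: "vanishing_third_differences R"
      "\<And>t. norm t < \<epsilon> / 2 \<Longrightarrow> (fdiff h ^^ card I) g (a \<bullet> t) = R t" by blast
    have "(fdiff h ^^ 3) ((fdiff h ^^ card I) g) s = (fdiff (h *\<^sub>R v) ^^ 3) R (s *\<^sub>R v)"
    proof (rule fdiff_funpow_cong)
      fix k :: nat assume k: "k \<le> 3"
      let ?x = "s + real k * h"
      have "\<bar>?x\<bar> \<le> \<bar>s\<bar> + real k * \<bar>h\<bar>" by (metis abs_mult abs_of_nat abs_triangle_ineq)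
      also have "\<dots> \<le> \<delta> + 3 * \<delta>" using hs k by (intro add_mono mult_mono) auto
      finally have "norm (?x *\<^sub>R v) \<le> (4 * \<delta>) * norm v"
        by (auto intro: mult_right_mono)
      also have "\<dots> < \<delta> * W"
      proof -
        have "0 \<le> (\<Sum>i\<in>I. norm (w i))" by (simp add: sum_nonneg)
        then have "\<delta> * (4 * norm v) < \<delta> * W" using d(1) by (intro mult_strict_left_mono) (auto simp: W_def)
        then show ?thesis by simp
      qed
      finally have "(fdiff h ^^ card I) g (a \<bullet> (?x *\<^sub>R v)) = R (?x *\<^sub>R v)"
        using d(3) by (intro R(2)) simp
      then show "(fdiff h ^^ card I) g (s + real k *\<^sub>R h) = R (s *\<^sub>R v + real k *\<^sub>R h *\<^sub>R v)"
        by (simp add: v scaleR_add_left inner_add_right)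
    qed
    also have "\<dots> = 0" using R(1) by (simp add: vanishing_third_differences_def)
    finally show ?thesis by (simp add: funpow_add)
  qed
  moreover have "continuous_on {-\<delta><..<\<delta>} g"
    by (rule continuous_on_subset[OF cont]) (use d(1,2) in auto)
  ultimately show ?thesis
    using d by (intro continuous_vanishing_fdiff_imp_poly[where m = "3 + card I"]) auto
qed

section \<open>Entire characteristic functions and Marcinkiewicz's theorem\<close>

lemma has_field_derivative_fdiff_funpow:
  fixes f :: "complex \<Rightarrow> complex"
  assumes "f holomorphic_on UNIV"
  shows "((fdiff h ^^ m) f has_field_derivative (fdiff h ^^ m) (deriv f) z) (at z)"
proof (induction m arbitrary: z)
  case 0
  then show ?case using assms by (simp add: holomorphic_derivI)
next
  case (Suc m)
  have "((\<lambda>z. (fdiff h ^^ m) f (z + h)) has_field_derivative (fdiff h ^^ m) (deriv f) (z + h)) (at z)"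
    using Suc.IH[of "z + h"] by (simp add: DERIV_shift)
  then have "((\<lambda>z. (fdiff h ^^ m) f (z + h) - (fdiff h ^^ m) f z) has_field_derivative
      (fdiff h ^^ m) (deriv f) (z + h) - (fdiff h ^^ m) (deriv f) z) (at z)"
    by (intro DERIV_diff Suc.IH)
  then show ?case
    unfolding fdiff_funpow_Suc by (simp add: fdiff_funpow_Suc[abs_def] fun_eq_iff[symmetric])
qed

text \<open>Mean value inequality, applied once for each of the \<open>m\<close> differences: the derivative of an
iterated difference is the iterated difference of the derivative.\<close>

lemma norm_fdiff_funpow_le:
  fixes f :: "complex \<Rightarrow> complex"
  assumes "f holomorphic_on UNIV" "\<And>w. norm w < \<rho> \<Longrightarrow> norm ((deriv ^^ m) f w) \<le> K"
    and "norm z + real m * norm h < \<rho>"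
  shows "norm ((fdiff h ^^ m) f z) \<le> K * norm h ^ m"
  using assms
proof (induction m arbitrary: f z)
  case (Suc m)
  have hol: "deriv f holomorphic_on UNIV" using Suc.prems(1) by (simp add: holomorphic_deriv)
  define S where "S = ball (0::complex) (\<rho> - real m * norm h)"
  have "norm ((fdiff h ^^ m) f (z + h) - (fdiff h ^^ m) f z) \<le> (K * norm h ^ m) * norm ((z + h) - z)"
  proof (rule field_differentiable_bound[where S = S and f' = "(fdiff h ^^ m) (deriv f)"])
    show "convex S" by (simp add: S_def)
    show "((fdiff h ^^ m) f has_field_derivative (fdiff h ^^ m) (deriv f) w) (at w within S)" for w
      by (rule has_field_derivative_at_within[OF has_field_derivative_fdiff_funpow[OF Suc.prems(1)]])
    fix w assume "w \<in> S"
    then show "norm ((fdiff h ^^ m) (deriv f) w) \<le> K * norm h ^ m"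
      using Suc.prems(2) by (intro Suc.IH[OF hol]) (auto simp: S_def funpow_Suc_right simp del: funpow.simps(2))
  next
    have "norm (z + h) \<le> norm z + norm h" by (rule norm_triangle_ineq)
    then show "z + h \<in> S" using Suc.prems(3) by (simp add: S_def algebra_simps)
    have "norm z \<le> norm z + norm h" by simp
    moreover have "norm z + norm h + real m * norm h < \<rho>" using Suc.prems(3) by (simp add: algebra_simps)
    ultimately have "norm z < \<rho> - real m * norm h" by linarith
    then show "z \<in> S" by (simp add: S_def)
  qed
  then show ?case by (simp add: fdiff_funpow_Suc algebra_simps del: funpow.simps(2))
qed simp

lemma fdiff_funpow_iexp:
  "(fdiff h ^^ m) (\<lambda>s. iexp (s * x)) t = iexp (t * x) * (iexp (h * x) - 1) ^ m"
proof (induction m arbitrary: t)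
  case (Suc m)
  have "iexp ((t + h) * x) = iexp (t * x) * iexp (h * x)"
    by (simp add: algebra_simps exp_add)
  then show ?case by (simp only: fdiff_funpow_Suc Suc.IH) (simp add: algebra_simps)
qed simp

text \<open>Centred differences of even order of \<open>s \<mapsto> exp (\<i> s x)\<close> at 0 are real and of constant sign, so
their expectations control moments without cancellation.\<close>

lemma central_fdiff_iexp:
  "(fdiff h ^^ (2 * n)) (\<lambda>s. iexp (s * x)) (- (real n * h)) = complex_of_real ((2 * cos (h * x) - 2) ^ n)"
proof -
  have "iexp (- (real n * h) * x) = iexp (- (h * x)) ^ n"
    by (simp add: exp_of_nat_mult[symmetric] algebra_simps)
  then have "(fdiff h ^^ (2 * n)) (\<lambda>s. iexp (s * x)) (- (real n * h)) = (iexp (- (h * x)) * (iexp (h * x) - 1)\<^sup>2) ^ n"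
    by (simp only: fdiff_funpow_iexp power_mult power_mult_distrib)
  moreover have "iexp (- (h * x)) * (iexp (h * x) - 1)\<^sup>2 = complex_of_real (2 * cos (h * x) - 2)"
  proof -
    have "iexp (- (h * x)) * (iexp (h * x) - 1)\<^sup>2 =
      (iexp (- (h * x)) * iexp (h * x)) * iexp (h * x) - 2 * (iexp (- (h * x)) * iexp (h * x)) + iexp (- (h * x))"
      by (simp add: power2_eq_square algebra_simps)
    also have "iexp (- (h * x)) * iexp (h * x) = 1" by (simp flip: exp_add)
    also have "1 * iexp (h * x) - 2 * 1 + iexp (- (h * x)) = complex_of_real (2 * cos (h * x) - 2)"
      by (simp add: complex_eq_iff Re_exp Im_exp)
    finally show ?thesis .
  qed
  ultimately show ?thesis by simp
qed

context real_distribution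
begin

lemma fdiff_funpow_char:
  "integrable M (\<lambda>x. (fdiff h ^^ m) (\<lambda>s. iexp (s * x)) t) \<and>
   (fdiff h ^^ m) (char M) t = (CLINT x|M. (fdiff h ^^ m) (\<lambda>s. iexp (s * x)) t)"
proof (induction m arbitrary: t)
  case 0
  have "integrable M (\<lambda>x. iexp (t * x))" by (rule integrable_iexp) auto
  then show ?case by (simp add: char_def)
next
  case (Suc m)
  then show ?case by (simp add: fdiff_funpow_Suc del: funpow.simps(2))
qed

text \<open>If the characteristic function agrees near 0 with an entire function \<open>\<psi>\<close>, then all even moments
are finite. The centred difference of order \<open>2n\<close> of the characteristic function is, up to sign,
the expectation of \<open>(2 - 2 cos (h x)) ^ n\<close>, which divided by \<open>h ^ (2n)\<close> tends to \<open>x ^ (2n)\<close> for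
\<open>h \<rightarrow> 0\<close>. The same difference of \<open>\<psi>\<close> is at most \<open>h ^ (2n)\<close> times a bound of its derivative of order
\<open>2n\<close>, for which there is Cauchy's inequality. Fatou's lemma concludes.\<close>

lemma even_moment_le:
  fixes \<psi> :: "complex \<Rightarrow> complex"
  assumes hol: "\<psi> holomorphic_on UNIV" and \<epsilon>: "0 < \<epsilon>"
    and eq: "\<And>t. \<bar>t\<bar> < \<epsilon> \<Longrightarrow> char M t = \<psi> (of_real t)"
    and R: "0 < R" and B: "\<And>z. norm z \<le> R + 1 \<Longrightarrow> norm (\<psi> z) \<le> B"
  shows "(\<integral>\<^sup>+x. ennreal (x ^ (2 * n)) \<partial>M) \<le> ennreal (fact (2 * n) * B / R ^ (2 * n))"
proof -
  define K where "K = fact (2 * n) * B / R ^ (2 * n)"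
  have K: "norm ((deriv ^^ (2 * n)) \<psi> w) \<le> K" if "norm w < 1" for w
    unfolding K_def
  proof (rule Cauchy_inequality)
    show "\<psi> holomorphic_on ball w R" using hol by (rule holomorphic_on_subset) auto
    show "continuous_on (cball w R) \<psi>"
      by (rule holomorphic_on_imp_continuous_on, rule holomorphic_on_subset[OF hol]) simp
    fix x assume "norm (w - x) = R"
    then show "norm (\<psi> x) \<le> B"
      using that norm_triangle_ineq4[of w "w - x"] by (intro B) simp
  qed (rule R)
  have K0: "0 \<le> K" using order_trans[OF norm_ge_zero K[of 0]] by simp
  \<comment> \<open>Any null sequence of steps will do for which the \<open>2 n + 1\<close> nodes stay inside the interval where
    \<open>\<psi>\<close> is known to agree with the characteristic function, and inside the unit disc where \<open>K\<close>
    bounds the derivative.\<close>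
  define h where "h = (\<lambda>k. min 1 \<epsilon> / ((4 * real n + 4) * real (Suc k)))"
  have hpos: "0 < h k" for k using \<epsilon> by (simp add: h_def)
  have hle: "h k \<le> min 1 \<epsilon> / (4 * real n + 4)" for k
  proof -
    have "min 1 \<epsilon> / (4 * real n + 4) / real (Suc k) \<le> min 1 \<epsilon> / (4 * real n + 4) / 1"
      using \<epsilon> by (intro divide_left_mono) auto
    then show ?thesis by (simp add: h_def)
  qed
  have hn: "(4 * real n) * h k < min 1 \<epsilon>" for k
  proof -
    have "(4 * real n) * h k < (4 * real n + 4) * h k" using hpos[of k] by simp
    also have "\<dots> \<le> (4 * real n + 4) * (min 1 \<epsilon> / (4 * real n + 4))"
      using hle[of k] by (intro mult_left_mono) auto
    also have "\<dots> = min 1 \<epsilon>" by (simp add: nonzero_eq_divide_eq)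
    finally show ?thesis .
  qed
  have hlim: "h \<longlonglongrightarrow> 0"
  proof -
    have "(\<lambda>k. (min 1 \<epsilon> / (4 * real n + 4)) * inverse (real (Suc k))) \<longlonglongrightarrow> (min 1 \<epsilon> / (4 * real n + 4)) * 0"
      by (intro tendsto_mult_left LIMSEQ_inverse_real_of_nat)
    then show ?thesis by (simp add: h_def field_simps)
  qed
  define u where "u k x = ((2 - 2 * cos (h k * x)) / (h k)\<^sup>2) ^ n" for k x
  have u0: "0 \<le> u k x" for k x by (simp add: u_def)
  have int_u: "(\<integral>\<^sup>+x. ennreal (u k x) \<partial>M) \<le> ennreal K" for k
  proof -
    let ?D = "\<lambda>x. (fdiff (h k) ^^ (2 * n)) (\<lambda>s. iexp (s * x)) (- (real n * h k))"
    have D: "?D x = complex_of_real ((- ((h k)\<^sup>2)) ^ n * u k x)" for x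
    proof -
      have "2 * cos (h k * x) - 2 = - ((h k)\<^sup>2) * ((2 - 2 * cos (h k * x)) / (h k)\<^sup>2)"
        using hpos[of k] by simp
      then have "(2 * cos (h k * x) - 2) ^ n = (- ((h k)\<^sup>2)) ^ n * u k x"
        unfolding u_def by (simp only: power_mult_distrib)
      then show ?thesis by (simp only: central_fdiff_iexp)
    qed
    have meas: "u k \<in> borel_measurable M" by (simp add: u_def[abs_def])
    have bnd: "\<bar>u k x\<bar> \<le> (4 / (h k)\<^sup>2) ^ n" for x
    proof -
      have "2 - 2 * cos (h k * x) \<le> 4" using cos_ge_minus_one[of "h k * x"] by linarith
      then have "(2 - 2 * cos (h k * x)) / (h k)\<^sup>2 \<le> 4 / (h k)\<^sup>2" by (intro divide_right_mono) auto
      then show ?thesis using u0[of k x] unfolding u_def by (simp add: power_mono)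
    qed
    have iu: "integrable M (u k)"
      by (rule integrable_const_bound[where B = "(4 / (h k)\<^sup>2) ^ n"]) (use meas bnd in auto)
    have "complex_of_real ((- ((h k)\<^sup>2)) ^ n * (LINT x|M. u k x)) = (CLINT x|M. ?D x)"
      unfolding D using iu by simp
    also have "\<dots> = (fdiff (h k) ^^ (2 * n)) (char M) (- (real n * h k))"
      using fdiff_funpow_char by simp
    also have "\<dots> = (fdiff (complex_of_real (h k)) ^^ (2 * n)) \<psi> (of_real (- (real n * h k)))"
    proof (rule fdiff_funpow_cong)
      fix j assume j: "j \<le> 2 * n"
      have "\<bar>- (real n * h k) + real j * h k\<bar> \<le> real n * h k + real j * h k"
      proof -
        have "0 \<le> real n * h k" "0 \<le> real j * h k" using hpos[of k] by auto
        then show ?thesis by linarith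
      qed
      also have "\<dots> \<le> (4 * real n) * h k"
      proof -
        have "real n * h k + real j * h k = (real n + real j) * h k" by (simp add: algebra_simps)
        also have "\<dots> \<le> (4 * real n) * h k" using hpos[of k] j by (intro mult_right_mono) auto
        finally show ?thesis .
      qed
      also have "\<dots> < \<epsilon>" using hn[of k] by simp
      finally show "char M (- (real n * h k) + real j *\<^sub>R h k) =
          \<psi> (of_real (- (real n * h k)) + real j *\<^sub>R complex_of_real (h k))"
        by (simp add: eq scaleR_conv_of_real)
    qed
    finally have "\<bar>(- ((h k)\<^sup>2)) ^ n * (LINT x|M. u k x)\<bar> =
        norm ((fdiff (complex_of_real (h k)) ^^ (2 * n)) \<psi> (of_real (- (real n * h k))))"
      by (metis norm_of_real real_norm_def)
    also have "\<dots> \<le> K * norm (complex_of_real (h k)) ^ (2 * n)"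
    proof (rule norm_fdiff_funpow_le[OF hol K])
      have "norm (complex_of_real (- (real n * h k))) + real (2 * n) * norm (complex_of_real (h k)) = 3 * (real n * h k)"
        using hpos[of k] by (simp add: norm_mult)
      also have "\<dots> \<le> 4 * real n * h k" using hpos[of k] by simp
      also have "\<dots> < 1" using hn[of k] by simp
      finally show "norm (complex_of_real (- (real n * h k))) + real (2 * n) * norm (complex_of_real (h k)) < 1" .
    qed auto
    finally have "\<bar>(- ((h k)\<^sup>2)) ^ n * (LINT x|M. u k x)\<bar> \<le> K * h k ^ (2 * n)"
      using hpos[of k] by simp
    moreover have "\<bar>(- ((h k)\<^sup>2)) ^ n * (LINT x|M. u k x)\<bar> = h k ^ (2 * n) * (LINT x|M. u k x)"
      using u0 by (simp add: abs_mult power_abs[symmetric] power_mult integral_nonneg_AE power_even_abs)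
    ultimately have "(LINT x|M. u k x) \<le> K" using hpos[of k] by (simp add: mult.commute)
    then show ?thesis using iu u0 by (simp add: nn_integral_eq_integral ennreal_leI)
  qed
  have ulim: "(\<lambda>k. u k x) \<longlonglongrightarrow> x ^ (2 * n)" for x
  proof (cases "x = 0")
    case True
    have "u k 0 = 0 ^ (2 * n)" for k by (simp add: u_def power_mult)
    then show ?thesis using True by simp
  next
    case False
    have l: "filterlim (\<lambda>k. h k * x / 2) (at 0) sequentially"
    proof (rule filterlim_atI)
      show "(\<lambda>k. h k * x / 2) \<longlonglongrightarrow> 0"
        using tendsto_mult[OF hlim tendsto_const[of "x / 2"]] by simp
      show "\<forall>\<^sub>F k in sequentially. h k * x / 2 \<noteq> 0" using hpos False by (simp add: less_imp_neq[symmetric])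
    qed
    have "((\<lambda>y::real. sin y / y) \<longlongrightarrow> 1) (at 0)"
      using DERIV_sin[of "0::real"] by (simp add: DERIV_def)
    from filterlim_compose[OF this l]
    have "(\<lambda>k. ((x * (sin (h k * x / 2) / (h k * x / 2)))\<^sup>2) ^ n) \<longlonglongrightarrow> ((x * 1)\<^sup>2) ^ n"
      by (intro tendsto_intros)
    moreover have "u k x = ((x * (sin (h k * x / 2) / (h k * x / 2)))\<^sup>2) ^ n" for k
    proof -
      have "2 - 2 * cos (h k * x) = 4 * (sin (h k * x / 2))\<^sup>2"
        using cos_double_sin[of "h k * x / 2"] by simp
      then have "(2 - 2 * cos (h k * x)) / (h k)\<^sup>2 = (x * (sin (h k * x / 2) / (h k * x / 2)))\<^sup>2"
        using hpos[of k] False by (simp add: field_simps power2_eq_square)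
      then show ?thesis by (simp only: u_def)
    qed
    ultimately show ?thesis by (simp add: power_mult)
  qed
  have "(\<integral>\<^sup>+x. ennreal (x ^ (2 * n)) \<partial>M) = (\<integral>\<^sup>+x. liminf (\<lambda>k. ennreal (u k x)) \<partial>M)"
  proof (rule nn_integral_cong)
    fix x
    have "(\<lambda>k. ennreal (u k x)) \<longlonglongrightarrow> ennreal (x ^ (2 * n))" by (intro tendsto_ennrealI ulim)
    then show "ennreal (x ^ (2 * n)) = liminf (\<lambda>k. ennreal (u k x))"
      by (simp add: lim_imp_Liminf)
  qed
  also have "\<dots> \<le> liminf (\<lambda>k. \<integral>\<^sup>+x. ennreal (u k x) \<partial>M)"
    by (rule nn_integral_liminf) (simp add: u_def[abs_def])
  also have "\<dots> \<le> liminf (\<lambda>k::nat. ennreal K)"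
    by (intro Liminf_mono always_eventually allI int_u)
  also have "\<dots> = ennreal K" by (simp add: Liminf_const)
  finally show ?thesis by (simp add: K_def)
qed

text \<open>The radius \<open>R\<close> in the moment bound is arbitrary, so the series of \<open>E cosh (r x)\<close> is dominated by
a geometric one as soon as \<open>R > 2 r\<close>.\<close>

lemma integrable_exp_abs:
  fixes \<psi> :: "complex \<Rightarrow> complex"
  assumes hol: "\<psi> holomorphic_on UNIV" and \<epsilon>: "0 < \<epsilon>"
    and eq: "\<And>t. \<bar>t\<bar> < \<epsilon> \<Longrightarrow> char M t = \<psi> (of_real t)" and r: "0 \<le> r"
  shows "integrable M (\<lambda>x. exp (r * \<bar>x\<bar>))"
proof -
  define R where "R = 2 * r + 1"
  have R: "0 < R" using r by (simp add: R_def)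
  have "continuous_on (cball 0 (R + 1)) \<psi>"
    by (rule holomorphic_on_imp_continuous_on, rule holomorphic_on_subset[OF hol]) simp
  then have "compact (\<psi> ` cball 0 (R + 1))" by (intro compact_continuous_image compact_cball)
  then have "bounded (\<psi> ` cball 0 (R + 1))" by (rule compact_imp_bounded)
  then obtain B where "\<forall>z\<in>cball 0 (R + 1). norm (\<psi> z) \<le> B"
    unfolding bounded_iff by auto
  then have B: "\<And>z. norm z \<le> R + 1 \<Longrightarrow> norm (\<psi> z) \<le> B" by simp
  have B0: "0 \<le> B" using order_trans[OF norm_ge_zero B[of 0]] R by simp
  define c where "c m x = (if even m then (r * x) ^ m /\<^sub>R fact m else 0)" for m x
  have c0: "0 \<le> c m x" for m x by (simp add: c_def zero_le_even_power)
  have c_int: "(\<integral>\<^sup>+x. ennreal (c m x) \<partial>M) \<le> ennreal (B * (1 / 2) ^ m)" for m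
  proof (cases "even m")
    case True
    then obtain n where m: "m = 2 * n" by (elim evenE)
    have "(\<integral>\<^sup>+x. ennreal (c m x) \<partial>M) = (\<integral>\<^sup>+x. ennreal (r ^ m / fact m) * ennreal (x ^ m) \<partial>M)"
      using True r by (intro nn_integral_cong) (simp add: c_def power_mult_distrib divide_inverse ac_simps zero_le_even_power flip: ennreal_mult)
    also have "\<dots> = ennreal (r ^ m / fact m) * (\<integral>\<^sup>+x. ennreal (x ^ m) \<partial>M)"
      by (rule nn_integral_cmult) auto
    also have "\<dots> \<le> ennreal (r ^ m / fact m) * ennreal (fact m * B / R ^ m)"
      unfolding m by (intro mult_left_mono even_moment_le[OF hol \<epsilon> eq R B]) auto
    also have "\<dots> = ennreal (B * (r / R) ^ m)"
      using r B0 R by (simp add: power_divide flip: ennreal_mult)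
    also have "\<dots> \<le> ennreal (B * (1 / 2) ^ m)"
      using r R B0 by (intro ennreal_leI mult_left_mono power_mono) (auto simp: R_def field_simps)
    finally show ?thesis .
  qed (use B0 in \<open>simp add: c_def\<close>)
  have sums: "(\<lambda>m. c m x) sums cosh (r * x)" for x
    unfolding c_def by (rule cosh_converges)
  have "(\<integral>\<^sup>+x. ennreal (cosh (r * x)) \<partial>M) = (\<integral>\<^sup>+x. (\<Sum>m. ennreal (c m x)) \<partial>M)"
  proof (rule nn_integral_cong)
    fix x
    show "ennreal (cosh (r * x)) = (\<Sum>m. ennreal (c m x))"
      using suminf_ennreal2[OF c0 sums_summable[OF sums[of x]]] sums_unique[OF sums[of x]] by simp
  qed
  also have "\<dots> = (\<Sum>m. \<integral>\<^sup>+x. ennreal (c m x) \<partial>M)"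
    by (rule nn_integral_suminf) (simp add: c_def[abs_def])
  also have "\<dots> \<le> (\<Sum>m. ennreal (B * (1 / 2) ^ m))"
    by (intro suminf_le c_int summableI)
  also have "\<dots> = ennreal (\<Sum>m. B * (1 / 2) ^ m)"
    using B0 by (intro suminf_ennreal2 summable_mult summable_geometric) auto
  also have "\<dots> < \<infinity>" by simp
  finally have fin: "(\<integral>\<^sup>+x. ennreal (cosh (r * x)) \<partial>M) < \<infinity>" .
  have cm: "(\<lambda>x. cosh (r * x)) \<in> borel_measurable M"
    by (simp add: cosh_def)
  have "integrable M (\<lambda>x. 2 * cosh (r * x))"
    using fin cm by (intro integrable_mult_right integrableI_nonneg) (auto simp: cosh_real_nonneg)
  then show ?thesis
  proof (rule Bochner_Integration.integrable_bound)
    show "AE x in M. norm (exp (r * \<bar>x\<bar>)) \<le> norm (2 * cosh (r * x))"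
    proof (rule AE_I2)
      fix x
      have "exp (r * \<bar>x\<bar>) \<le> 2 * cosh (r * x)"
        by (cases "x \<ge> 0") (auto simp: cosh_def)
      then show "norm (exp (r * \<bar>x\<bar>)) \<le> norm (2 * cosh (r * x))" by simp
    qed
  qed simp
qed

text \<open>The expectation can be taken term by term in the exponential series.\<close>

lemma holomorphic_laplace_transform:
  assumes int: "\<And>r. 0 \<le> r \<Longrightarrow> integrable M (\<lambda>x. exp (r * \<bar>x\<bar>))"
  shows "(\<lambda>z. CLINT x|M. exp (\<i> * z * complex_of_real x)) holomorphic_on UNIV"
proof -
  define a where "a n = (\<i> ^ n / fact n) * (CLINT x|M. complex_of_real x ^ n)" for n
  have pw: "\<bar>x\<bar> ^ n \<le> fact n * exp (1 * \<bar>x\<bar>)" for n and x :: real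
  proof -
    have "\<bar>x\<bar> ^ n / fact n \<le> exp \<bar>x\<bar>"
      using sum_le_suminf[OF summable_exp_generic[of "\<bar>x\<bar>"], of "{n}"]
      by (simp add: exp_def divide_inverse mult.commute)
    then show ?thesis by (simp add: field_simps)
  qed
  have intp: "integrable M (\<lambda>x. complex_of_real x ^ n)" for n
  proof (rule Bochner_Integration.integrable_bound)
    show "integrable M (\<lambda>x. fact n * exp (1 * \<bar>x\<bar>))" by (intro integrable_mult_right int) simp
  qed (use pw in \<open>auto simp: norm_power\<close>)
  have series: "(\<lambda>n. a n * z ^ n) sums (CLINT x|M. exp (\<i> * z * complex_of_real x))" for z
  proof -
    let ?f = "\<lambda>n x. (\<i> * z * complex_of_real x) ^ n /\<^sub>R fact n"
    have f: "?f n x = (\<i> ^ n / fact n * z ^ n) * complex_of_real x ^ n" for n x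
      by (simp add: scaleR_conv_of_real power_mult_distrib field_simps)
    have nf: "norm (?f n x) = (norm z * \<bar>x\<bar>) ^ n /\<^sub>R fact n" for n and x :: real
      by (simp add: norm_mult norm_power power_mult_distrib)
    have intf: "integrable M (?f n)" for n unfolding f by (intro integrable_mult_right intp)
    have "(\<lambda>n. CLINT x|M. ?f n x) sums (CLINT x|M. (\<Sum>n. ?f n x))"
    proof (rule sums_integral[OF intf])
      show "AE x in M. summable (\<lambda>n. norm (?f n x))"
        unfolding nf by (intro AE_I2 summable_exp_generic)
      show "summable (\<lambda>n. LINT x|M. norm (?f n x))"
      proof (rule summableI_nonneg_bounded)
        fix N
        have "(\<Sum>n<N. LINT x|M. norm (?f n x)) = (LINT x|M. (\<Sum>n<N. norm (?f n x)))"
          by (rule Bochner_Integration.integral_sum[symmetric], rule integrable_norm[OF intf])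
        also have "\<dots> \<le> (LINT x|M. exp (norm z * \<bar>x\<bar>))"
        proof (rule integral_mono)
          show "integrable M (\<lambda>x. \<Sum>n<N. norm (?f n x))"
            by (intro Bochner_Integration.integrable_sum integrable_norm intf)
          show "integrable M (\<lambda>x. exp (norm z * \<bar>x\<bar>))" by (intro int) simp
          show "(\<Sum>n<N. norm (?f n x)) \<le> exp (norm z * \<bar>x\<bar>)" for x
            unfolding nf exp_def by (intro sum_le_suminf summable_exp_generic) auto
        qed
        finally show "(\<Sum>n<N. LINT x|M. norm (?f n x)) \<le> (LINT x|M. exp (norm z * \<bar>x\<bar>))" .
      qed (intro integral_nonneg_AE; simp)
    qed
    moreover have "(CLINT x|M. ?f n x) = a n * z ^ n" for n
      unfolding f a_def by (simp add: intp)
    ultimately show ?thesis by (simp add: exp_def)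
  qed
  have "(\<lambda>z. CLINT x|M. exp (\<i> * z * complex_of_real x)) holomorphic_on ball 0 r" for r
    by (rule power_series_holomorphic[where a = a]) (use series in auto)
  then have "(\<lambda>z. CLINT x|M. exp (\<i> * z * complex_of_real x)) field_differentiable at z" for z
    by (intro holomorphic_on_imp_differentiable_at[where s = "ball 0 (norm z + 1)"]) auto
  then show ?thesis by (simp add: holomorphic_on_def)
qed

end

text \<open>Among the \<open>n\<close> solutions of \<open>c * w ^ n = \<bar>c\<bar>\<close> at most two are purely imaginary. The argument is
explicit: a root on the imaginary axis is rotated off it by the angle \<open>2 \<pi> / n < \<pi>\<close>.\<close>

lemma rotated_root:
  fixes c :: complex
  assumes "c \<noteq> 0" "3 \<le> n"
  shows "\<exists>w. norm w = 1 \<and> Re w \<noteq> 0 \<and> c * w ^ n = of_real (norm c)"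
proof -
  define \<theta> where "\<theta> = - Arg c / n"
  define w where "w \<alpha> = cis (\<theta> + \<alpha>)" for \<alpha>
  have c: "c = of_real (norm c) * cis (Arg c)" by (metis rcis_cmod_Arg rcis_def)
  have root: "c * w \<alpha> ^ n = of_real (norm c)" if "cis (n * \<alpha>) = 1" for \<alpha> :: real
  proof -
    have "w \<alpha> ^ n = cis (real n * (\<theta> + \<alpha>))" by (simp add: w_def Complex.DeMoivre)
    also have "real n * (\<theta> + \<alpha>) = - Arg c + n * \<alpha>" using assms by (simp add: \<theta>_def field_simps)
    also have "cis \<dots> = cis (- Arg c)" using that by (simp only: cis_mult[symmetric] mult_1_right)
    finally have "c * w \<alpha> ^ n = of_real (norm c) * (cis (Arg c) * cis (- Arg c))"
      by (subst c) (simp add: mult.assoc)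
    then show ?thesis by (simp add: cis_mult)
  qed
  show ?thesis
  proof (cases "Re (w 0) = 0")
    case False
    then show ?thesis using root[of 0] by (intro exI[of _ "w 0"]) (auto simp: w_def)
  next
    case True
    let ?\<alpha> = "2 * pi / n"
    have "cos \<theta> = 0" using True by (simp add: w_def)
    then have "sin \<theta> \<noteq> 0" using sin_cos_squared_add[of \<theta>] by auto
    moreover have "0 < ?\<alpha>" "?\<alpha> < pi" using assms pi_gt_zero by (auto simp: field_simps)
    then have "sin ?\<alpha> > 0" by (rule sin_gt_zero)
    ultimately have "Re (w ?\<alpha>) \<noteq> 0" using \<open>cos \<theta> = 0\<close> by (simp add: w_def cos_add)
    moreover have "cis (n * ?\<alpha>) = 1" using assms by simp
    ultimately show ?thesis using root[of ?\<alpha>] by (intro exI[of _ "w ?\<alpha>"]) (auto simp: w_def)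
  qed
qed

text \<open>Let \<open>c\<close> be the leading coefficient and \<open>n\<close> the degree. Along the ray through a unit vector \<open>w\<close>
with \<open>c * w ^ n = \<bar>c\<bar>\<close> the left-hand side grows like \<open>\<bar>c\<bar> r ^ n\<close>, the right-hand side at most like
\<open>\<bar>c\<bar> \<bar>Im w\<bar> ^ n r ^ n\<close>. If \<open>n \<ge> 3\<close>, then \<open>w\<close> can be chosen off the imaginary axis, where
\<open>\<bar>Im w\<bar> < 1\<close>.\<close>

lemma degree_le_2_of_ridge:
  fixes p :: "complex poly"
  assumes ridge: "\<And>z. Re (poly p z) \<le> Re (poly p (\<i> * of_real (Im z)))"
  shows "degree p \<le> 2"
proof (rule ccontr)
  assume "\<not> degree p \<le> 2"
  define n where "n = degree p"
  have n: "3 \<le> n" using \<open>\<not> degree p \<le> 2\<close> by (simp add: n_def)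
  define c where "c = lead_coeff p"
  have c: "c \<noteq> 0" using n by (auto simp: c_def n_def)
  obtain w where w: "norm w = 1" "Re w \<noteq> 0" "c * w ^ n = of_real (norm c)"
    using rotated_root[OF c n] by blast
  \<comment> \<open>Along the ray through \<open>w\<close> the difference of the two sides of the hypothesis is a real polynomial
    \<open>q\<close> in the distance from 0; its leading coefficient turns out to be positive.\<close>
  define d where "d k = Re (coeff p k * w ^ k) - Re (coeff p k * (\<i> * of_real (Im w)) ^ k)" for k
  define q where "q = (\<Sum>k\<le>n. monom (d k) k)"
  have pq: "poly q r = Re (poly p (of_real r * w)) - Re (poly p (\<i> * of_real (Im (of_real r * w))))" for r
  proof -
    have "Re (coeff p k * (of_real r * w) ^ k) - Re (coeff p k * (\<i> * of_real (Im (of_real r * w))) ^ k) = d k * r ^ k" for k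
    proof -
      have "coeff p k * (of_real r * w) ^ k = of_real (r ^ k) * (coeff p k * w ^ k)"
        by (simp add: power_mult_distrib)
      moreover have "coeff p k * (\<i> * of_real (Im (of_real r * w))) ^ k = of_real (r ^ k) * (coeff p k * (\<i> * of_real (Im w)) ^ k)"
        by (simp add: power_mult_distrib)
      ultimately show ?thesis by (simp add: d_def algebra_simps del: of_real_power)
    qed
    then show ?thesis
      by (simp add: q_def poly_sum poly_monom poly_altdef[of p] n_def[symmetric] flip: sum_subtractf)
  qed
  have "\<bar>Im w\<bar> < 1"
  proof -
    have "(Re w)\<^sup>2 + (Im w)\<^sup>2 = 1" using w(1) by (simp add: cmod_def)
    moreover have "(Re w)\<^sup>2 > 0" using w(2) by simp
    ultimately have "(Im w)\<^sup>2 < 1" by linarith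
    then show ?thesis by (simp add: abs_square_less_1)
  qed
  then have "\<bar>Im w\<bar> ^ n < 1" using n by (simp add: power_less_one_iff)
  moreover have "Re (c * (\<i> * of_real (Im w)) ^ n) \<le> norm c * \<bar>Im w\<bar> ^ n"
    using complex_Re_le_cmod[of "c * (\<i> * of_real (Im w)) ^ n"] by (simp add: norm_mult norm_power)
  moreover have "norm c * \<bar>Im w\<bar> ^ n < norm c" if "\<bar>Im w\<bar> ^ n < 1"
    using mult_strict_left_mono[OF that, of "norm c"] c by simp
  ultimately have "Re (c * (\<i> * of_real (Im w)) ^ n) < norm c" by linarith
  moreover have "d n = norm c - Re (c * (\<i> * of_real (Im w)) ^ n)"
    using w(3) by (simp only: d_def c_def n_def Re_complex_of_real)
  ultimately have dn: "d n > 0" by simp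
  have cq: "coeff q k = (if k \<le> n then d k else 0)" for k
    by (simp add: q_def coeff_sum)
  have "degree q = n"
    by (rule antisym[OF degree_le le_degree]) (use cq dn in auto)
  then have "lead_coeff q > 0" using cq dn by simp
  then obtain r where "poly q r \<ge> lead_coeff q" using poly_pinfty_gt_lc by blast
  then have "poly q r > 0" using \<open>lead_coeff q > 0\<close> by simp
  then show False using pq[of r] ridge[of "of_real r * w"] by simp
qed

text \<open>The transform \<open>F z = E exp (\<i> z x)\<close> and \<open>exp (p z)\<close> are entire and agree near 0 on the real axis,
hence everywhere. Since \<open>\<bar>F z\<bar> \<le> F (\<i> Im z)\<close>, the degree of \<open>p\<close> is at most 2. The symmetry
\<open>char M (-t) = cnj (char M t)\<close> and the bound \<open>\<bar>char M t\<bar> \<le> 1\<close> then force the coefficients to be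
those of a Gaussian law.\<close>

theorem (in real_distribution) Marcinkiewicz:
  assumes \<epsilon>: "0 < \<epsilon>" and eq: "\<And>t. \<bar>t\<bar> < \<epsilon> \<Longrightarrow> char M t = exp (poly p (of_real t))"
  shows "\<exists>m v. 0 \<le> v \<and> (\<forall>t. char M t = exp (\<i> * complex_of_real (t * m) - complex_of_real (v * t\<^sup>2) / 2))"
proof -
  define \<psi> where "\<psi> z = exp (poly p z)" for z
  have hol: "\<psi> holomorphic_on UNIV" unfolding \<psi>_def by (intro holomorphic_intros)
  have eq': "\<And>t. \<bar>t\<bar> < \<epsilon> \<Longrightarrow> char M t = \<psi> (of_real t)" using eq by (simp add: \<psi>_def)
  note int = integrable_exp_abs[OF hol \<epsilon> eq']
  define F where "F z = (CLINT x|M. exp (\<i> * z * complex_of_real x))" for z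
  have holF: "F holomorphic_on UNIV" unfolding F_def by (rule holomorphic_laplace_transform[OF int])
  have F_char: "F (of_real t) = char M t" for t by (simp add: F_def char_def mult.assoc)
  have F: "F z = \<psi> z" for z
  proof -
    have "F z - \<psi> z = 0"
    proof (rule analytic_continuation[where f = "\<lambda>z. F z - \<psi> z" and S = UNIV and U = "of_real ` {0<..<\<epsilon>}" and \<xi> = 0])
      show "(\<lambda>z. F z - \<psi> z) holomorphic_on UNIV" by (intro holomorphic_intros holF hol)
      show "(0::complex) islimpt of_real ` {0<..<\<epsilon>}"
        unfolding islimpt_approachable
      proof (intro allI impI)
        fix e :: real assume "0 < e"
        then show "\<exists>x'\<in>complex_of_real ` {0<..<\<epsilon>}. x' \<noteq> 0 \<and> dist x' 0 < e"
          using \<epsilon> by (intro bexI[of _ "of_real (min e \<epsilon> / 2)"] imageI) (auto simp del: of_real_divide)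
      qed
    qed (use F_char eq' in auto)
    then show ?thesis by simp
  qed
  have "Re (poly p z) \<le> Re (poly p (\<i> * of_real (Im z)))" for z
  proof -
    have n: "norm (exp (\<i> * z * complex_of_real x)) = exp (- Im z * x)" for z and x :: real
      by (simp add: norm_exp_eq_Re)
    have e: "exp (\<i> * (\<i> * complex_of_real (Im z)) * complex_of_real x) = complex_of_real (exp (- Im z * x))" for x
      by (simp add: exp_of_real[symmetric] mult.assoc[symmetric])
    have "norm (F z) \<le> (LINT x|M. norm (exp (\<i> * z * complex_of_real x)))"
      unfolding F_def by (rule integral_norm_bound)
    also have "\<dots> = (LINT x|M. exp (- Im z * x))" unfolding n ..
    also have "\<dots> \<le> norm (complex_of_real (LINT x|M. exp (- Im z * x)))" by simp
    also have "complex_of_real (LINT x|M. exp (- Im z * x)) = F (\<i> * of_real (Im z))"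
      unfolding F_def e by simp
    finally have "exp (Re (poly p z)) \<le> exp (Re (poly p (\<i> * of_real (Im z))))"
      unfolding F \<psi>_def norm_exp_eq_Re .
    then show ?thesis by simp
  qed
  then have "degree p \<le> 2" by (rule degree_le_2_of_ridge)
  then have "p = (\<Sum>i\<le>2. monom (coeff p i) i)" by (simp add: poly_as_sum_of_monoms')
  then have "poly p z = poly (\<Sum>i\<le>2. monom (coeff p i) i) z" for z by simp
  then have pz: "poly p z = coeff p 0 + coeff p 1 * z + coeff p 2 * z\<^sup>2" for z
    by (simp add: poly_sum poly_monom numeral_2_eq_2)
  define b c where "b = coeff p 1" and "c = coeff p 2"
  have char_p: "char M t = exp (poly p (of_real t))" for t
    using F[of "of_real t"] F_char[of t] by (simp add: \<psi>_def)
  have "exp (coeff p 0) = 1" using char_p[of 0] char_zero pz[of 0] by simp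
  then have ch: "char M t = exp (b * of_real t + c * (of_real t)\<^sup>2)" for t
    unfolding char_p pz b_def c_def by (simp add: exp_add)
  \<comment> \<open>The conjugate symmetry of characteristic functions, written as an identity for the exponents.\<close>
  have sym: "exp (complex_of_real (2 * t * Re b) - \<i> * complex_of_real (2 * t\<^sup>2 * Im c)) = 1" for t
  proof -
    have "char M (- t) = cnj (char M t)"
      unfolding char_def by (simp add: Bochner_Integration.integral_cnj[symmetric] exp_cnj del: Bochner_Integration.integral_cnj)
    then have "exp (- b * of_real t + c * (of_real t)\<^sup>2) = exp (cnj b * of_real t + cnj c * (of_real t)\<^sup>2)"
      unfolding ch by (simp add: exp_cnj)
    then have "exp ((cnj b * of_real t + cnj c * (of_real t)\<^sup>2) - (- b * of_real t + c * (of_real t)\<^sup>2)) = 1"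
      by (subst exp_diff) simp
    also have "(cnj b * of_real t + cnj c * (of_real t)\<^sup>2) - (- b * of_real t + c * (of_real t)\<^sup>2) =
       complex_of_real (2 * t * Re b) - \<i> * complex_of_real (2 * t\<^sup>2 * Im c)"
      by (simp add: complex_eq_iff power2_eq_square algebra_simps)
    finally show ?thesis .
  qed
  have b0: "Re b = 0"
    using arg_cong[OF sym[of 1], of norm] by (simp add: norm_exp_eq_Re)
  have c0: "Im c = 0"
  proof (rule ccontr)
    assume "Im c \<noteq> 0"
    \<comment> \<open>At this \<open>t\<close> the identity would read \<open>-1 = 1\<close>.\<close>
    define t where "t = sqrt (pi / (2 * \<bar>Im c\<bar>))"
    have "2 * t\<^sup>2 * \<bar>Im c\<bar> = pi" using \<open>Im c \<noteq> 0\<close> pi_ge_zero by (simp add: t_def)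
    then have "2 * t\<^sup>2 * Im c = pi \<or> 2 * t\<^sup>2 * Im c = - pi" by (auto simp: abs_if split: if_splits)
    then have "exp (- (\<i> * complex_of_real (2 * t\<^sup>2 * Im c))) = -1"
    proof
      assume *: "2 * t\<^sup>2 * Im c = pi"
      show ?thesis unfolding * exp_minus by simp
    next
      assume *: "2 * t\<^sup>2 * Im c = - pi"
      show ?thesis unfolding * by simp
    qed
    moreover have "exp (- (\<i> * complex_of_real (2 * t\<^sup>2 * Im c))) = 1" using sym[of t] b0 by simp
    ultimately show False by simp
  qed
  have "exp (Re c) \<le> 1"
    using cmod_char_le_1[of 1] b0 unfolding ch norm_exp_eq_Re by simp
  then have "Re c \<le> 0" by simp
  moreover
  have "b * of_real t + c * (of_real t)\<^sup>2 = \<i> * complex_of_real (t * Im b) - complex_of_real (- 2 * Re c * t\<^sup>2) / 2" for t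
    using b0 c0 by (simp add: complex_eq_iff power2_eq_square)
  ultimately show ?thesis
    by (intro exI[of _ "Im b"] exI[of _ "- 2 * Re c"]) (simp add: ch)
qed

section \<open>Product spaces and independence\<close>

lemma integral_pair_mult:
  fixes f :: "'a \<Rightarrow> complex" and g :: "'b \<Rightarrow> complex"
  assumes "prob_space M" "prob_space N"
    and [measurable]: "f \<in> borel_measurable M" "g \<in> borel_measurable N"
    and bnd: "\<And>x. norm (f x) \<le> 1" "\<And>y. norm (g y) \<le> 1"
  shows "(LINT \<omega>|(M \<Otimes>\<^sub>M N). f (fst \<omega>) * g (snd \<omega>)) = (LINT x|M. f x) * (LINT y|N. g y)"
proof -
  interpret M: prob_space M by fact
  interpret N: prob_space N by fact
  interpret pair_prob_space M N ..
  have "integrable (M \<Otimes>\<^sub>M N) (\<lambda>(x, y). f x * g y)"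
  proof (rule integrable_const_bound[of _ 1])
    show "AE x in M \<Otimes>\<^sub>M N. norm (case x of (x, y) \<Rightarrow> f x * g y) \<le> 1"
      using bnd by (intro AE_I2) (auto simp: norm_mult intro!: mult_le_one)
  qed simp
  from integral_fst[OF this]
  have "(LINT \<omega>|(M \<Otimes>\<^sub>M N). (case \<omega> of (x, y) \<Rightarrow> f x * g y)) = (LINT x|M. f x * (LINT y|N. g y))"
    by simp
  then show ?thesis by (simp add: case_prod_beta)
qed

lemma distr_pair_fst:
  assumes "prob_space M" "prob_space N"
  shows "distr (M \<Otimes>\<^sub>M N) M fst = M"
proof (rule measure_eqI)
  interpret N: prob_space N by fact
  fix A assume "A \<in> sets (distr (M \<Otimes>\<^sub>M N) M fst)"
  then have A: "A \<in> sets M" by simp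
  have "fst -` A \<inter> space (M \<Otimes>\<^sub>M N) = A \<times> space N"
    using sets.sets_into_space[OF A] by (auto simp: space_pair_measure)
  then show "emeasure (distr (M \<Otimes>\<^sub>M N) M fst) A = emeasure M A"
    using A by (simp add: emeasure_distr N.emeasure_pair_measure_Times N.emeasure_space_1)
qed simp

lemma distr_pair_snd:
  assumes "prob_space M" "prob_space N"
  shows "distr (M \<Otimes>\<^sub>M N) N snd = N"
proof (rule measure_eqI)
  interpret M: prob_space M by fact
  interpret N: prob_space N by fact
  fix A assume "A \<in> sets (distr (M \<Otimes>\<^sub>M N) N snd)"
  then have A: "A \<in> sets N" by simp
  have "snd -` A \<inter> space (M \<Otimes>\<^sub>M N) = space M \<times> A"
    using sets.sets_into_space[OF A] by (auto simp: space_pair_measure)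
  then show "emeasure (distr (M \<Otimes>\<^sub>M N) N snd) A = emeasure N A"
    using A by (simp add: emeasure_distr N.emeasure_pair_measure_Times M.emeasure_space_1)
qed simp

lemma integral_pair_fst:
  fixes f :: "'a \<Rightarrow> 'c::{banach, second_countable_topology}"
  assumes "prob_space M" "prob_space N" "f \<in> borel_measurable M"
  shows "(LINT \<omega>|(M \<Otimes>\<^sub>M N). f (fst \<omega>)) = (LINT x|M. f x)"
  using integral_distr[of fst "M \<Otimes>\<^sub>M N" M f] distr_pair_fst[OF assms(1,2)] assms(3) by simp

lemma integral_pair_snd:
  fixes f :: "'b \<Rightarrow> 'c::{banach, second_countable_topology}"
  assumes "prob_space M" "prob_space N" "f \<in> borel_measurable N"
  shows "(LINT \<omega>|(M \<Otimes>\<^sub>M N). f (snd \<omega>)) = (LINT x|N. f x)"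
  using integral_distr[of snd "M \<Otimes>\<^sub>M N" N f] distr_pair_snd[OF assms(1,2)] assms(3) by simp

lemma indep_rv_pair:
  assumes "prob_space M" "prob_space N"
    and [measurable]: "F \<in> borel_measurable M" "H \<in> borel_measurable N"
  shows "indep_rv (M \<Otimes>\<^sub>M N) (\<lambda>\<omega>. H (snd \<omega>)) (\<lambda>\<omega>. F (fst \<omega>))"
proof -
  interpret M: prob_space M by fact
  interpret N: prob_space N by fact
  interpret P: pair_prob_space M N ..
  show ?thesis
    unfolding indep_rv_def
  proof (intro conjI P.P.indep_setI)
    fix a b
    assume "a \<in> {(\<lambda>\<omega>. H (snd \<omega>)) -` S \<inter> space (M \<Otimes>\<^sub>M N) |S. S \<in> sets borel}"
      "b \<in> {(\<lambda>\<omega>. F (fst \<omega>)) -` S \<inter> space (M \<Otimes>\<^sub>M N) |S. S \<in> sets borel}"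
    then obtain S T where S: "S \<in> sets borel" "a = (\<lambda>\<omega>. H (snd \<omega>)) -` S \<inter> space (M \<Otimes>\<^sub>M N)"
      and T: "T \<in> sets borel" "b = (\<lambda>\<omega>. F (fst \<omega>)) -` T \<inter> space (M \<Otimes>\<^sub>M N)" by blast
    define S' where "S' = H -` S \<inter> space N"
    define T' where "T' = F -` T \<inter> space M"
    have sets: "S' \<in> sets N" "T' \<in> sets M" using S T by (auto simp: S'_def T'_def)
    have "a = space M \<times> S'" "b = T' \<times> space N" "a \<inter> b = T' \<times> S'"
      using S T by (auto simp: S'_def T'_def space_pair_measure)
    then show "P.prob (a \<inter> b) = P.prob a * P.prob b"
      using sets by (simp add: measure_def N.emeasure_pair_measure_Times M.emeasure_space_1 N.emeasure_space_1 enn2real_mult)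
  qed auto
qed

text \<open>The complex-valued \<open>f (X \<omega>)\<close> and \<open>g (Y \<omega>)\<close> inherit independence, because their preimages are
preimages under \<open>X\<close> and \<open>Y\<close>. Unlike \<open>X\<close> and \<open>Y\<close> they have a common type, so the product rule for
expectations applies to them.\<close>

lemma indep_rv_integral_mult:
  fixes X :: "'a \<Rightarrow> 'b::topological_space" and Y :: "'a \<Rightarrow> 'c::topological_space"
    and f :: "'b \<Rightarrow> complex" and g :: "'c \<Rightarrow> complex"
  assumes "prob_space M" and ind: "indep_rv M X Y"
    and [measurable]: "f \<in> borel_measurable borel" "g \<in> borel_measurable borel"
    and bnd: "\<And>x. norm (f x) \<le> 1" "\<And>y. norm (g y) \<le> 1"
  shows "(LINT \<omega>|M. f (X \<omega>) * g (Y \<omega>)) = (LINT \<omega>|M. f (X \<omega>)) * (LINT \<omega>|M. g (Y \<omega>))"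
proof -
  interpret prob_space M by fact
  have [measurable]: "X \<in> borel_measurable M" "Y \<in> borel_measurable M"
    using ind by (auto simp: indep_rv_def)
  let ?A = "{X -` S \<inter> space M | S. S \<in> sets borel}" and ?B = "{Y -` T \<inter> space M | T. T \<in> sets borel}"
  let ?A' = "{(\<lambda>\<omega>. f (X \<omega>)) -` S \<inter> space M | S. S \<in> sets borel}"
  let ?B' = "{(\<lambda>\<omega>. g (Y \<omega>)) -` S \<inter> space M | S. S \<in> sets borel}"
  have AB: "indep_set ?A ?B" using ind by (simp add: indep_rv_def)
  have sub: "?A' \<subseteq> ?A" "?B' \<subseteq> ?B"
  proof safe
    fix S :: "complex set" assume S: "S \<in> sets borel"
    show "\<exists>T. (\<lambda>\<omega>. f (X \<omega>)) -` S \<inter> space M = X -` T \<inter> space M \<and> T \<in> sets borel"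
      using measurable_sets[OF assms(3) S] by (intro exI[of _ "f -` S"]) auto
    show "\<exists>T. (\<lambda>\<omega>. g (Y \<omega>)) -` S \<inter> space M = Y -` T \<inter> space M \<and> T \<in> sets borel"
      using measurable_sets[OF assms(4) S] by (intro exI[of _ "g -` S"]) auto
  qed
  have stable: "Int_stable {Z -` S \<inter> space M | S. S \<in> sets borel}" for Z :: "'a \<Rightarrow> complex"
  proof (rule Int_stableI)
    fix a b assume "a \<in> {Z -` S \<inter> space M | S. S \<in> sets borel}" "b \<in> {Z -` S \<inter> space M | S. S \<in> sets borel}"
    then obtain S T where "S \<in> sets borel" "T \<in> sets borel" "a = Z -` S \<inter> space M" "b = Z -` T \<inter> space M" by blast
    then show "a \<inter> b \<in> {Z -` S \<inter> space M | S. S \<in> sets borel}"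
      by (intro CollectI exI[of _ "S \<inter> T"]) auto
  qed
  have "indep_set ?A' ?B'"
  proof (rule indep_setI)
    show "?A' \<subseteq> events" "?B' \<subseteq> events"
      using sub indep_setD_ev1[OF AB] indep_setD_ev2[OF AB] by (meson subset_trans)+
    show "prob (a \<inter> b) = prob a * prob b" if "a \<in> ?A'" "b \<in> ?B'" for a b
      by (rule indep_setD[OF AB subsetD[OF sub(1) that(1)] subsetD[OF sub(2) that(2)]])
  qed
  then have "indep_set (sigma_sets (space M) ?A') (sigma_sets (space M) ?B')"
    by (rule indep_set_sigma_sets) (rule stable)+
  then have "indep_var borel (\<lambda>\<omega>. f (X \<omega>)) borel (\<lambda>\<omega>. g (Y \<omega>))"
    unfolding indep_var_eq by simp
  then show ?thesis
    by (rule indep_var_lebesgue_integral) (auto intro!: integrable_const_bound[of _ 1] simp: bnd)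
qed

section \<open>Uniqueness of characteristic functions of random vectors\<close>

lemma norm_iexp [simp]: "norm (iexp x) = 1"
  using norm_exp_i_times[of x] by simp

text \<open>For a positive weight this is the one-dimensional uniqueness theorem, applied to the law of \<open>X\<close>
under the measure with normalised density \<open>w\<close>. The lower bound 1 keeps the normalising constant
positive.\<close>

lemma weighted_char_determines_indicator_integral_nonneg:
  fixes w :: "'a \<Rightarrow> real" and X :: "'a \<Rightarrow> real"
  assumes "prob_space M" "prob_space N"
    and mM [measurable]: "X \<in> borel_measurable M" "w \<in> borel_measurable M"
    and mN [measurable]: "X \<in> borel_measurable N" "w \<in> borel_measurable N"
    and w: "\<And>x. 1 \<le> w x" "\<And>x. w x \<le> K"
    and eq: "\<And>t. (LINT x|M. complex_of_real (w x) * iexp (t * X x)) = (LINT x|N. complex_of_real (w x) * iexp (t * X x))"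
    and A [measurable]: "A \<in> sets borel"
  shows "(LINT x|M. w x * indicator A (X x)) = (LINT x|N. w x * indicator A (X x))"
proof -
  define c where "c = (LINT x|M. w x)"
  have wK: "\<bar>w x\<bar> \<le> K" for x using w[of x] by simp
  have law: "real_distribution (distr (density M (\<lambda>x. ennreal (w x / c))) borel X) \<and>
      (\<forall>t. char (distr (density M (\<lambda>x. ennreal (w x / c))) borel X) t = (LINT x|M. complex_of_real (w x) * iexp (t * X x)) / c) \<and>
      measure (distr (density M (\<lambda>x. ennreal (w x / c))) borel X) A = (LINT x|M. w x * indicator A (X x)) / c"
    if "prob_space M" "c = (LINT x|M. w x)"
      and [measurable]: "X \<in> borel_measurable M" "w \<in> borel_measurable M"
    for M c
  proof -
    interpret prob_space M by fact
    have iw: "integrable M w"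
      by (rule integrable_const_bound[of _ K]) (use wK in auto)
    have "(LINT x|M. 1) \<le> (LINT x|M. w x)" by (intro integral_mono iw) (use w in auto)
    then have c: "1 \<le> c" by (simp add: that prob_space)
    have w0: "0 \<le> w x / c" for x using w(1)[of x] c by simp
    let ?D = "density M (\<lambda>x. ennreal (w x / c))"
    have "emeasure ?D (space ?D) = (\<integral>\<^sup>+x. ennreal (w x / c) \<partial>M)"
      by (subst emeasure_density) (auto intro!: nn_integral_cong)
    also have "\<dots> = ennreal (LINT x|M. w x / c)"
      using iw w0 by (intro nn_integral_eq_integral) auto
    also have "(LINT x|M. w x / c) = 1" using c by (simp add: that)
    finally have "prob_space ?D" by (intro prob_spaceI) simp
    then interpret D: prob_space ?D .
    have "real_distribution (distr ?D borel X)" by (intro D.real_distribution_distr) simp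
    moreover have "char (distr ?D borel X) t = (LINT x|M. complex_of_real (w x) * iexp (t * X x)) / c" for t
    proof -
      have "char (distr ?D borel X) t = (LINT x|?D. iexp (t * X x))"
        unfolding char_def by (rule integral_distr) auto
      also have "\<dots> = (LINT x|M. (w x / c) *\<^sub>R iexp (t * X x))"
        by (rule integral_density) (use w0 in auto)
      also have "\<dots> = (LINT x|M. (complex_of_real (w x) * iexp (t * X x)) / c)"
        by (intro Bochner_Integration.integral_cong) (auto simp: scaleR_conv_of_real)
      finally show ?thesis by simp
    qed
    moreover have "measure (distr ?D borel X) A = (LINT x|M. w x * indicator A (X x)) / c"
    proof -
      have "measure (distr ?D borel X) A = (LINT x|distr ?D borel X. indicator A x)" by simp
      also have "\<dots> = (LINT x|?D. indicator A (X x))"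
        by (rule integral_distr) auto
      also have "\<dots> = (LINT x|M. (w x / c) *\<^sub>R indicator A (X x))"
        by (rule integral_density) (use w0 in auto)
      finally show ?thesis by simp
    qed
    ultimately show ?thesis by blast
  qed
  have "complex_of_real (LINT x|M. w x) = complex_of_real (LINT x|N. w x)"
    using eq[of 0] by simp
  then have c: "c = (LINT x|N. w x)" by (simp add: c_def)
  note LM = law[OF assms(1) c_def mM] and LN = law[OF assms(2) c mN]
  have "distr (density M (\<lambda>x. ennreal (w x / c))) borel X = distr (density N (\<lambda>x. ennreal (w x / c))) borel X"
    using LM LN eq by (intro Levy_uniqueness) auto
  then have "(LINT x|M. w x * indicator A (X x)) / c = (LINT x|N. w x * indicator A (X x)) / c"
    using LM[THEN conjunct2, THEN conjunct2] LN[THEN conjunct2, THEN conjunct2] by metis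
  moreover have "c \<noteq> 0"
  proof -
    interpret prob_space M by fact
    have "integrable M w"
      by (rule integrable_const_bound[of _ K]) (use wK in auto)
    then have "(LINT x|M. 1) \<le> (LINT x|M. w x)" by (intro integral_mono) (use w in auto)
    then show ?thesis by (simp add: c_def prob_space)
  qed
  ultimately show ?thesis by simp
qed

text \<open>The weight \<open>y\<close> is shifted by 2 to make it positive; the shift is subtracted again by the
unweighted case.\<close>

lemma weighted_char_determines_indicator_integral_real:
  fixes y :: "'a \<Rightarrow> real" and X :: "'a \<Rightarrow> real"
  assumes "prob_space M" "prob_space N"
    and mM [measurable]: "X \<in> borel_measurable M" "y \<in> borel_measurable M"
    and mN [measurable]: "X \<in> borel_measurable N" "y \<in> borel_measurable N"
    and y: "\<And>x. \<bar>y x\<bar> \<le> 1"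
    and eq: "\<And>t. (LINT x|M. complex_of_real (y x) * iexp (t * X x)) = (LINT x|N. complex_of_real (y x) * iexp (t * X x))"
    and eq1: "\<And>t. (LINT x|M. iexp (t * X x)) = (LINT x|N. iexp (t * X x))"
    and A [measurable]: "A \<in> sets borel"
  shows "(LINT x|M. y x * indicator A (X x)) = (LINT x|N. y x * indicator A (X x))"
proof -
  have ic: "integrable L (\<lambda>x. complex_of_real (y x) * iexp (t * X x))" "integrable L (\<lambda>x. iexp (t * X x))"
    "integrable L (\<lambda>x. y x * indicator A (X x))" "integrable L (\<lambda>x. indicator A (X x) :: real)"
    if "prob_space L" and [measurable]: "X \<in> borel_measurable L" "y \<in> borel_measurable L" for L t
  proof -
    interpret prob_space L by fact
    show "integrable L (\<lambda>x. complex_of_real (y x) * iexp (t * X x))"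
      by (rule integrable_const_bound[of _ 1]) (use y in \<open>auto simp: norm_mult simp del: of_real_mult\<close>)
    show "integrable L (\<lambda>x. iexp (t * X x))"
      by (rule integrable_const_bound[of _ 1]) (auto simp del: of_real_mult)
    show "integrable L (\<lambda>x. y x * indicator A (X x))"
      by (rule integrable_const_bound[of _ 1]) (use y in \<open>auto simp: indicator_def\<close>)
    show "integrable L (\<lambda>x. indicator A (X x) :: real)"
      by (rule integrable_const_bound[of _ 1]) (auto simp: indicator_def)
  qed
  have "(LINT x|M. (y x + 2) * indicator A (X x)) = (LINT x|N. (y x + 2) * indicator A (X x))"
  proof (rule weighted_char_determines_indicator_integral_nonneg[OF assms(1,2), where K = 3])
    show "1 \<le> y x + 2" "y x + 2 \<le> 3" for x using y[of x] by auto
    fix t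
    have s: "complex_of_real (y x + 2) * iexp (t * X x) = complex_of_real (y x) * iexp (t * X x) + 2 * iexp (t * X x)" for x
      by (simp add: algebra_simps)
    show "(LINT x|M. complex_of_real (y x + 2) * iexp (t * X x)) = (LINT x|N. complex_of_real (y x + 2) * iexp (t * X x))"
      unfolding s using eq[of t] eq1[of t] ic[OF assms(1) mM] ic[OF assms(2) mN]
      by (simp del: of_real_mult)
  qed auto
  moreover have "(LINT x|M. 1 * indicator A (X x) :: real) = (LINT x|N. 1 * indicator A (X x))"
    by (rule weighted_char_determines_indicator_integral_nonneg[OF assms(1,2), where K = 1 and w = "\<lambda>_. 1"]) (use eq1 in auto)
  moreover have "(y x + 2) * indicator A (X x) = y x * indicator A (X x) + 2 * indicator A (X x)" for x
    by (simp add: algebra_simps)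
  ultimately show ?thesis
    using ic[OF assms(1) mM] ic[OF assms(2) mN] by simp
qed

text \<open>Conjugating the hypothesis at \<open>-t\<close> gives the hypothesis for the conjugate weight, hence for its
real and imaginary part.\<close>

lemma weighted_char_determines_indicator_integral:
  fixes Y :: "'a \<Rightarrow> complex" and X :: "'a \<Rightarrow> real"
  assumes "prob_space M" "prob_space N"
    and mM [measurable]: "X \<in> borel_measurable M" "Y \<in> borel_measurable M"
    and mN [measurable]: "X \<in> borel_measurable N" "Y \<in> borel_measurable N"
    and Y: "\<And>x. norm (Y x) \<le> 1"
    and eq: "\<And>t. (LINT x|M. Y x * iexp (t * X x)) = (LINT x|N. Y x * iexp (t * X x))"
    and eq1: "\<And>t. (LINT x|M. iexp (t * X x)) = (LINT x|N. iexp (t * X x))"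
    and A [measurable]: "A \<in> sets borel"
  shows "(LINT x|M. indicator A (X x) * Y x) = (LINT x|N. indicator A (X x) * Y x)"
proof -
  have int: "integrable L (\<lambda>x. Y x * iexp (t * X x))" "integrable L (\<lambda>x. cnj (Y x) * iexp (t * X x))"
    "integrable L (\<lambda>x. indicator A (X x) * Y x)"
    if "prob_space L" and [measurable]: "X \<in> borel_measurable L" "Y \<in> borel_measurable L" for L t
  proof -
    interpret prob_space L by fact
    have [measurable]: "(\<lambda>x. cnj (Y x)) \<in> borel_measurable L"
      by (rule borel_measurable_continuous_on[where f = cnj]) (auto intro: continuous_intros)
    show "integrable L (\<lambda>x. Y x * iexp (t * X x))" "integrable L (\<lambda>x. cnj (Y x) * iexp (t * X x))"
      by (rule integrable_const_bound[of _ 1]; use Y in \<open>auto simp: norm_mult simp del: of_real_mult\<close>)+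
    show "integrable L (\<lambda>x. indicator A (X x) * Y x)"
      by (rule integrable_const_bound[of _ 1]) (use Y in \<open>auto simp: indicator_def norm_mult\<close>)
  qed
  have cnj_eq: "(LINT x|M. cnj (Y x) * iexp (t * X x)) = (LINT x|N. cnj (Y x) * iexp (t * X x))" for t
  proof -
    have "cnj (Y x) * iexp (t * X x) = cnj (Y x * iexp ((- t) * X x))" for x
      by (simp add: exp_cnj)
    then show ?thesis using eq[of "- t"] by (simp only: Bochner_Integration.integral_cnj)
  qed
  have re: "(LINT x|M. Re (Y x) * indicator A (X x)) = (LINT x|N. Re (Y x) * indicator A (X x))"
  proof (rule weighted_char_determines_indicator_integral_real[OF assms(1,2)])
    show "\<bar>Re (Y x)\<bar> \<le> 1" for x using abs_Re_le_cmod[of "Y x"] Y[of x] by simp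
    fix t
    have s: "complex_of_real (Re (Y x)) * iexp (t * X x) = (1 / 2) * (Y x * iexp (t * X x) + cnj (Y x) * iexp (t * X x))" for x
      by (simp only: distrib_right[symmetric] complex_add_cnj) simp
    show "(LINT x|M. complex_of_real (Re (Y x)) * iexp (t * X x)) = (LINT x|N. complex_of_real (Re (Y x)) * iexp (t * X x))"
      unfolding s using eq[of t] cnj_eq[of t] int[OF assms(1) mM] int[OF assms(2) mN]
      by (simp del: of_real_mult)
  qed (use eq1 in auto)
  have im: "(LINT x|M. Im (Y x) * indicator A (X x)) = (LINT x|N. Im (Y x) * indicator A (X x))"
  proof (rule weighted_char_determines_indicator_integral_real[OF assms(1,2)])
    show "\<bar>Im (Y x)\<bar> \<le> 1" for x using abs_Im_le_cmod[of "Y x"] Y[of x] by simp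
    fix t
    have s: "complex_of_real (Im (Y x)) * iexp (t * X x) = (- \<i> / 2) * (Y x * iexp (t * X x) - cnj (Y x) * iexp (t * X x))" for x
    proof -
      have "complex_of_real (Im (Y x)) = (- \<i> / 2) * (Y x - cnj (Y x))" by (simp add: complex_eq_iff)
      then show ?thesis by (simp only: left_diff_distrib[symmetric] mult.assoc)
    qed
    show "(LINT x|M. complex_of_real (Im (Y x)) * iexp (t * X x)) = (LINT x|N. complex_of_real (Im (Y x)) * iexp (t * X x))"
      unfolding s using eq[of t] cnj_eq[of t] int[OF assms(1) mM] int[OF assms(2) mN]
      by (simp del: of_real_mult)
  qed (use eq1 in auto)
  have parts: "Re (LINT x|L. indicator A (X x) * Y x) = (LINT x|L. Re (Y x) * indicator A (X x)) \<and>
      Im (LINT x|L. indicator A (X x) * Y x) = (LINT x|L. Im (Y x) * indicator A (X x))"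
    if "integrable L (\<lambda>x. indicator A (X x) * Y x)" for L
  proof -
    have "Re (indicator A (X x) * Y x) = Re (Y x) * indicator A (X x)"
      "Im (indicator A (X x) * Y x) = Im (Y x) * indicator A (X x)" for x
      by (auto simp: indicator_def)
    then show ?thesis using integral_Re[OF that] integral_Im[OF that] by simp
  qed
  show ?thesis
    using re im parts[OF int(3)[OF assms(1) mM]] parts[OF int(3)[OF assms(2) mN]]
    by (simp add: complex_eq_iff)
qed

text \<open>Starting from \<open>exp (\<i> (t \<bullet> x))\<close>, the factors \<open>exp (\<i> t\<^sub>j x\<^sub>j)\<close> are replaced by indicators of
Borel sets of \<open>x\<^sub>j\<close>, one coordinate at a time; the other factors play the role of a complex weight
for the coordinate in question. At the end the two measures agree on all orthants \<open>{..a}\<close>.\<close>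

theorem char_uniqueness_vec:
  fixes M N :: "(real ^ 'n) measure"
  assumes M: "prob_space M" "sets M = sets borel" and N: "prob_space N" "sets N = sets borel"
    and eq: "\<And>t. (LINT x|M. iexp (t \<bullet> x)) = (LINT x|N. iexp (t \<bullet> x))"
  shows "M = N"
proof -
  interpret M: prob_space M by fact
  interpret N: prob_space N by fact
  have meas: "f \<in> borel_measurable borel \<Longrightarrow> f \<in> borel_measurable M"
    "f \<in> borel_measurable borel \<Longrightarrow> f \<in> borel_measurable N" for f :: "real ^ 'n \<Rightarrow> 'c::topological_space"
    using M N by (simp_all cong: measurable_cong_sets)
  have step: "(LINT x|M. (\<Prod>j\<in>S. indicator (A j) (x $ j)) * iexp (\<Sum>j\<in>-S. t $ j * x $ j)) =
      (LINT x|N. (\<Prod>j\<in>S. indicator (A j) (x $ j)) * iexp (\<Sum>j\<in>-S. t $ j * x $ j))"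
    if [measurable]: "\<And>j. A j \<in> sets borel" for S :: "'n set" and A t
    using finite[of S]
  proof (induction S arbitrary: t rule: finite_induct)
    case empty
    then show ?case using eq[of t] by (simp add: inner_vec_def)
  next
    case (insert k S)
    define Y where "Y x = (\<Prod>j\<in>S. indicator (A j) (x $ j)) * iexp (\<Sum>j\<in>-insert k S. t $ j * x $ j)" for x
    have compl: "- S = insert k (- insert k S)" using insert(2) by auto
    have "(LINT x|M. indicator (A k) (x $ k) * Y x) = (LINT x|N. indicator (A k) (x $ k) * Y x)"
    proof (rule weighted_char_determines_indicator_integral[OF M(1) N(1)])
      have [measurable]: "Y \<in> borel_measurable borel" by (simp add: Y_def[abs_def])
      show "Y \<in> borel_measurable M" "Y \<in> borel_measurable N"
        "(\<lambda>x. x $ k) \<in> borel_measurable M" "(\<lambda>x. x $ k) \<in> borel_measurable N"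
        by (auto intro: meas)
      show "norm (Y x) \<le> 1" for x
        unfolding Y_def norm_mult norm_iexp prod_norm[symmetric] by (auto intro!: prod_le_1 simp: indicator_def)
      fix s
      define t' where "t' = (\<chi> j. if j = k then s else t $ j)"
      have e: "Y x * iexp (s * x $ k) = (\<Prod>j\<in>S. indicator (A j) (x $ j)) * iexp (\<Sum>j\<in>-S. t' $ j * x $ j)" for x
      proof -
        have "(\<Sum>j\<in>-S. t' $ j * x $ j) = s * x $ k + (\<Sum>j\<in>-insert k S. t' $ j * x $ j)"
          unfolding compl by (subst sum.insert) (auto simp: t'_def)
        also have "(\<Sum>j\<in>-insert k S. t' $ j * x $ j) = (\<Sum>j\<in>-insert k S. t $ j * x $ j)"
          by (intro sum.cong) (auto simp: t'_def)
        finally have "iexp (\<Sum>j\<in>-S. t' $ j * x $ j) = iexp (s * x $ k) * iexp (\<Sum>j\<in>-insert k S. t $ j * x $ j)"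
          by (simp only: of_real_add distrib_left exp_add)
        then show ?thesis by (simp only: Y_def) (simp only: ac_simps)
      qed
      show "(LINT x|M. Y x * iexp (s * x $ k)) = (LINT x|N. Y x * iexp (s * x $ k))"
        unfolding e by (rule insert.IH)
      have "axis k s \<bullet> x = s * x $ k" for x :: "real ^ 'n"
        by (simp add: inner_axis' )
      then show "(LINT x|M. iexp (s * x $ k)) = (LINT x|N. iexp (s * x $ k))"
        using eq[of "axis k s"] by simp
    qed simp
    moreover have "indicator (A k) (x $ k) * Y x =
        (\<Prod>j\<in>insert k S. indicator (A j) (x $ j)) * iexp (\<Sum>j\<in>-insert k S. t $ j * x $ j)" for x
      using insert(1,2) by (simp add: Y_def mult.assoc)
    ultimately show ?case by simp
  qed
  have atMost: "measure M {..a} = measure N {..a}" for a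
  proof -
    have e: "(\<Prod>j\<in>UNIV. indicator {..a $ j} (x $ j)) * iexp (\<Sum>j\<in>-UNIV. 0 $ j * x $ j) = complex_of_real (indicator {..a} x)" for x :: "real ^ 'n"
      by (auto simp: indicator_def less_eq_vec_def prod_zero_iff)
    have "(LINT x|M. complex_of_real (indicator {..a} x)) = (LINT x|N. complex_of_real (indicator {..a} x))"
      unfolding e[symmetric] by (rule step) simp
    then have "(LINT x|M. indicator {..a} x :: real) = (LINT x|N. indicator {..a} x)"
      by (simp only: integral_complex_of_real of_real_eq_iff)
    then show ?thesis using M(2) N(2) by simp
  qed
  show ?thesis
  proof (rule measure_eqI_generator_eq)
    show "Int_stable (range (\<lambda>a::real^'n. {..a}))"
    proof (rule Int_stableI)
      fix A B assume "A \<in> range (\<lambda>a::real^'n. {..a})" "B \<in> range (\<lambda>a::real^'n. {..a})"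
      then obtain a b where "A = {..a}" "B = {..b}" by blast
      then have "A \<inter> B = {..(\<chi> i. min (a $ i) (b $ i))}" by (auto simp: less_eq_vec_def)
      then show "A \<inter> B \<in> range (\<lambda>a::real^'n. {..a})" by blast
    qed
    show "sets M = sigma_sets UNIV (range (\<lambda>a. {..a}))" "sets N = sigma_sets UNIV (range (\<lambda>a. {..a}))"
      using M(2) N(2) by (simp_all add: borel_eq_atMost)
    show "emeasure M X = emeasure N X" if "X \<in> range (\<lambda>a. {..a})" for X
      using that atMost by (auto simp: M.emeasure_eq_measure N.emeasure_eq_measure)
    show "range (\<lambda>i::nat. {..(\<chi> j. real i) :: real^'n}) \<subseteq> range (\<lambda>a. {..a})" by auto
    show "(\<Union>i::nat. {..(\<chi> j. real i) :: real^'n}) = UNIV"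
    proof (intro set_eqI iffI)
      fix x :: "real ^ 'n"
      obtain i :: nat where i: "norm x \<le> real i" using real_arch_simple by blast
      have "x $ j \<le> real i" for j using component_le_norm_cart[of x j] i by linarith
      then show "x \<in> (\<Union>i::nat. {..(\<chi> j. real i)})" by (auto simp: less_eq_vec_def)
    qed simp
  qed auto
qed

section \<open>Normal convolution factors\<close>

lemma char_convolution:
  assumes "real_distribution M" "real_distribution N"
  shows "char (M \<star> N) t = char M t * char N t"
proof -
  interpret M: real_distribution M by fact
  interpret N: real_distribution N by fact
  have "char (M \<star> N) t = (LINT \<omega>|(M \<Otimes>\<^sub>M N). iexp (t * (case \<omega> of (x, y) \<Rightarrow> x + y)))"
    unfolding char_def convolution_def by (rule integral_distr) auto
  also have "\<dots> = (LINT \<omega>|(M \<Otimes>\<^sub>M N). iexp (t * fst \<omega>) * iexp (t * snd \<omega>))"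
    by (intro Bochner_Integration.integral_cong) (auto simp: distrib_left exp_add)
  also have "\<dots> = char M t * char N t"
    unfolding char_def
    by (rule integral_pair_mult[where f = "\<lambda>x. iexp (t * x)" and g = "\<lambda>x. iexp (t * x)"])
       (auto intro: M.prob_space_axioms N.prob_space_axioms simp del: of_real_mult)
  finally show ?thesis .
qed

lemma real_distribution_convolution:
  assumes "real_distribution M" "real_distribution N"
  shows "real_distribution (M \<star> N)"
proof -
  interpret M: real_distribution M by fact
  interpret N: real_distribution N by fact
  interpret P: pair_prob_space M N ..
  show ?thesis unfolding convolution_def by (rule P.P.real_distribution_distr) auto
qed

lemma char_normal:
  assumes "0 < \<sigma>"
  shows "real_distribution (density lborel (normal_density 0 \<sigma>))"
    and "char (density lborel (normal_density 0 \<sigma>)) t = exp (- complex_of_real (\<sigma>\<^sup>2 * t\<^sup>2) / 2)"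
proof -
  interpret S: real_distribution std_normal_distribution by (rule real_dist_normal_dist)
  have "distributed std_normal_distribution lborel (\<lambda>x. x) (normal_density 0 1)"
    by (auto simp: distributed_def intro!: measure_eqI simp: emeasure_distr)
  from S.normal_density_affine[OF this, of \<sigma> 0]
  have "distributed std_normal_distribution lborel (\<lambda>x. \<sigma> * x) (normal_density 0 \<sigma>)"
    using assms by simp
  then have "distr std_normal_distribution lborel (\<lambda>x. \<sigma> * x) = density lborel (normal_density 0 \<sigma>)"
    by (simp add: distributed_distr_eq_density)
  then have D: "density lborel (normal_density 0 \<sigma>) = distr std_normal_distribution borel (\<lambda>x. \<sigma> * x)"
    by (simp cong: distr_cong)
  show "real_distribution (density lborel (normal_density 0 \<sigma>))"
    unfolding D by (rule S.real_distribution_distr) simp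
  have "char (density lborel (normal_density 0 \<sigma>)) t = char std_normal_distribution (t * \<sigma>)"
    unfolding D char_def by (subst integral_distr) (auto simp: mult.assoc)
  then show "char (density lborel (normal_density 0 \<sigma>)) t = exp (- complex_of_real (\<sigma>\<^sup>2 * t\<^sup>2) / 2)"
    by (simp add: char_std_normal_distribution exp_of_real[symmetric] power_mult_distrib mult.commute)
qed

section \<open>Gaussian characteristic functions\<close>

lemma inner_matrix_mult_transpose: "t \<bullet> (A *v x) = (transpose A *v t) \<bullet> x" for A :: "real ^ 'n ^ 'm"
  by (metis dot_lmul_matrix vector_transpose_matrix transpose_transpose)

lemma transpose_mult_nth: "(transpose A *v t) $ j = column j A \<bullet> t" for A :: "real ^ 'n ^ 'm"
  by (simp add: matrix_vector_mult_def transpose_def column_def inner_vec_def)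

lemma borel_measurable_matrix_mult [measurable]:
  fixes A :: "real ^ 'n ^ 'm"
  assumes "f \<in> borel_measurable M"
  shows "(\<lambda>x. A *v f x) \<in> borel_measurable M"
  by (rule borel_measurable_continuous_on[OF _ assms]) (rule matrix_vector_mult_linear_continuous_on)

lemma borel_measurable_vec_lambda:
  fixes f :: "'n::finite \<Rightarrow> 'a \<Rightarrow> real"
  assumes "\<And>j. f j \<in> borel_measurable M"
  shows "(\<lambda>x. \<chi> j. f j x) \<in> borel_measurable M"
  using assms by (subst borel_measurable_euclidean_space) (auto simp: Basis_vec_def inner_axis)

text \<open>The logarithm of the characteristic function of a Gaussian vector. It is named separately because
the argument takes logarithms of characteristic functions.\<close>

definition gauss_exponent :: "real ^ 'n \<Rightarrow> real ^ 'n ^ 'n \<Rightarrow> real ^ 'n \<Rightarrow> complex" where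
  "gauss_exponent \<mu> \<Sigma> t = \<i> * complex_of_real (t \<bullet> \<mu>) - complex_of_real (t \<bullet> (\<Sigma> *v t)) / 2"

abbreviation gauss_char :: "real ^ 'n \<Rightarrow> real ^ 'n ^ 'n \<Rightarrow> real ^ 'n \<Rightarrow> complex" where
  "gauss_char \<mu> \<Sigma> t \<equiv> exp (gauss_exponent \<mu> \<Sigma> t)"

lemma gauss_exponent_add:
  "gauss_exponent (\<mu> + \<mu>') (\<Sigma> + \<Sigma>') t = gauss_exponent \<mu> \<Sigma> t + gauss_exponent \<mu>' \<Sigma>' t"
  by (simp add: gauss_exponent_def inner_add_right matrix_vector_mult_add_rdistrib field_simps)

lemma gauss_exponent_linear_image:
  "gauss_exponent (A *v \<xi>) (A ** \<Delta> ** transpose A) t = gauss_exponent \<xi> \<Delta> (transpose A *v t)"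
  by (simp add: gauss_exponent_def inner_matrix_mult_transpose flip: matrix_vector_mul_assoc)

lemma gauss_exponent_diagonal:
  assumes "diagonal_matrix \<Delta>"
  shows "gauss_exponent \<xi> \<Delta> s = (\<Sum>k\<in>UNIV. \<i> * complex_of_real (s $ k * \<xi> $ k) - complex_of_real (\<Delta> $ k $ k * (s $ k)\<^sup>2) / 2)"
proof -
  have "(\<Delta> *v s) $ k = \<Delta> $ k $ k * s $ k" for k
  proof -
    have "(\<Delta> *v s) $ k = (\<Sum>j\<in>UNIV. if j = k then \<Delta> $ k $ k * s $ k else 0)"
      unfolding matrix_vector_mult_def vec_lambda_beta
      by (intro sum.cong) (use assms in \<open>auto simp: diagonal_matrix_def\<close>)
    then show ?thesis by simp
  qed
  then show ?thesis
    by (simp add: gauss_exponent_def inner_vec_def sum_subtractf sum_distrib_left sum_divide_distrib power2_eq_square ac_simps)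
qed

lemma quadratic_form_scaleR: "(r *\<^sub>R t) \<bullet> (S *v (r *\<^sub>R t)) = r\<^sup>2 * (t \<bullet> (S *v t))" for S :: "real ^ 'n ^ 'n"
  by (simp add: matrix_vector_mult_scaleR power2_eq_square)

text \<open>Comparing absolute values shows that the quadratic form of \<open>S\<close> vanishes near 0, hence everywhere
by homogeneity, and polarisation gives \<open>S = 0\<close>. Then \<open>exp (\<i> (t \<bullet> b)) = 1\<close> near 0, which fails for
a small positive multiple \<open>t\<close> of \<open>b\<close> unless \<open>b = 0\<close>.\<close>

lemma gauss_exponent_eq_0_near_0:
  fixes S :: "real ^ 'n ^ 'n"
  assumes \<epsilon>: "0 < \<epsilon>" and sym: "transpose S = S"
    and one: "\<And>t. norm t < \<epsilon> \<Longrightarrow> gauss_char b S t = 1"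
  shows "b = 0 \<and> S = 0"
proof
  \<comment> \<open>Homogeneity: \<open>t\<close> is scaled into the ball where the hypothesis applies.\<close>
  have quad: "t \<bullet> (S *v t) = 0" for t
  proof -
    define r where "r = \<epsilon> / (norm t + 1)"
    have r: "0 < r" using \<epsilon> by (auto simp: r_def intro!: divide_pos_pos add_nonneg_pos)
    have "r * norm t < \<epsilon>"
    proof -
      have "r * norm t < r * (norm t + 1)" using r by simp
      also have "\<dots> = \<epsilon>" by (simp add: r_def add_nonneg_eq_0_iff)
      finally show ?thesis .
    qed
    then have "gauss_char b S (r *\<^sub>R t) = 1" using r by (intro one) simp
    then have "Re (gauss_exponent b S (r *\<^sub>R t)) = 0" by (simp only: exp_eq_1)
    then have "(r *\<^sub>R t) \<bullet> (S *v (r *\<^sub>R t)) = 0" by (simp add: gauss_exponent_def)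
    then show ?thesis unfolding quadratic_form_scaleR using r by simp
  qed
  have bil: "x \<bullet> (S *v y) = 0" for x y
  proof -
    have "y \<bullet> (S *v x) = x \<bullet> (S *v y)"
      using inner_matrix_mult_transpose[of y S x] sym by (simp add: inner_commute)
    then show ?thesis
      using quad[of "x + y"] quad[of x] quad[of y]
      by (simp add: matrix_vector_right_distrib inner_add_left inner_add_right)
  qed
  have "S *v y = 0 *v y" for y
    using bil[of "S *v y" y] by simp
  then show S0: "S = 0" unfolding matrix_eq by blast
  show "b = 0"
  proof (rule ccontr)
    assume b: "b \<noteq> 0"
    \<comment> \<open>The first bound keeps \<open>r b\<close> in the ball, the second one makes \<open>r (b \<bullet> b)\<close> at most 1, below the
      period \<open>2 \<pi>\<close>.\<close>
    define r where "r = min (\<epsilon> / (2 * norm b)) (1 / (norm b)\<^sup>2)"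
    have r: "0 < r" using \<epsilon> b by (simp add: r_def)
    have "r * norm b \<le> \<epsilon> / (2 * norm b) * norm b" by (intro mult_right_mono) (auto simp: r_def)
    also have "\<dots> < \<epsilon>" using \<epsilon> b by simp
    finally have "gauss_char b S (r *\<^sub>R b) = 1" using r by (intro one) simp
    then obtain n :: int where n: "r * (b \<bullet> b) = of_int (2 * n) * pi"
      unfolding exp_eq_1 by (auto simp: gauss_exponent_def S0)
    have "r * (b \<bullet> b) \<le> 1 / (norm b)\<^sup>2 * (b \<bullet> b)" by (intro mult_right_mono) (auto simp: r_def)
    also have "\<dots> = 1" using b by (simp add: power2_norm_eq_inner)
    finally have le: "of_int (2 * n) * pi \<le> 1" using n by simp
    have "0 < of_int (2 * n) * pi" using n r b by (metis inner_gt_zero_iff mult_pos_pos)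
    then have "1 \<le> n" by (simp add: zero_less_mult_iff)
    then have "2 * pi \<le> of_int (2 * n) * pi" by (intro mult_right_mono) auto
    then show False using le pi_gt3 by linarith
  qed
qed

lemma vanishing_third_differences_gauss_exponent:
  "vanishing_third_differences (gauss_exponent \<mu> \<Sigma>)"
  unfolding vanishing_third_differences_def
proof (intro allI)
  fix u t
  define q where "q x y = x \<bullet> (\<Sigma> *v y)" for x y
  have q: "q (x + y) z = q x z + q y z" "q z (x + y) = q z x + q z y" for x y z
    by (simp_all add: q_def matrix_vector_right_distrib inner_add_left inner_add_right)
  have g: "gauss_exponent \<mu> \<Sigma> x = \<i> * complex_of_real (x \<bullet> \<mu>) - complex_of_real (q x x) / 2" for x
    by (simp add: gauss_exponent_def q_def)
  show "(fdiff u ^^ 3) (gauss_exponent \<mu> \<Sigma>) t = 0"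
    unfolding numeral_3_eq_3 fdiff_funpow_Suc funpow_0 g q inner_add_left
    by (simp add: field_simps)
qed

lemma real_distribution_distr_borel:
  "prob_space M \<Longrightarrow> Z \<in> borel_measurable M \<Longrightarrow> real_distribution (distr M borel Z)"
  by (rule prob_space.real_distribution_distr)

lemma char_distr:
  "Z \<in> borel_measurable M \<Longrightarrow> char (distr M borel Z) t = (LINT \<omega>|M. iexp (t * Z \<omega>))"
  unfolding char_def by (rule integral_distr) auto

lemma char_distr_affine:
  fixes Z :: "'a \<Rightarrow> real"
  assumes [measurable]: "Z \<in> borel_measurable M"
  shows "char (distr M borel (\<lambda>\<omega>. a * Z \<omega> + b)) s = iexp (s * b) * char (distr M borel Z) (s * a)"
proof -
  have "iexp (s * (a * Z \<omega> + b)) = iexp (s * b) * iexp (s * a * Z \<omega>)" for \<omega>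
    by (simp add: algebra_simps exp_add)
  then show ?thesis by (subst (1 2) char_distr) (simp_all only: assms borel_measurable_times borel_measurable_add borel_measurable_const integral_mult_right_zero)
qed

text \<open>How Gaussian-freeness is contradicted: a factorisation of the characteristic function is a
factorisation of the law, by uniqueness.\<close>

lemma not_gaussian_freeI:
  assumes "prob_space M" "Z \<in> borel_measurable M" and N: "real_distribution N" and v: "0 < v"
    and eq: "\<And>t. char (distr M borel Z) t = char N t * exp (- complex_of_real (v * t\<^sup>2) / 2)"
  shows "\<not> gaussian_free M Z"
proof -
  interpret N: real_distribution N by fact
  let ?G = "density lborel (normal_density 0 (sqrt v))"
  have G: "real_distribution ?G" using v by (intro char_normal) simp
  have "char (distr M borel Z) t = char (N \<star> ?G) t" for t
    using char_convolution[OF N G, of t] char_normal(2)[of "sqrt v" t] v eq[of t] by simp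
  then have "distr M borel Z = (N \<star> ?G)"
    using assms G by (intro Levy_uniqueness real_distribution_distr_borel real_distribution_convolution) auto
  moreover have "prob_space N" "sets N = sets borel"
    using N.prob_space_axioms by auto
  ultimately show ?thesis
    unfolding gaussian_free_def using v by (metis real_sqrt_gt_zero)
qed

section \<open>The functional equation and the matching of columns\<close>

lemma indep_components_char:
  fixes Z :: "'a \<Rightarrow> real ^ 'k"
  assumes "prob_space M" "Z \<in> borel_measurable M"
    and ind: "prob_space.indep_vars M (\<lambda>_. borel) (\<lambda>j \<omega>. Z \<omega> $ j) UNIV"
  shows "(LINT \<omega>|M. iexp (s \<bullet> Z \<omega>)) = (\<Prod>j\<in>UNIV. char (distr M borel (\<lambda>\<omega>. Z \<omega> $ j)) (s $ j))"
proof -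
  interpret prob_space M by fact
  have [measurable]: "(\<lambda>\<omega>. Z \<omega> $ j) \<in> borel_measurable M" for j
    using ind by (simp add: indep_vars_def2)
  have "indep_vars (\<lambda>_. borel) (\<lambda>j \<omega>. iexp (s $ j * Z \<omega> $ j)) UNIV"
    by (rule indep_vars_compose2[OF ind, where Y = "\<lambda>j x. iexp (s $ j * x)"]) simp
  then have "(LINT \<omega>|M. (\<Prod>j\<in>UNIV. iexp (s $ j * Z \<omega> $ j))) = (\<Prod>j\<in>UNIV. LINT \<omega>|M. iexp (s $ j * Z \<omega> $ j))"
    by (intro indep_vars_lebesgue_integral integrable_const_bound[of _ 1]) (auto simp del: of_real_mult)
  moreover have "iexp (s \<bullet> Z \<omega>) = (\<Prod>j\<in>UNIV. iexp (s $ j * Z \<omega> $ j))" for \<omega>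
    by (simp add: inner_vec_def sum_distrib_left exp_sum)
  ultimately show ?thesis by (simp only: char_distr[OF \<open>(\<lambda>\<omega>. Z \<omega> $ _) \<in> borel_measurable M\<close>])
qed

lemma representation_measurable:
  assumes "representation M X A Z E \<mu> \<Sigma>"
  shows "Z \<in> borel_measurable M" "E \<in> borel_measurable M" "(\<lambda>\<omega>. Z \<omega> $ j) \<in> borel_measurable M"
proof -
  show Z: "Z \<in> borel_measurable M" and "E \<in> borel_measurable M"
    using assms by (auto simp: representation_def gaussian_vector_def)
  show "(\<lambda>\<omega>. Z \<omega> $ j) \<in> borel_measurable M"
    by (rule borel_measurable_continuous_on[OF _ Z, where f = "\<lambda>x. x $ j"]) (intro continuous_intros)
qed

lemma representation_char_Z:
  assumes "prob_space M" "representation M X A Z E \<mu> \<Sigma>"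
  shows "(LINT \<omega>|M. iexp (s \<bullet> Z \<omega>)) = (\<Prod>j\<in>UNIV. char (distr M borel (\<lambda>\<omega>. Z \<omega> $ j)) (s $ j))"
  using assms by (intro indep_components_char) (auto simp: representation_def)

lemma representation_char_E:
  assumes "representation M X A Z E \<mu> \<Sigma>"
  shows "(LINT \<omega>|M. iexp (t \<bullet> E \<omega>)) = gauss_char \<mu> \<Sigma> t"
  using assms by (auto simp: representation_def gaussian_vector_def gauss_exponent_def)

text \<open>This is the only place where the decomposition of \<open>X\<close> itself enters; afterwards only the
functional equation between the right-hand sides of the two representations is used.\<close>

lemma representation_char:
  fixes A :: "real ^ 'k ^ 'p"
  assumes "prob_space M" and [measurable]: "X \<in> borel_measurable M"
    and rep: "representation M X A Z E \<mu> \<Sigma>"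
  shows "(LINT \<omega>|M. iexp (t \<bullet> X \<omega>)) =
    (\<Prod>j\<in>UNIV. char (distr M borel (\<lambda>\<omega>. Z \<omega> $ j)) (column j A \<bullet> t)) * gauss_char \<mu> \<Sigma> t"
proof -
  note [measurable] = representation_measurable(1,2)[OF rep]
  let ?s = "transpose A *v t"
  have X: "AE \<omega> in M. X \<omega> = A *v Z \<omega> + E \<omega>" and ind: "indep_rv M E Z"
    using rep by (auto simp: representation_def)
  have "(LINT \<omega>|M. iexp (t \<bullet> X \<omega>)) = (LINT \<omega>|M. iexp (t \<bullet> E \<omega>) * iexp (?s \<bullet> Z \<omega>))"
  proof (rule integral_cong_AE)
    show "AE \<omega> in M. iexp (t \<bullet> X \<omega>) = iexp (t \<bullet> E \<omega>) * iexp (?s \<bullet> Z \<omega>)"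
      using X
    proof eventually_elim
      case (elim \<omega>)
      have "t \<bullet> X \<omega> = t \<bullet> E \<omega> + ?s \<bullet> Z \<omega>"
        by (simp add: elim inner_add_right inner_matrix_mult_transpose)
      then show ?case by (simp add: distrib_left exp_add)
    qed
  qed auto
  also have "\<dots> = (LINT \<omega>|M. iexp (t \<bullet> E \<omega>)) * (LINT \<omega>|M. iexp (?s \<bullet> Z \<omega>))"
    by (rule indep_rv_integral_mult[OF assms(1) ind, where f = "\<lambda>x. iexp (t \<bullet> x)" and g = "\<lambda>x. iexp (?s \<bullet> x)"]) auto
  finally show ?thesis
    by (simp only: representation_char_E[OF rep] representation_char_Z[OF assms(1) rep] transpose_mult_nth mult.commute)
qed

text \<open>Up to scaling, \<open>w\<close> is the component of \<open>a\<close> orthogonal to \<open>c\<close>. If \<open>c = 0\<close> the quotient in the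
definition of \<open>k\<close> is 0 and \<open>w\<close> is a multiple of \<open>a\<close>.\<close>

lemma separating_vector:
  fixes a c :: "real ^ 'n"
  assumes "a \<noteq> 0" "\<not> proportional a c"
  shows "\<exists>w. c \<bullet> w = 0 \<and> a \<bullet> w = 1"
proof -
  define k where "k = (a \<bullet> c) / (c \<bullet> c)"
  define w where "w = a - k *\<^sub>R c"
  have cw: "c \<bullet> w = 0"
    by (cases "c = 0") (simp_all add: w_def k_def inner_diff_right inner_commute)
  have "w \<noteq> 0"
  proof
    assume "w = 0"
    then have "a = k *\<^sub>R c" by (simp add: w_def)
    moreover from this have "k \<noteq> 0" using assms(1) by auto
    ultimately show False using assms(2) by (auto simp: proportional_def)
  qed
  moreover have "a \<bullet> w = w \<bullet> w"
  proof -
    have "a \<bullet> w = (w + k *\<^sub>R c) \<bullet> w" by (simp add: w_def)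
    then show ?thesis using cw by (simp add: inner_add_left)
  qed
  ultimately have "a \<bullet> w \<noteq> 0" by simp
  then show ?thesis using cw by (intro exI[of _ "(1 / (a \<bullet> w)) *\<^sub>R w"]) simp
qed

lemma isCont_tendsto_nhds: "isCont f a \<Longrightarrow> (f \<longlongrightarrow> f a) (nhds a)"
  by (simp add: continuous_at tendsto_at_iff_tendsto_nhds)

text \<open>Otherwise column \<open>j\<close> is proportional to none of the other columns of either matrix, and the
logarithm of the characteristic function of the \<open>j\<close>-th component would be a polynomial near 0. The
index type \<open>'k + 'l\<close> collects the columns of both matrices in one family.\<close>

lemma column_proportional:
  fixes A1 :: "real ^ 'k ^ 'p" and A2 :: "real ^ 'l ^ 'p"
  assumes M: "prob_space M" and X: "X \<in> borel_measurable M"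
    and rep1: "representation M X A1 Z1 E1 \<mu>1 \<Sigma>1"
    and rep2: "representation M X A2 Z2 E2 \<mu>2 \<Sigma>2"
  shows "\<exists>l. proportional (column j A1) (column l A2)"
proof (rule ccontr)
  assume no: "\<not> ?thesis"
  define c :: "'k + 'l \<Rightarrow> real ^ 'p" where "c i = (case i of Inl k \<Rightarrow> column k A1 | Inr l \<Rightarrow> column l A2)" for i
  define D where "D i = (case i of Inl k \<Rightarrow> distr M borel (\<lambda>\<omega>. Z1 \<omega> $ k) | Inr l \<Rightarrow> distr M borel (\<lambda>\<omega>. Z2 \<omega> $ l))" for i :: "'k + 'l"
  define \<phi> where "\<phi> i = char (D i)" for i
  define f where "f i s = Ln (\<phi> i s)" for i s
  define Q where "Q t = gauss_exponent \<mu>2 \<Sigma>2 t - gauss_exponent \<mu>1 \<Sigma>1 t" for t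
  let ?a = "c (Inl j)"
  have D: "real_distribution (D i)" for i
    using representation_measurable(3)[OF rep1] representation_measurable(3)[OF rep2] M
    by (cases i) (auto simp: D_def intro: real_distribution_distr_borel)
  have \<phi>0: "\<phi> i 0 = 1" and cont\<phi>: "isCont (\<phi> i) s" for i s
    unfolding \<phi>_def using D by (rule real_distribution.char_zero, rule real_distribution.isCont_char)
  have f0: "f i 0 = 0" for i by (simp add: f_def \<phi>0)
  have contf: "isCont (f i) 0" for i
    unfolding f_def by (rule isCont_Ln'[OF cont\<phi>]) (simp add: \<phi>0)
  have cont_c: "isCont (\<lambda>t. g (c i \<bullet> t)) 0" if "isCont g 0" for g :: "real \<Rightarrow> complex" and i
  proof (rule isCont_o2[where f = "\<lambda>t. c i \<bullet> t" and g = g])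
    show "isCont (\<lambda>t. c i \<bullet> t) 0" by (intro continuous_intros)
    show "isCont g (c i \<bullet> 0)" using that by simp
  qed
  have contQ: "isCont Q 0"
  proof -
    have "isCont (\<lambda>t. S *v t) 0" for S :: "real ^ 'p ^ 'p"
      by (rule linear_continuous_at) (rule matrix_vector_mul_bounded_linear)
    then show ?thesis unfolding Q_def gauss_exponent_def by (intro continuous_intros) simp_all
  qed
  have Q0: "Q 0 = 0" by (simp add: Q_def gauss_exponent_def)
  \<comment> \<open>The functional equation says only that \<open>exp (L t) = 1\<close>. Since \<open>L\<close> is continuous with \<open>L 0 = 0\<close>,
    the branch is the right one near 0 and \<open>L\<close> itself vanishes there.\<close>
  define L where "L t = (\<Sum>k\<in>UNIV. f (Inl k) (c (Inl k) \<bullet> t)) - (\<Sum>l\<in>UNIV. f (Inr l) (c (Inr l) \<bullet> t)) - Q t" for t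
  have contL: "isCont L 0"
    unfolding L_def by (intro continuous_intros cont_c contf contQ)
  have L0: "L 0 = 0" by (simp add: L_def f0 Q0)
  have "\<forall>\<^sub>F t in nhds 0. norm (L t) < 1"
  proof -
    have "\<forall>\<^sub>F t in nhds 0. dist (L t) (L 0) < 1"
      by (rule tendstoD[OF isCont_tendsto_nhds[OF contL]]) simp
    then show ?thesis by (simp add: L0)
  qed
  moreover have "\<forall>\<^sub>F t in nhds 0. \<forall>i. \<phi> i (c i \<bullet> t) \<noteq> 0"
  proof (rule eventually_all_finite)
    fix i
    show "\<forall>\<^sub>F t in nhds 0. \<phi> i (c i \<bullet> t) \<noteq> 0"
      by (rule tendsto_imp_eventually_ne[OF isCont_tendsto_nhds[OF cont_c[OF cont\<phi>]]]) (simp add: \<phi>0)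
  qed
  ultimately have "\<forall>\<^sub>F t in nhds 0. L t = 0"
  proof eventually_elim
    case (elim t)
    have expf: "exp (f i (c i \<bullet> t)) = \<phi> i (c i \<bullet> t)" for i
      using elim by (simp add: f_def)
    have "(\<Prod>k\<in>UNIV. \<phi> (Inl k) (c (Inl k) \<bullet> t)) * gauss_char \<mu>1 \<Sigma>1 t =
        (\<Prod>l\<in>UNIV. \<phi> (Inr l) (c (Inr l) \<bullet> t)) * gauss_char \<mu>2 \<Sigma>2 t"
      using representation_char[OF M X rep1, of t] representation_char[OF M X rep2, of t]
      by (simp add: \<phi>_def D_def c_def)
    moreover have "exp (L t) = (\<Prod>k\<in>UNIV. \<phi> (Inl k) (c (Inl k) \<bullet> t)) /
        (\<Prod>l\<in>UNIV. \<phi> (Inr l) (c (Inr l) \<bullet> t)) / (gauss_char \<mu>2 \<Sigma>2 t / gauss_char \<mu>1 \<Sigma>1 t)"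
      by (simp only: L_def Q_def exp_diff exp_sum finite expf)
    moreover have "(\<Prod>l\<in>UNIV. \<phi> (Inr l) (c (Inr l) \<bullet> t)) \<noteq> 0" using elim by simp
    ultimately have "exp (L t) = 1" by (simp add: field_simps)
    then obtain n :: int where n: "Im (L t) = of_int (2 * n) * pi" and re: "Re (L t) = 0"
      unfolding exp_eq_1 by blast
    have "\<bar>of_int (2 * n) * pi\<bar> < 1" using abs_Im_le_cmod[of "L t"] elim n by simp
    moreover have "1 \<le> \<bar>of_int (2 * n) * pi\<bar>" if "n \<noteq> 0"
    proof -
      have "1 \<le> \<bar>real_of_int (2 * n)\<bar>" using that by linarith
      then have "1 * 1 \<le> \<bar>real_of_int (2 * n)\<bar> * pi" using pi_gt3 by (intro mult_mono) auto
      then show ?thesis by (simp add: abs_mult)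
    qed
    ultimately have "n = 0" by (meson not_le)
    then show ?case using n re by (simp add: complex_eq_iff)
  qed
  then obtain \<epsilon>1 where \<epsilon>1: "0 < \<epsilon>1" "\<And>t. norm t < \<epsilon>1 \<Longrightarrow> L t = 0"
    unfolding eventually_nhds_metric by (auto simp: dist_norm)
  have "\<forall>\<^sub>F s in nhds 0. dist (\<phi> (Inl j) s) 1 < 1"
  proof (rule tendstoD)
    show "(\<phi> (Inl j) \<longlongrightarrow> 1) (nhds 0)"
      using isCont_tendsto_nhds[OF cont\<phi>[of 0 "Inl j"]] \<phi>0[of "Inl j"] by simp
  qed simp
  then obtain \<epsilon>2 where \<epsilon>2: "0 < \<epsilon>2" "\<And>s. \<bar>s\<bar> < \<epsilon>2 \<Longrightarrow> dist (\<phi> (Inl j) s) 1 < 1"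
    unfolding eventually_nhds_metric by (auto simp: dist_real_def)
  have pos: "\<phi> (Inl j) s \<notin> \<real>\<^sub>\<le>\<^sub>0" if "\<bar>s\<bar> < \<epsilon>2" for s
  proof -
    have "\<bar>Re (\<phi> (Inl j) s - 1)\<bar> < 1"
      using \<epsilon>2(2)[OF that] abs_Re_le_cmod[of "\<phi> (Inl j) s - 1"] by (simp add: dist_norm)
    then show ?thesis by (auto simp: complex_nonpos_Reals_iff)
  qed
  define \<epsilon> where "\<epsilon> = min \<epsilon>1 \<epsilon>2"
  have nonzero: "column k A1 \<noteq> 0" for k using rep1 by (simp add: representation_def)
  have sep: "\<exists>w. c i \<bullet> w = 0 \<and> ?a \<bullet> w = 1" if "i \<noteq> Inl j" for i
  proof (rule separating_vector)
    show "?a \<noteq> 0" using nonzero by (simp add: c_def)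
    show "\<not> proportional ?a (c i)"
      using that no rep1 by (cases i) (auto simp: c_def representation_def)
  qed
  then obtain w where w: "\<And>i. i \<noteq> Inl j \<Longrightarrow> c i \<bullet> w i = 0" "\<And>i. i \<noteq> Inl j \<Longrightarrow> ?a \<bullet> w i = 1"
    by metis
  define F where "F i s = (case i of Inl k \<Rightarrow> f i s | Inr l \<Rightarrow> - f i s)" for i s
  have "\<exists>p \<delta>. 0 < \<delta> \<and> (\<forall>s. \<bar>s\<bar> < \<delta> \<longrightarrow> f (Inl j) s = poly p (of_real s))"
  proof (rule sum_of_ridge_functions_imp_poly[where I = "UNIV - {Inl j}" and c = c and w = w and a = ?a
        and v = "(1 / (?a \<bullet> ?a)) *\<^sub>R ?a" and Q = Q and F = F and \<epsilon> = \<epsilon>])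
    show "?a \<bullet> ((1 / (?a \<bullet> ?a)) *\<^sub>R ?a) = 1" using nonzero[of j] by (simp add: c_def)
    show "vanishing_third_differences Q"
      using vanishing_third_differences_gauss_exponent[of \<mu>2 \<Sigma>2] vanishing_third_differences_gauss_exponent[of \<mu>1 \<Sigma>1]
      by (simp add: vanishing_third_differences_def Q_def[abs_def] fdiff_funpow_diff)
    show "0 < \<epsilon>" using \<epsilon>1 \<epsilon>2 by (simp add: \<epsilon>_def)
    show "continuous_on {-\<epsilon><..<\<epsilon>} (f (Inl j))"
      unfolding f_def using pos cont\<phi>
      by (intro continuous_on_Ln continuous_at_imp_continuous_on) (auto simp: \<epsilon>_def)
    fix t :: "real ^ 'p" assume "norm t < \<epsilon>"
    then have "L t = 0" by (intro \<epsilon>1) (simp add: \<epsilon>_def)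
    have "f (Inl j) (?a \<bullet> t) + (\<Sum>i\<in>UNIV - {Inl j}. F i (c i \<bullet> t)) = (\<Sum>i\<in>UNIV. F i (c i \<bullet> t))"
      by (subst sum.remove[of UNIV "Inl j"]) (auto simp: F_def)
    also have "\<dots> = (\<Sum>i\<in>(UNIV <+> UNIV). F i (c i \<bullet> t))" by (simp only: UNIV_Plus_UNIV)
    also have "\<dots> = (\<Sum>k\<in>UNIV. f (Inl k) (c (Inl k) \<bullet> t)) - (\<Sum>l\<in>UNIV. f (Inr l) (c (Inr l) \<bullet> t))"
      by (subst sum.Plus) (auto simp: F_def sum_negf)
    finally show "f (Inl j) (?a \<bullet> t) + (\<Sum>i\<in>UNIV - {Inl j}. F i (c i \<bullet> t)) = Q t"
      using \<open>L t = 0\<close> by (simp add: L_def)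
  qed (use w in auto)
  then obtain p \<delta> where p: "0 < \<delta>" "\<And>s. \<bar>s\<bar> < \<delta> \<Longrightarrow> f (Inl j) s = poly p (of_real s)" by blast
  have "\<exists>m v. 0 \<le> v \<and> (\<forall>t. char (D (Inl j)) t = exp (\<i> * complex_of_real (t * m) - complex_of_real (v * t\<^sup>2) / 2))"
  proof (rule real_distribution.Marcinkiewicz[OF D])
    show "0 < min \<delta> \<epsilon>2" using p \<epsilon>2 by simp
    fix s assume "\<bar>s\<bar> < min \<delta> \<epsilon>2"
    then have "f (Inl j) s = poly p (of_real s)" "\<phi> (Inl j) s \<noteq> 0" using p pos[of s] by auto
    then show "char (D (Inl j)) s = exp (poly p (of_real s))"
      by (metis \<phi>_def f_def exp_Ln)
  qed
  then have "gaussian_rv M (\<lambda>\<omega>. Z1 \<omega> $ j)"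
    using representation_measurable(3)[OF rep1] by (simp add: gaussian_rv_def D_def)
  then show False using rep1 by (simp add: representation_def)
qed

section \<open>Permutation and diagonal matrices\<close>

lemma matrix_inv_eqI:
  fixes A :: "real ^ 'n ^ 'm" and B :: "real ^ 'm ^ 'n"
  assumes "A ** B = mat 1" "B ** A = mat 1"
  shows "matrix_inv A = B"
proof -
  have "A ** matrix_inv A = mat 1 \<and> matrix_inv A ** A = mat 1"
    unfolding matrix_inv_def by (rule someI[of _ B]) (use assms in simp)
  then show ?thesis by (metis assms matrix_mul_assoc matrix_mul_lid matrix_mul_rid)
qed

definition perm_matrix :: "('l \<Rightarrow> 'k) \<Rightarrow> real ^ 'l ^ 'k" where
  "perm_matrix \<pi> = (\<chi> i j. if i = \<pi> j then 1 else 0)"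

lemma matrix_inv_perm_matrix_mult:
  fixes \<pi> :: "'l::finite \<Rightarrow> 'k::finite"
  assumes "bij \<pi>"
  shows "(matrix_inv (perm_matrix \<pi>) *v x) $ l = x $ \<pi> l"
proof -
  have inj: "\<pi> a = \<pi> b \<longleftrightarrow> a = b" for a b using assms by (simp add: bij_def inj_eq)
  have "matrix_inv (perm_matrix \<pi>) = transpose (perm_matrix \<pi>)"
  proof (rule matrix_inv_eqI)
    show "transpose (perm_matrix \<pi>) ** perm_matrix \<pi> = mat 1"
      by (auto simp: vec_eq_iff matrix_matrix_mult_def transpose_def perm_matrix_def mat_def inj if_distrib[of "\<lambda>x. x * _"] cong: if_cong)
    have "(\<Sum>k\<in>UNIV. (if i = \<pi> k then 1 else 0) * (if j = \<pi> k then 1 else 0)) = (if i = j then 1 else (0::real))" for i j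
    proof -
      obtain l where i: "i = \<pi> l" using assms by (metis bij_pointE)
      have "(\<Sum>k\<in>UNIV. (if i = \<pi> k then 1 else 0) * (if j = \<pi> k then 1 else 0)) =
          (\<Sum>k\<in>UNIV. if k = l then (if i = j then 1 else (0::real)) else 0)"
        by (intro sum.cong) (auto simp: i inj)
      then show ?thesis by simp
    qed
    then show "perm_matrix \<pi> ** transpose (perm_matrix \<pi>) = mat 1"
      by (simp add: vec_eq_iff matrix_matrix_mult_def transpose_def perm_matrix_def mat_def)
  qed
  then have "(matrix_inv (perm_matrix \<pi>) *v x) $ l = (\<Sum>k\<in>UNIV. if k = \<pi> l then x $ k else 0)"
    by (simp add: matrix_vector_mult_def transpose_def perm_matrix_def if_distrib[of "\<lambda>a. a * _"] cong: if_cong)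
  then show ?thesis by simp
qed

lemma diagonal_matrix_mult:
  fixes D :: "real ^ 'n ^ 'n"
  assumes "diagonal_matrix D"
  shows "(D ** B) $ i $ j = D $ i $ i * B $ i $ j" "(C ** D) $ a $ j = C $ a $ j * D $ j $ j"
proof -
  have "(D ** B) $ i $ j = (\<Sum>k\<in>UNIV. if k = i then D $ i $ i * B $ i $ j else 0)"
    unfolding matrix_matrix_mult_def vec_lambda_beta
    by (intro sum.cong) (use assms in \<open>auto simp: diagonal_matrix_def\<close>)
  then show "(D ** B) $ i $ j = D $ i $ i * B $ i $ j" by simp
  have "(C ** D) $ a $ j = (\<Sum>k\<in>UNIV. if k = j then C $ a $ j * D $ j $ j else 0)"
    unfolding matrix_matrix_mult_def vec_lambda_beta
    by (intro sum.cong) (use assms in \<open>auto simp: diagonal_matrix_def\<close>)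
  then show "(C ** D) $ a $ j = C $ a $ j * D $ j $ j" by simp
qed

lemma invertible_diagonal_iff:
  fixes D :: "real ^ 'n ^ 'n"
  assumes D: "diagonal_matrix D"
  shows "invertible D \<longleftrightarrow> (\<forall>i. D $ i $ i \<noteq> 0)"
    and "invertible D \<Longrightarrow> (matrix_inv D *v x) $ i = x $ i / D $ i $ i"
proof -
  define R where "R = (\<chi> i j. if i = j then 1 / D $ i $ i else 0 :: real ^ 'n ^ 'n)"
  have R: "R ** D = mat 1" "D ** R = mat 1" if "\<forall>i. D $ i $ i \<noteq> 0"
    using that D by (auto simp: vec_eq_iff diagonal_matrix_mult[OF D] R_def mat_def diagonal_matrix_def)
  show iff: "invertible D \<longleftrightarrow> (\<forall>i. D $ i $ i \<noteq> 0)"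
  proof
    assume "invertible D"
    then obtain B where "D ** B = mat 1" by (auto simp: invertible_def)
    then have "D $ i $ i * B $ i $ i = 1" for i
      using diagonal_matrix_mult(1)[OF D, of B i i] by (simp add: mat_def)
    then show "\<forall>i. D $ i $ i \<noteq> 0" by (metis mult_zero_left zero_neq_one)
  qed (use R in \<open>auto simp: invertible_def\<close>)
  assume "invertible D"
  then have "matrix_inv D = R" using R iff by (intro matrix_inv_eqI) auto
  then have "(matrix_inv D *v x) $ i = (\<Sum>k\<in>UNIV. if k = i then x $ i / D $ i $ i else 0)"
    unfolding matrix_vector_mult_def vec_lambda_beta
    by (intro sum.cong) (auto simp: R_def)
  then show "(matrix_inv D *v x) $ i = x $ i / D $ i $ i" by simp
qed

section \<open>Existence of diagonal Gaussian laws\<close>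

text \<open>The image of independent standard normal variables under \<open>x\<^sub>k \<mapsto> \<xi>\<^sub>k + sqrt (v\<^sub>k) x\<^sub>k\<close>; this
covers vanishing variances.\<close>

lemma diagonal_gaussian_law_exists:
  fixes \<xi> :: "real ^ 'k" and v :: "'k \<Rightarrow> real"
  assumes v: "\<And>k. 0 \<le> v k"
  shows "\<exists>N :: (real ^ 'k) measure. prob_space N \<and> sets N = sets borel \<and>
    (\<forall>t. (LINT x|N. iexp (t \<bullet> x)) = gauss_char \<xi> (\<chi> i j. if i = j then v i else 0) t)"
proof -
  interpret S: real_distribution std_normal_distribution by (rule real_dist_normal_dist)
  interpret P: product_prob_space "\<lambda>_::'k. std_normal_distribution" UNIV ..
  let ?P = "PiM (UNIV :: 'k set) (\<lambda>_. std_normal_distribution)"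
  define h where "h x = (\<chi> k. \<xi> $ k + sqrt (v k) * x k)" for x :: "'k \<Rightarrow> real"
  have h [measurable]: "h \<in> borel_measurable ?P"
    unfolding h_def by (rule borel_measurable_vec_lambda) measurable
  let ?N = "distr ?P borel h"
  have "(LINT x|?N. iexp (t \<bullet> x)) = gauss_char \<xi> (\<chi> i j. if i = j then v i else 0) t" for t
  proof -
    have "(LINT x|?N. iexp (t \<bullet> x)) = (LINT x|?P. iexp (t \<bullet> h x))"
      by (rule integral_distr) auto
    also have "\<dots> = (LINT x|?P. (\<Prod>k\<in>UNIV. iexp (t $ k * \<xi> $ k) * iexp (t $ k * sqrt (v k) * x k)))"
    proof (rule Bochner_Integration.integral_cong[OF refl])
      fix x
      have "t \<bullet> h x = (\<Sum>k\<in>UNIV. t $ k * \<xi> $ k + t $ k * sqrt (v k) * x k)"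
        by (simp add: inner_vec_def h_def algebra_simps)
      then have "iexp (t \<bullet> h x) = (\<Prod>k\<in>UNIV. iexp (t $ k * \<xi> $ k + t $ k * sqrt (v k) * x k))"
        by (simp only: of_real_sum sum_distrib_left exp_sum finite)
      then show "iexp (t \<bullet> h x) = (\<Prod>k\<in>UNIV. iexp (t $ k * \<xi> $ k) * iexp (t $ k * sqrt (v k) * x k))"
        by (simp only: of_real_add distrib_left exp_add)
    qed
    also have "\<dots> = (\<Prod>k\<in>UNIV. LINT x|std_normal_distribution. iexp (t $ k * \<xi> $ k) * iexp (t $ k * sqrt (v k) * x))"
      by (rule P.product_integral_prod)
        (auto intro!: S.integrable_const_bound[of _ 1] simp: norm_mult simp del: of_real_mult)
    also have "\<dots> = (\<Prod>k\<in>UNIV. iexp (t $ k * \<xi> $ k) * char std_normal_distribution (t $ k * sqrt (v k)))"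
      unfolding char_def by simp
    also have "\<dots> = (\<Prod>k\<in>UNIV. exp (\<i> * complex_of_real (t $ k * \<xi> $ k) - complex_of_real (v k * (t $ k)\<^sup>2) / 2))"
    proof (rule prod.cong[OF refl])
      fix k
      have "char std_normal_distribution (t $ k * sqrt (v k)) = exp (- complex_of_real (v k * (t $ k)\<^sup>2) / 2)"
        using v by (simp add: char_std_normal_distribution exp_of_real[symmetric] power_mult_distrib mult.commute flip: of_real_power)
      then show "iexp (t $ k * \<xi> $ k) * char std_normal_distribution (t $ k * sqrt (v k)) =
          exp (\<i> * complex_of_real (t $ k * \<xi> $ k) - complex_of_real (v k * (t $ k)\<^sup>2) / 2)"
        by (simp flip: exp_add)
    qed
    also have "\<dots> = gauss_char \<xi> (\<chi> i j. if i = j then v i else 0) t"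
      by (subst gauss_exponent_diagonal) (auto simp: diagonal_matrix_def exp_sum)
    finally show ?thesis .
  qed
  moreover have "prob_space ?N" by (rule P.prob_space_distr) simp
  ultimately show ?thesis by (intro exI[of _ ?N]) auto
qed

section \<open>Comparison of two representations\<close>

text \<open>The columns of each matrix are pairwise non-proportional, so proportionality matches each column
of one matrix with exactly one column of the other.\<close>

lemma columns_correspond:
  fixes A1 :: "real ^ 'k ^ 'p" and A2 :: "real ^ 'l ^ 'p"
  assumes M: "prob_space M" and X: "X \<in> borel_measurable M"
    and rep1: "representation M X A1 Z1 E1 \<mu>1 \<Sigma>1"
    and rep2: "representation M X A2 Z2 E2 \<mu>2 \<Sigma>2"
  shows "\<exists>(\<pi> :: 'l \<Rightarrow> 'k) \<kappa>. bij \<pi> \<and> (\<forall>l. \<kappa> l \<noteq> 0 \<and> column l A2 = \<kappa> l *\<^sub>R column (\<pi> l) A1)"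
proof -
  have "\<forall>l. \<exists>k c. c \<noteq> 0 \<and> column l A2 = c *\<^sub>R column k A1"
    using column_proportional[OF M X rep2 rep1] by (auto simp: proportional_def)
  then obtain \<pi> \<kappa> where \<pi>: "\<And>l. \<kappa> l \<noteq> 0" "\<And>l. column l A2 = \<kappa> l *\<^sub>R column (\<pi> l) A1"
    by metis
  have "inj \<pi>"
  proof (rule injI, rule ccontr)
    fix a b assume ab: "\<pi> a = \<pi> b" "a \<noteq> b"
    have "column a A2 = (\<kappa> a / \<kappa> b) *\<^sub>R column b A2" using \<pi> ab by simp
    then have "proportional (column a A2) (column b A2)"
      unfolding proportional_def using \<pi>(1) by (intro exI[of _ "\<kappa> a / \<kappa> b"]) simp
    then show False using rep2 ab by (auto simp: representation_def)
  qed
  moreover have "surj \<pi>"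
    unfolding surj_def
  proof
    fix k
    obtain l c where c: "c \<noteq> 0" "column k A1 = c *\<^sub>R column l A2"
      using column_proportional[OF M X rep1 rep2, of k] by (auto simp: proportional_def)
    have "k = \<pi> l"
    proof (rule ccontr)
      assume "k \<noteq> \<pi> l"
      moreover have "proportional (column k A1) (column (\<pi> l) A1)"
        unfolding proportional_def using c \<pi> by (intro exI[of _ "c * \<kappa> l"]) simp
      ultimately show False using rep1 by (auto simp: representation_def)
    qed
    then show "\<exists>l. k = \<pi> l" by blast
  qed
  ultimately show ?thesis
    using \<pi> by (intro exI[of _ \<pi>] exI[of _ \<kappa>]) (simp add: bij_def)
qed

lemma rank_eq_of_columns:
  fixes A1 :: "real ^ 'k ^ 'p" and A2 :: "real ^ 'l ^ 'p"
  assumes "bij \<pi>" "\<And>l. \<kappa> l \<noteq> 0" "\<And>l. column l A2 = \<kappa> l *\<^sub>R column (\<pi> l) A1"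
  shows "rank A1 = rank A2"
proof -
  have "column l A2 \<in> span (columns A1)" for l
    unfolding assms(3) by (intro span_mul span_base) (auto simp: columns_def)
  then have "columns A2 \<subseteq> span (columns A1)" by (auto simp: columns_def)
  moreover have "column k A1 \<in> span (columns A2)" for k
  proof -
    obtain l where "k = \<pi> l" using assms(1) by (metis bij_pointE)
    then have "column k A1 = (1 / \<kappa> l) *\<^sub>R column l A2" using assms by simp
    then show ?thesis by (simp only:) (intro span_mul span_base, auto simp: columns_def)
  qed
  then have "columns A1 \<subseteq> span (columns A2)" by (auto simp: columns_def)
  ultimately have "span (columns A1) = span (columns A2)" by (simp add: span_eq)
  then show ?thesis unfolding column_rank_def by (metis dim_span)
qed

lemma prod_reindex_perm:
  fixes \<pi> :: "'l::finite \<Rightarrow> 'k::finite"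
  assumes "bij \<pi>"
  shows "(\<Prod>l\<in>UNIV. g (\<pi> l)) = (\<Prod>k\<in>UNIV. g k)"
  by (rule prod.reindex_bij_betw) (use assms in simp)

text \<open>The rows of a left inverse of \<open>A1\<close> are dual to its columns. At \<open>s\<close> times the dual vector of
column \<open>\<pi> l\<close>, all factors of the functional equation equal 1 except those of the matched
components and the Gaussian ones. The number \<open>v\<close> may have either sign here.\<close>

lemma characteristic_functions_matched:
  fixes A1 :: "real ^ 'k ^ 'p" and A2 :: "real ^ 'l ^ 'p" and B :: "real ^ 'p ^ 'k"
  assumes M: "prob_space M" and X: "X \<in> borel_measurable M"
    and rep1: "representation M X A1 Z1 E1 \<mu>1 \<Sigma>1"
    and rep2: "representation M X A2 Z2 E2 \<mu>2 \<Sigma>2"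
    and \<pi>: "bij \<pi>" and col: "\<And>l. column l A2 = \<kappa> l *\<^sub>R column (\<pi> l) A1"
    and B: "B ** A1 = mat 1"
  shows "\<exists>m v. \<forall>l s. char (distr M borel (\<lambda>\<omega>. Z2 \<omega> $ l)) (\<kappa> l * s) =
    char (distr M borel (\<lambda>\<omega>. Z1 \<omega> $ \<pi> l)) s * exp (\<i> * complex_of_real (s * m (\<pi> l)) - complex_of_real (v (\<pi> l) * s\<^sup>2) / 2)"
proof -
  let ?\<phi>1 = "\<lambda>k. char (distr M borel (\<lambda>\<omega>. Z1 \<omega> $ k))" and ?\<phi>2 = "\<lambda>l. char (distr M borel (\<lambda>\<omega>. Z2 \<omega> $ l))"
  have zero: "?\<phi>1 k 0 = 1" "?\<phi>2 l 0 = 1" for k l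
    using representation_measurable(3)[OF rep1] representation_measurable(3)[OF rep2] M
    by (auto intro!: real_distribution.char_zero real_distribution_distr_borel)
  define d where "d k = row k B" for k
  have dual: "column i A1 \<bullet> d k = (if i = k then 1 else 0)" for i k
    using arg_cong[OF B, of "\<lambda>C. C $ k $ i"]
    by (auto simp: d_def row_def column_def inner_vec_def matrix_matrix_mult_def mat_def mult.commute)
  define m where "m k = d k \<bullet> (\<mu>1 - \<mu>2)" for k
  define v where "v k = d k \<bullet> ((\<Sigma>1 - \<Sigma>2) *v d k)" for k
  have "?\<phi>2 l (\<kappa> l * s) = ?\<phi>1 (\<pi> l) s * exp (\<i> * complex_of_real (s * m (\<pi> l)) - complex_of_real (v (\<pi> l) * s\<^sup>2) / 2)" for l s
  proof -
    let ?t = "s *\<^sub>R d (\<pi> l)"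
    have inj: "\<pi> a = \<pi> b \<longleftrightarrow> a = b" for a b using \<pi> by (simp add: bij_def inj_eq)
    have "(\<Prod>k\<in>UNIV. ?\<phi>1 k (column k A1 \<bullet> ?t)) = (\<Prod>k\<in>UNIV. if k = \<pi> l then ?\<phi>1 (\<pi> l) s else 1)"
      by (intro prod.cong) (auto simp: dual zero)
    then have L: "(\<Prod>k\<in>UNIV. ?\<phi>1 k (column k A1 \<bullet> ?t)) = ?\<phi>1 (\<pi> l) s" by simp
    have "(\<Prod>k\<in>UNIV. ?\<phi>2 k (column k A2 \<bullet> ?t)) = (\<Prod>k\<in>UNIV. if k = l then ?\<phi>2 l (\<kappa> l * s) else 1)"
      by (intro prod.cong) (auto simp: dual zero col inj mult.commute)
    then have R: "(\<Prod>k\<in>UNIV. ?\<phi>2 k (column k A2 \<bullet> ?t)) = ?\<phi>2 l (\<kappa> l * s)" by simp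
    have "?\<phi>1 (\<pi> l) s * gauss_char \<mu>1 \<Sigma>1 ?t = ?\<phi>2 l (\<kappa> l * s) * gauss_char \<mu>2 \<Sigma>2 ?t"
      using representation_char[OF M X rep1, of ?t] representation_char[OF M X rep2, of ?t] unfolding L R by simp
    then have "?\<phi>2 l (\<kappa> l * s) = ?\<phi>1 (\<pi> l) s * exp (gauss_exponent \<mu>1 \<Sigma>1 ?t - gauss_exponent \<mu>2 \<Sigma>2 ?t)"
      by (simp add: exp_diff field_simps)
    also have "gauss_exponent \<mu>1 \<Sigma>1 ?t - gauss_exponent \<mu>2 \<Sigma>2 ?t =
        \<i> * complex_of_real (s * m (\<pi> l)) - complex_of_real (v (\<pi> l) * s\<^sup>2) / 2"
      unfolding gauss_exponent_def quadratic_form_scaleR m_def v_def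
      by (simp add: inner_diff_right matrix_vector_mult_diff_rdistrib field_simps)
    finally show ?thesis .
  qed
  then show ?thesis by blast
qed

text \<open>Near 0 the product of the characteristic functions of the components of \<open>Z1\<close> does not vanish and
can be cancelled from the functional equation; what remains is an identity between characteristic
functions of Gaussian vectors.\<close>

lemma gaussian_parts_matched:
  fixes A1 :: "real ^ 'k ^ 'p" and A2 :: "real ^ 'l ^ 'p"
  assumes M: "prob_space M" and X: "X \<in> borel_measurable M"
    and rep1: "representation M X A1 Z1 E1 \<mu>1 \<Sigma>1"
    and rep2: "representation M X A2 Z2 E2 \<mu>2 \<Sigma>2"
    and \<pi>: "bij \<pi>" and col: "\<And>l. column l A2 = \<kappa> l *\<^sub>R column (\<pi> l) A1"
    and \<Delta>: "diagonal_matrix \<Delta>"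
    and match: "\<And>l s. char (distr M borel (\<lambda>\<omega>. Z2 \<omega> $ l)) (\<kappa> l * s) =
      char (distr M borel (\<lambda>\<omega>. Z1 \<omega> $ \<pi> l)) s *
      exp (\<i> * complex_of_real (s * \<xi> $ \<pi> l) - complex_of_real (\<Delta> $ \<pi> l $ \<pi> l * s\<^sup>2) / 2)"
  shows "\<mu>1 = A1 *v \<xi> + \<mu>2 \<and> \<Sigma>1 = A1 ** \<Delta> ** transpose A1 + \<Sigma>2"
proof -
  let ?\<phi>1 = "\<lambda>k. char (distr M borel (\<lambda>\<omega>. Z1 \<omega> $ k))" and ?\<phi>2 = "\<lambda>l. char (distr M borel (\<lambda>\<omega>. Z2 \<omega> $ l))"
  have D: "real_distribution (distr M borel (\<lambda>\<omega>. Z1 \<omega> $ k))" for k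
    using representation_measurable(3)[OF rep1] M by (rule real_distribution_distr_borel[rotated])
  have "\<forall>\<^sub>F t in nhds 0. \<forall>k. ?\<phi>1 k (column k A1 \<bullet> t) \<noteq> 0"
  proof (rule eventually_all_finite)
    fix k
    have "isCont (\<lambda>t. ?\<phi>1 k (column k A1 \<bullet> t)) 0"
      by (rule isCont_o2[where f = "\<lambda>t. column k A1 \<bullet> t"]) (intro continuous_intros, rule real_distribution.isCont_char[OF D])
    then show "\<forall>\<^sub>F t in nhds 0. ?\<phi>1 k (column k A1 \<bullet> t) \<noteq> 0"
      by (rule tendsto_imp_eventually_ne[OF isCont_tendsto_nhds]) (simp add: real_distribution.char_zero[OF D])
  qed
  then obtain \<epsilon> where \<epsilon>: "0 < \<epsilon>" "\<And>t k. norm t < \<epsilon> \<Longrightarrow> ?\<phi>1 k (column k A1 \<bullet> t) \<noteq> 0"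
    unfolding eventually_nhds_metric by (auto simp: dist_norm)
  define b where "b = \<mu>1 - (A1 *v \<xi> + \<mu>2)"
  define S where "S = \<Sigma>1 - (A1 ** \<Delta> ** transpose A1 + \<Sigma>2)"
  have "gauss_char b S t = 1" if t: "norm t < \<epsilon>" for t
  proof -
    define s where "s = transpose A1 *v t"
    have s: "s $ k = column k A1 \<bullet> t" for k by (simp only: s_def transpose_mult_nth)
    let ?g = "\<lambda>k. exp (\<i> * complex_of_real (s $ k * \<xi> $ k) - complex_of_real (\<Delta> $ k $ k * (s $ k)\<^sup>2) / 2)"
    have "(\<Prod>l\<in>UNIV. ?\<phi>2 l (column l A2 \<bullet> t)) = (\<Prod>l\<in>UNIV. ?\<phi>1 (\<pi> l) (s $ \<pi> l) * ?g (\<pi> l))"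
      by (simp only: col inner_scaleR_left s[symmetric] match)
    also have "\<dots> = (\<Prod>k\<in>UNIV. ?\<phi>1 k (s $ k) * ?g k)" by (rule prod_reindex_perm[OF \<pi>])
    also have "\<dots> = (\<Prod>k\<in>UNIV. ?\<phi>1 k (column k A1 \<bullet> t)) * gauss_char \<xi> \<Delta> s"
      unfolding gauss_exponent_diagonal[OF \<Delta>] by (simp only: prod.distrib exp_sum finite s)
    finally have "(\<Prod>k\<in>UNIV. ?\<phi>1 k (column k A1 \<bullet> t)) * gauss_char \<mu>1 \<Sigma>1 t =
        (\<Prod>k\<in>UNIV. ?\<phi>1 k (column k A1 \<bullet> t)) * gauss_char \<xi> \<Delta> s * gauss_char \<mu>2 \<Sigma>2 t"
      using representation_char[OF M X rep1, of t] representation_char[OF M X rep2, of t] by metis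
    then have eq: "gauss_char \<mu>1 \<Sigma>1 t = exp (gauss_exponent (A1 *v \<xi> + \<mu>2) (A1 ** \<Delta> ** transpose A1 + \<Sigma>2) t)"
      using \<epsilon>(2)[OF t] by (simp add: gauss_exponent_add gauss_exponent_linear_image s_def exp_add mult.assoc)
    have "gauss_exponent \<mu>1 \<Sigma>1 t = gauss_exponent b S t + gauss_exponent (A1 *v \<xi> + \<mu>2) (A1 ** \<Delta> ** transpose A1 + \<Sigma>2) t"
      unfolding gauss_exponent_add[symmetric] by (simp add: b_def S_def)
    then show ?thesis using eq by (simp add: exp_add)
  qed
  moreover have "transpose S = S"
  proof -
    have sym: "transpose \<Sigma>1 = \<Sigma>1" "transpose \<Sigma>2 = \<Sigma>2"
      using rep1 rep2 by (auto simp: representation_def gaussian_vector_def pos_semidef_def)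
    have "transpose \<Delta> = \<Delta>"
      using \<Delta> by (auto simp: vec_eq_iff transpose_def diagonal_matrix_def) metis
    then have "transpose (A1 ** \<Delta> ** transpose A1) = A1 ** \<Delta> ** transpose A1"
      by (simp add: matrix_transpose_mul matrix_mul_assoc)
    with sym show ?thesis by (simp add: S_def vec_eq_iff transpose_def)
  qed
  ultimately have "b = 0 \<and> S = 0" using \<epsilon>(1) by (intro gauss_exponent_eq_0_near_0) auto
  then show ?thesis by (simp add: b_def S_def)
qed

section \<open>The Gaussian shift between two representations\<close>

text \<open>The linear map that turns \<open>Z1 + H\<close> into a copy of \<open>Z2\<close> picks, for each \<open>l\<close>, the entry of index
\<open>\<pi> l\<close> and divides it by the diagonal entry of \<open>\<Lambda>\<close>. On the side of characteristic functions it acts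
by the inverse relabelling of \<open>t\<close>.\<close>

lemma inner_unmixed:
  fixes \<pi> :: "'l::finite \<Rightarrow> 'k::finite" and \<Lambda> :: "real ^ 'l ^ 'l"
  assumes \<pi>: "bij \<pi>" and \<Lambda>: "diagonal_matrix \<Lambda>" "invertible \<Lambda>"
  shows "t \<bullet> (matrix_inv \<Lambda> *v (matrix_inv (perm_matrix \<pi>) *v x)) =
    (\<chi> k. t $ inv \<pi> k / \<Lambda> $ inv \<pi> k $ inv \<pi> k) \<bullet> x"
proof -
  let ?g = "\<lambda>k. t $ inv \<pi> k / \<Lambda> $ inv \<pi> k $ inv \<pi> k * x $ k"
  have "(\<Sum>l\<in>UNIV. ?g (\<pi> l)) = (\<Sum>k\<in>UNIV. ?g k)"
    by (rule sum.reindex_bij_betw) (use \<pi> in simp)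
  moreover have "inv \<pi> (\<pi> l) = l" for l using \<pi> by (simp add: bij_is_inj)
  ultimately show ?thesis
    by (simp add: inner_vec_def invertible_diagonal_iff(2)[OF \<Lambda>] matrix_inv_perm_matrix_mult[OF \<pi>])
qed

lemma distr_vec_eqI:
  fixes U :: "'a \<Rightarrow> real ^ 'n" and V :: "'b \<Rightarrow> real ^ 'n"
  assumes "prob_space M" "prob_space N" and [measurable]: "U \<in> borel_measurable M" "V \<in> borel_measurable N"
    and eq: "\<And>t. (LINT \<omega>|M. iexp (t \<bullet> U \<omega>)) = (LINT \<omega>|N. iexp (t \<bullet> V \<omega>))"
  shows "distr M borel U = distr N borel V"
proof (rule char_uniqueness_vec)
  show "prob_space (distr M borel U)" "prob_space (distr N borel V)"
    using assms by (auto intro: prob_space.prob_space_distr)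
  fix t
  have "(LINT x|distr M borel U. iexp (t \<bullet> x)) = (LINT \<omega>|M. iexp (t \<bullet> U \<omega>))"
    by (rule integral_distr) auto
  moreover have "(LINT x|distr N borel V. iexp (t \<bullet> x)) = (LINT \<omega>|N. iexp (t \<bullet> V \<omega>))"
    by (rule integral_distr) auto
  ultimately show "(LINT x|distr M borel U. iexp (t \<bullet> x)) = (LINT x|distr N borel V. iexp (t \<bullet> x))"
    using eq by simp
qed auto

text \<open>The law of \<open>H\<close> has as parameters the numbers \<open>m\<close> and \<open>v\<close> from the comparison of matched
components, and \<open>H\<close> is the second projection of the product space, which makes it independent of
everything defined on the first factor.\<close>

lemma gaussian_shift_exists:
  fixes A1 :: "real ^ 'k ^ 'p" and A2 :: "real ^ 'l ^ 'p" and M :: "'a measure"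
  assumes M: "prob_space M" and X: "X \<in> borel_measurable M"
    and rep1: "representation M X A1 Z1 E1 \<mu>1 \<Sigma>1"
    and rep2: "representation M X A2 Z2 E2 \<mu>2 \<Sigma>2"
    and rank: "rank A1 = CARD('k)"
    and free: "\<And>k. gaussian_free M (\<lambda>\<omega>. Z1 \<omega> $ k)"
  shows "\<exists>(P :: real ^ 'l ^ 'k) \<Lambda> (N :: (real ^ 'k) measure) H \<xi> \<Delta>.
         gaussian_shift_relation M A1 Z1 E1 \<mu>1 \<Sigma>1 A2 Z2 E2 \<mu>2 \<Sigma>2 P \<Lambda> N H \<xi> \<Delta>"
proof -
  note meas [measurable] = representation_measurable[OF rep1] representation_measurable[OF rep2]
  let ?\<phi>1 = "\<lambda>k. char (distr M borel (\<lambda>\<omega>. Z1 \<omega> $ k))" and ?\<phi>2 = "\<lambda>l. char (distr M borel (\<lambda>\<omega>. Z2 \<omega> $ l))"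
  obtain \<pi> :: "'l \<Rightarrow> 'k" and \<kappa> where \<pi>: "bij \<pi>" and \<kappa>: "\<And>l. \<kappa> l \<noteq> 0"
    and col: "\<And>l. column l A2 = \<kappa> l *\<^sub>R column (\<pi> l) A1"
    using columns_correspond[OF M X rep1 rep2] by blast
  obtain B where B: "B ** A1 = mat 1"
    using rank full_rank_injective[of A1] matrix_left_invertible_injective[of A1] by blast
  obtain m v where match: "\<And>l s. ?\<phi>2 l (\<kappa> l * s) =
      ?\<phi>1 (\<pi> l) s * exp (\<i> * complex_of_real (s * m (\<pi> l)) - complex_of_real (v (\<pi> l) * s\<^sup>2) / 2)"
    using characteristic_functions_matched[OF M X rep1 rep2 \<pi> col B] by blast
  have v: "0 \<le> v k" for k
  proof (rule ccontr)
    assume neg: "\<not> 0 \<le> v k"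
    obtain l where l: "k = \<pi> l" using \<pi> by (metis bij_pointE)
    \<comment> \<open>The matching identity, solved for the characteristic function of the component of \<open>Z1\<close>: it is
      that of an affine image of the component of \<open>Z2\<close> times a centred normal one with variance
      \<open>- v k\<close>.\<close>
    let ?N = "distr M borel (\<lambda>\<omega>. \<kappa> l * Z2 \<omega> $ l + - m k)"
    have "\<not> gaussian_free M (\<lambda>\<omega>. Z1 \<omega> $ k)"
    proof (rule not_gaussian_freeI[OF M])
      show "real_distribution ?N" by (rule real_distribution_distr_borel[OF M]) simp
      show "0 < - v k" using neg by simp
      fix s
      have "char ?N s = iexp (s * (- m k)) * (?\<phi>1 k s * exp (\<i> * complex_of_real (s * m k) - complex_of_real (v k * s\<^sup>2) / 2))"
        unfolding l match[symmetric] by (subst char_distr_affine) (simp_all add: mult.commute)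
      also have "\<dots> = ?\<phi>1 k s * exp (- complex_of_real (v k * s\<^sup>2) / 2)"
        by (simp add: mult.left_commute flip: exp_add)
      finally show "?\<phi>1 k s = char ?N s * exp (- complex_of_real (- v k * s\<^sup>2) / 2)"
        by (simp add: mult.assoc flip: exp_add)
    qed simp
    then show False using free by simp
  qed
  define \<xi> where "\<xi> = (\<chi> k. m k)"
  define \<Delta> where "\<Delta> = (\<chi> i j. if i = j then v i else 0 :: real ^ 'k ^ 'k)"
  have \<Delta>: "diagonal_matrix \<Delta>" by (simp add: diagonal_matrix_def \<Delta>_def)
  define \<Lambda> where "\<Lambda> = (\<chi> i j. if i = j then \<kappa> i else 0 :: real ^ 'l ^ 'l)"
  have \<Lambda>: "diagonal_matrix \<Lambda>" by (simp add: diagonal_matrix_def \<Lambda>_def)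
  have "\<forall>i. \<Lambda> $ i $ i \<noteq> 0" using \<kappa> by (simp add: \<Lambda>_def)
  then have \<Lambda>_inv: "invertible \<Lambda>" using invertible_diagonal_iff(1)[OF \<Lambda>] by blast
  obtain N :: "(real ^ 'k) measure" where N: "prob_space N" and N_sets [measurable_cong]: "sets N = sets borel"
    and N_char: "\<And>t. (LINT x|N. iexp (t \<bullet> x)) = gauss_char \<xi> \<Delta> t"
    using diagonal_gaussian_law_exists[where v = v and \<xi> = \<xi>, OF v] unfolding \<Delta>_def by blast
  have MN: "prob_space (M \<Otimes>\<^sub>M N)" using M N by (rule prob_space_pair)
  have snd_meas [measurable]: "snd \<in> borel_measurable (M \<Otimes>\<^sub>M N)"
    by measurable
  have gauss: "\<mu>1 = A1 *v \<xi> + \<mu>2 \<and> \<Sigma>1 = A1 ** \<Delta> ** transpose A1 + \<Sigma>2"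
    by (rule gaussian_parts_matched[OF M X rep1 rep2 \<pi> col \<Delta>]) (simp add: match \<xi>_def \<Delta>_def)
  have "gaussian_vector (M \<Otimes>\<^sub>M N) snd \<xi> \<Delta>"
    unfolding gaussian_vector_def
  proof (intro conjI allI)
    have "(\<Delta> *v x) $ k = v k * x $ k" for x k
      by (simp add: matrix_vector_mult_def \<Delta>_def if_distrib[of "\<lambda>a. a * _"] cong: if_cong)
    then have "0 \<le> x \<bullet> (\<Delta> *v x)" for x
      using v by (auto simp: inner_vec_def mult.left_commute intro!: sum_nonneg)
    moreover have "transpose \<Delta> = \<Delta>" by (auto simp: \<Delta>_def transpose_def vec_eq_iff)
    ultimately show "pos_semidef \<Delta>" by (simp add: pos_semidef_def)
    show "(LINT \<omega>|(M \<Otimes>\<^sub>M N). iexp (t \<bullet> snd \<omega>)) =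
        exp (\<i> * complex_of_real (t \<bullet> \<xi>) - complex_of_real (t \<bullet> (\<Delta> *v t)) / 2)" for t
      using integral_pair_snd[OF M N, of "\<lambda>x. iexp (t \<bullet> x)"] N_char[of t] by (simp add: gauss_exponent_def)
  qed measurable
  moreover have "indep_rv (M \<Otimes>\<^sub>M N) snd (\<lambda>\<omega>. (Z1 (fst \<omega>), E2 (fst \<omega>)))"
  proof -
    have "(\<lambda>\<omega>. (Z1 \<omega>, E2 \<omega>)) \<in> borel_measurable M" by (rule borel_measurable_Pair[OF meas(1,5)])
    moreover have "(\<lambda>x. x) \<in> borel_measurable N" by (rule measurable_ident_sets[OF N_sets])
    ultimately show ?thesis by (rule indep_rv_pair[OF M N])
  qed
  moreover have "A2 = A1 ** perm_matrix \<pi> ** \<Lambda>"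
  proof -
    have "(A1 ** perm_matrix \<pi>) $ i $ l = A1 $ i $ \<pi> l" for i l
      by (simp add: matrix_matrix_mult_def perm_matrix_def if_distrib[of "\<lambda>a. _ * a"] cong: if_cong)
    moreover have "A2 $ i $ l = \<kappa> l * A1 $ i $ \<pi> l" for i l
      using arg_cong[OF col, of "\<lambda>c. c $ i"] by (simp add: column_def)
    ultimately show ?thesis
      by (simp add: vec_eq_iff diagonal_matrix_mult(2)[OF \<Lambda>]) (simp add: \<Lambda>_def)
  qed
  moreover have "distr M borel Z2 =
      distr (M \<Otimes>\<^sub>M N) borel (\<lambda>\<omega>. matrix_inv \<Lambda> *v (matrix_inv (perm_matrix \<pi>) *v (Z1 (fst \<omega>) + snd \<omega>)))"
  proof (rule distr_vec_eqI[OF M MN])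
    fix t :: "real ^ 'l"
    define s where "s = (\<chi> k. t $ inv \<pi> k / \<Lambda> $ inv \<pi> k $ inv \<pi> k)"
    have s: "\<kappa> l * s $ \<pi> l = t $ l" for l
      using \<pi> \<kappa> by (simp add: s_def \<Lambda>_def bij_is_inj)
    let ?g = "\<lambda>k. exp (\<i> * complex_of_real (s $ k * \<xi> $ k) - complex_of_real (\<Delta> $ k $ k * (s $ k)\<^sup>2) / 2)"
    have "(LINT \<omega>|(M \<Otimes>\<^sub>M N). iexp (t \<bullet> (matrix_inv \<Lambda> *v (matrix_inv (perm_matrix \<pi>) *v (Z1 (fst \<omega>) + snd \<omega>))))) =
        (LINT \<omega>|(M \<Otimes>\<^sub>M N). iexp (s \<bullet> Z1 (fst \<omega>)) * iexp (s \<bullet> snd \<omega>))"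
      unfolding inner_unmixed[OF \<pi> \<Lambda> \<Lambda>_inv] s_def[symmetric]
      by (simp only: inner_add_right of_real_add distrib_left exp_add)
    also have "\<dots> = (LINT \<omega>|M. iexp (s \<bullet> Z1 \<omega>)) * (LINT x|N. iexp (s \<bullet> x))"
      by (rule integral_pair_mult[OF M N]) auto
    also have "\<dots> = (\<Prod>k\<in>UNIV. ?\<phi>1 k (s $ k) * ?g k)"
      unfolding N_char representation_char_Z[OF M rep1] gauss_exponent_diagonal[OF \<Delta>]
      by (simp only: exp_sum finite prod.distrib)
    also have "\<dots> = (\<Prod>l\<in>UNIV. ?\<phi>1 (\<pi> l) (s $ \<pi> l) * ?g (\<pi> l))"
      by (rule prod_reindex_perm[OF \<pi>, symmetric])
    also have "\<dots> = (\<Prod>l\<in>UNIV. ?\<phi>2 l (t $ l))"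
      unfolding s[symmetric] match by (simp add: \<xi>_def \<Delta>_def)
    finally show "(LINT \<omega>|M. iexp (t \<bullet> Z2 \<omega>)) =
        (LINT \<omega>|(M \<Otimes>\<^sub>M N). iexp (t \<bullet> (matrix_inv \<Lambda> *v (matrix_inv (perm_matrix \<pi>) *v (Z1 (fst \<omega>) + snd \<omega>)))))"
      by (simp only: representation_char_Z[OF M rep2])
  qed measurable
  moreover have "distr M borel E1 = distr (M \<Otimes>\<^sub>M N) borel (\<lambda>\<omega>. A1 *v snd \<omega> + E2 (fst \<omega>))"
  proof (rule distr_vec_eqI[OF M MN])
    fix t :: "real ^ 'p"
    let ?s = "transpose A1 *v t"
    have "(LINT \<omega>|(M \<Otimes>\<^sub>M N). iexp (t \<bullet> (A1 *v snd \<omega> + E2 (fst \<omega>)))) =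
        (LINT \<omega>|(M \<Otimes>\<^sub>M N). iexp (t \<bullet> E2 (fst \<omega>)) * iexp (?s \<bullet> snd \<omega>))"
      by (simp only: inner_add_right inner_matrix_mult_transpose of_real_add distrib_left exp_add mult.commute)
    also have "\<dots> = (LINT \<omega>|M. iexp (t \<bullet> E2 \<omega>)) * (LINT x|N. iexp (?s \<bullet> x))"
      by (rule integral_pair_mult[OF M N]) auto
    also have "\<dots> = gauss_char \<mu>1 \<Sigma>1 t"
      unfolding N_char representation_char_E[OF rep2]
      by (simp only: gauss gauss_exponent_add gauss_exponent_linear_image exp_add mult.commute)
    finally show "(LINT \<omega>|M. iexp (t \<bullet> E1 \<omega>)) = (LINT \<omega>|(M \<Otimes>\<^sub>M N). iexp (t \<bullet> (A1 *v snd \<omega> + E2 (fst \<omega>))))"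
      by (simp only: representation_char_E[OF rep1])
  qed measurable
  moreover have "permutation_matrix (perm_matrix \<pi>)"
    using \<pi> by (auto simp: permutation_matrix_def perm_matrix_def)
  ultimately have "gaussian_shift_relation M A1 Z1 E1 \<mu>1 \<Sigma>1 A2 Z2 E2 \<mu>2 \<Sigma>2 (perm_matrix \<pi>) \<Lambda> N snd \<xi> \<Delta>"
    unfolding gaussian_shift_relation_def using \<Lambda> \<Lambda>_inv \<Delta> N gauss by blast
  then show ?thesis by blast
qed

text \<open>The \<open>l\<close>-th component of \<open>Z2\<close> is distributed as the sum of the \<open>\<pi> l\<close>-th components of \<open>Z1\<close> and
\<open>H\<close>, which are independent, divided by a non-zero constant. A positive variance of the latter
would be a normal convolution factor.\<close>

lemma gaussian_shift_covariance_zero: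
  fixes A1 :: "real ^ 'k ^ 'p" and A2 :: "real ^ 'l ^ 'p" and M :: "'a measure" and N :: "'b measure"
  assumes M: "prob_space M"
    and [measurable]: "Z1 \<in> borel_measurable M" "Z2 \<in> borel_measurable M"
    and free: "\<And>l. gaussian_free M (\<lambda>\<omega>. Z2 \<omega> $ l)"
    and rel: "gaussian_shift_relation M A1 Z1 E1 \<mu>1 \<Sigma>1 A2 Z2 E2 \<mu>2 \<Sigma>2 P \<Lambda> N H \<xi> \<Delta>"
  shows "\<Delta> = 0"
proof -
  obtain \<pi> where \<pi>: "bij \<pi>" and P: "P = perm_matrix \<pi>"
    using rel by (auto simp: gaussian_shift_relation_def permutation_matrix_def perm_matrix_def)
  have \<Lambda>: "diagonal_matrix \<Lambda>" "invertible \<Lambda>" and N: "prob_space N" and \<Delta>: "diagonal_matrix \<Delta>"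
    and psd: "pos_semidef \<Delta>" and [measurable]: "H \<in> borel_measurable (M \<Otimes>\<^sub>M N)"
    and H_char: "\<And>t. (LINT \<omega>|(M \<Otimes>\<^sub>M N). iexp (t \<bullet> H \<omega>)) = gauss_char \<xi> \<Delta> t"
    and ind: "indep_rv (M \<Otimes>\<^sub>M N) H (\<lambda>\<omega>. (Z1 (fst \<omega>), E2 (fst \<omega>)))"
    and law: "distr M borel Z2 =
       distr (M \<Otimes>\<^sub>M N) borel (\<lambda>\<omega>. matrix_inv \<Lambda> *v (matrix_inv P *v (Z1 (fst \<omega>) + H \<omega>)))"
    using rel by (auto simp: gaussian_shift_relation_def gaussian_vector_def gauss_exponent_def)
  have MN: "prob_space (M \<Otimes>\<^sub>M N)" using M N by (rule prob_space_pair)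
  have comp [measurable]: "(\<lambda>\<omega>. Z1 \<omega> $ k) \<in> borel_measurable M" "(\<lambda>\<omega>. Z2 \<omega> $ l) \<in> borel_measurable M" for k l
    by (rule borel_measurable_continuous_on[where f = "\<lambda>x. x $ _"]; (intro continuous_intros | simp))+
  have axis_char: "gauss_char \<xi> \<Delta> (axis k r) = exp (\<i> * complex_of_real (r * \<xi> $ k) - complex_of_real (\<Delta> $ k $ k * r\<^sup>2) / 2)" for k r
  proof -
    have "gauss_exponent \<xi> \<Delta> (axis k r) = (\<Sum>j\<in>UNIV. if j = k then \<i> * complex_of_real (r * \<xi> $ k) - complex_of_real (\<Delta> $ k $ k * r\<^sup>2) / 2 else 0)"
      unfolding gauss_exponent_diagonal[OF \<Delta>] by (intro sum.cong) (auto simp: axis_def)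
    then show ?thesis by simp
  qed
  have "\<Delta> $ k $ k = 0" for k
  proof (rule ccontr)
    assume nz: "\<Delta> $ k $ k \<noteq> 0"
    have "axis k 1 \<bullet> (\<Delta> *v axis k 1) = \<Delta> $ k $ k"
      by (simp add: inner_axis' matrix_vector_mult_basis column_def)
    then have pos: "0 < \<Delta> $ k $ k" using psd nz by (metis pos_semidef_def order_le_less)
    obtain l where l: "k = \<pi> l" using \<pi> by (metis bij_pointE)
    define c where "c = \<Lambda> $ l $ l"
    have c: "c \<noteq> 0" using \<Lambda> by (simp add: c_def invertible_diagonal_iff(1)[OF \<Lambda>(1)])
    let ?N = "distr M borel (\<lambda>\<omega>. (1 / c) * Z1 \<omega> $ k + \<xi> $ k / c)"
    have "\<not> gaussian_free M (\<lambda>\<omega>. Z2 \<omega> $ l)"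
    proof (rule not_gaussian_freeI[OF M])
      show "real_distribution ?N" by (rule real_distribution_distr_borel[OF M]) simp
      show "0 < \<Delta> $ k $ k / c\<^sup>2" using pos c by simp
      fix s
      let ?W = "\<lambda>\<omega>. matrix_inv \<Lambda> *v (matrix_inv P *v (Z1 (fst \<omega>) + H \<omega>))"
      have "char (distr M borel (\<lambda>\<omega>. Z2 \<omega> $ l)) s = (LINT \<omega>|M. iexp (axis l s \<bullet> Z2 \<omega>))"
        by (subst char_distr) (simp_all add: inner_axis')
      also have "\<dots> = (LINT x|distr M borel Z2. iexp (axis l s \<bullet> x))"
        by (rule integral_distr[symmetric]) auto
      also have "\<dots> = (LINT \<omega>|(M \<Otimes>\<^sub>M N). iexp (axis l s \<bullet> ?W \<omega>))"
        unfolding law by (rule integral_distr) auto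
      also have "\<dots> = (LINT \<omega>|(M \<Otimes>\<^sub>M N). iexp (axis k (s / c) \<bullet> H \<omega>) * iexp (s / c * fst (Z1 (fst \<omega>), E2 (fst \<omega>)) $ k))"
      proof (rule Bochner_Integration.integral_cong[OF refl])
        fix \<omega>
        have "axis l s \<bullet> ?W \<omega> = axis k (s / c) \<bullet> H \<omega> + s / c * fst (Z1 (fst \<omega>), E2 (fst \<omega>)) $ k"
          by (simp add: inner_axis' P invertible_diagonal_iff(2)[OF \<Lambda>] matrix_inv_perm_matrix_mult[OF \<pi>] l c_def distrib_left add_divide_distrib)
        then show "iexp (axis l s \<bullet> ?W \<omega>) = iexp (axis k (s / c) \<bullet> H \<omega>) * iexp (s / c * fst (Z1 (fst \<omega>), E2 (fst \<omega>)) $ k)"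
          by (simp only: of_real_add distrib_left exp_add)
      qed
      also have "\<dots> = (LINT \<omega>|(M \<Otimes>\<^sub>M N). iexp (axis k (s / c) \<bullet> H \<omega>)) *
          (LINT \<omega>|(M \<Otimes>\<^sub>M N). iexp (s / c * fst (Z1 (fst \<omega>), E2 (fst \<omega>)) $ k))"
      proof (rule indep_rv_integral_mult[OF MN ind, where f = "\<lambda>x. iexp (axis k (s / c) \<bullet> x)" and g = "\<lambda>y. iexp (s / c * fst y $ k)"])
        show "(\<lambda>y. iexp (s / c * fst y $ k)) \<in> borel_measurable borel"
          by (intro borel_measurable_continuous_onI continuous_intros)
      qed (auto simp del: of_real_mult of_real_divide)
      also have "(LINT \<omega>|(M \<Otimes>\<^sub>M N). iexp (s / c * fst (Z1 (fst \<omega>), E2 (fst \<omega>)) $ k)) = char (distr M borel (\<lambda>\<omega>. Z1 \<omega> $ k)) (s / c)"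
        unfolding fst_conv
        by (subst integral_pair_fst[OF M N, of "\<lambda>\<omega>. iexp (s / c * Z1 \<omega> $ k)"]) (simp_all only: char_distr[OF comp(1)], measurable)
      also have "(LINT \<omega>|(M \<Otimes>\<^sub>M N). iexp (axis k (s / c) \<bullet> H \<omega>)) * char (distr M borel (\<lambda>\<omega>. Z1 \<omega> $ k)) (s / c) =
          char ?N s * exp (- complex_of_real (\<Delta> $ k $ k / c\<^sup>2 * s\<^sup>2) / 2)"
        unfolding H_char axis_char char_distr_affine[OF comp(1)]
        by (simp add: exp_diff exp_minus power_divide field_simps)
      finally show "char (distr M borel (\<lambda>\<omega>. Z2 \<omega> $ l)) s = char ?N s * exp (- complex_of_real (\<Delta> $ k $ k / c\<^sup>2 * s\<^sup>2) / 2)" .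
    qed simp
    then show False using free by simp
  qed
  then show "\<Delta> = 0" using \<Delta> by (auto simp: vec_eq_iff diagonal_matrix_def) metis
qed

lemma distr_pair_deterministic:
  fixes g :: "'h \<Rightarrow> 'a \<Rightarrow> 'c::topological_space"
  assumes "prob_space M" "prob_space N" and H: "AE \<omega> in M \<Otimes>\<^sub>M N. H \<omega> = \<xi>"
    and [measurable]: "(\<lambda>\<omega>. g (H \<omega>) (fst \<omega>)) \<in> borel_measurable (M \<Otimes>\<^sub>M N)" "g \<xi> \<in> borel_measurable M"
  shows "distr (M \<Otimes>\<^sub>M N) borel (\<lambda>\<omega>. g (H \<omega>) (fst \<omega>)) = distr M borel (g \<xi>)"
proof -
  have "distr (M \<Otimes>\<^sub>M N) borel (\<lambda>\<omega>. g (H \<omega>) (fst \<omega>)) = distr (M \<Otimes>\<^sub>M N) borel (\<lambda>\<omega>. g \<xi> (fst \<omega>))"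
    using H by (intro distr_cong_AE) auto
  also have "\<dots> = distr (distr (M \<Otimes>\<^sub>M N) M fst) borel (g \<xi>)"
    by (subst distr_distr) (auto simp: comp_def)
  finally show ?thesis by (simp add: distr_pair_fst[OF assms(1,2)])
qed

text \<open>A Gaussian vector with covariance 0 has the characteristic function of a constant, so it is
almost surely constant and can be replaced by its value in all laws.\<close>

lemma gaussian_shift_deterministic:
  fixes A1 :: "real ^ 'k ^ 'p" and A2 :: "real ^ 'l ^ 'p" and M :: "'a measure" and N :: "'b measure"
  assumes M: "prob_space M"
    and [measurable]: "Z1 \<in> borel_measurable M" "E1 \<in> borel_measurable M" "E2 \<in> borel_measurable M"
    and rel: "gaussian_shift_relation M A1 Z1 E1 \<mu>1 \<Sigma>1 A2 Z2 E2 \<mu>2 \<Sigma>2 P \<Lambda> N H \<xi> 0"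
  shows "(AE \<omega> in M \<Otimes>\<^sub>M N. H \<omega> = \<xi>) \<and>
    distr M borel Z2 = distr M borel (\<lambda>\<omega>. matrix_inv \<Lambda> *v (matrix_inv P *v (Z1 \<omega> + \<xi>))) \<and>
    distr M borel E2 = distr M borel (\<lambda>\<omega>. E1 \<omega> - A1 *v \<xi>) \<and> \<Sigma>2 = \<Sigma>1"
proof -
  have N: "prob_space N" and [measurable]: "H \<in> borel_measurable (M \<Otimes>\<^sub>M N)"
    and H_char: "\<And>t. (LINT \<omega>|(M \<Otimes>\<^sub>M N). iexp (t \<bullet> H \<omega>)) = gauss_char \<xi> 0 t"
    and law_Z: "distr M borel Z2 =
       distr (M \<Otimes>\<^sub>M N) borel (\<lambda>\<omega>. matrix_inv \<Lambda> *v (matrix_inv P *v (Z1 (fst \<omega>) + H \<omega>)))"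
    and law_E: "distr M borel E1 = distr (M \<Otimes>\<^sub>M N) borel (\<lambda>\<omega>. A1 *v H \<omega> + E2 (fst \<omega>))"
    and \<Sigma>: "\<Sigma>1 = A1 ** 0 ** transpose A1 + \<Sigma>2"
    using rel by (auto simp: gaussian_shift_relation_def gaussian_vector_def gauss_exponent_def)
  have MN: "prob_space (M \<Otimes>\<^sub>M N)" using M N by (rule prob_space_pair)
  have ret: "distr (M \<Otimes>\<^sub>M N) borel H = return borel \<xi>"
  proof (rule char_uniqueness_vec)
    show "prob_space (distr (M \<Otimes>\<^sub>M N) borel H)" by (rule prob_space.prob_space_distr[OF MN]) simp
    show "prob_space (return borel \<xi>)" by (rule prob_space_return) simp
    fix t
    have "(LINT x|distr (M \<Otimes>\<^sub>M N) borel H. iexp (t \<bullet> x)) = (LINT \<omega>|(M \<Otimes>\<^sub>M N). iexp (t \<bullet> H \<omega>))"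
      by (rule integral_distr) auto
    also have "\<dots> = iexp (t \<bullet> \<xi>)" unfolding H_char by (simp add: gauss_exponent_def)
    also have "\<dots> = (LINT x|return borel \<xi>. iexp (t \<bullet> x))" by (rule integral_return[symmetric]) auto
    finally show "(LINT x|distr (M \<Otimes>\<^sub>M N) borel H. iexp (t \<bullet> x)) = (LINT x|return borel \<xi>. iexp (t \<bullet> x))" .
  qed auto
  have "AE x in distr (M \<Otimes>\<^sub>M N) borel H. x = \<xi>" unfolding ret by (subst AE_return) auto
  then have H: "AE \<omega> in M \<Otimes>\<^sub>M N. H \<omega> = \<xi>" by (subst (asm) AE_distr_iff) auto
  have Z: "distr M borel Z2 = distr M borel (\<lambda>\<omega>. matrix_inv \<Lambda> *v (matrix_inv P *v (Z1 \<omega> + \<xi>)))"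
    unfolding law_Z by (rule distr_pair_deterministic[OF M N H, where g = "\<lambda>h \<omega>. matrix_inv \<Lambda> *v (matrix_inv P *v (Z1 \<omega> + h))"]) measurable
  have E: "distr M borel E1 = distr M borel (\<lambda>\<omega>. A1 *v \<xi> + E2 \<omega>)"
    unfolding law_E by (rule distr_pair_deterministic[OF M N H, where g = "\<lambda>h \<omega>. A1 *v h + E2 \<omega>"]) measurable
  have "distr M borel (\<lambda>\<omega>. E1 \<omega> - A1 *v \<xi>) = distr (distr M borel E1) borel (\<lambda>x. x - A1 *v \<xi>)"
    by (subst distr_distr) (auto simp: comp_def)
  also have "\<dots> = distr M borel E2"
    unfolding E by (subst distr_distr) (auto simp: comp_def)
  finally show ?thesis using H Z \<Sigma> by simp
qed

theorem theorem6p12: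
  fixes M :: "'a measure"
    and X :: "'a \<Rightarrow> real ^ 'p"
    and A1 :: "real ^ 'k ^ 'p" and Z1 :: "'a \<Rightarrow> real ^ 'k"
    and A2 :: "real ^ 'l ^ 'p" and Z2 :: "'a \<Rightarrow> real ^ 'l"
    and E1 E2 :: "'a \<Rightarrow> real ^ 'p"
    and \<mu>1 \<mu>2 :: "real ^ 'p" and \<Sigma>1 \<Sigma>2 :: "real ^ 'p ^ 'p"
  assumes "prob_space M"
    and "X \<in> borel_measurable M"
    and "representation M X A1 Z1 E1 \<mu>1 \<Sigma>1"
    and "representation M X A2 Z2 E2 \<mu>2 \<Sigma>2"
  shows "CARD('k) = CARD('l) \<and> rank A1 = rank A2 \<and>
    (rank A1 = CARD('k) \<longrightarrow> (\<forall>j. gaussian_free M (\<lambda>\<omega>. Z1 \<omega> $ j)) \<longrightarrow>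
      (\<exists>(P :: real ^ 'l ^ 'k) \<Lambda> (N :: (real ^ 'k) measure) H \<xi> \<Delta>.
         gaussian_shift_relation M A1 Z1 E1 \<mu>1 \<Sigma>1 A2 Z2 E2 \<mu>2 \<Sigma>2 P \<Lambda> N H \<xi> \<Delta>) \<and>
      ((\<forall>j. gaussian_free M (\<lambda>\<omega>. Z2 \<omega> $ j)) \<longrightarrow>
        (\<forall>(P :: real ^ 'l ^ 'k) \<Lambda> (N :: (real ^ 'k) measure) H \<xi> \<Delta>.
           gaussian_shift_relation M A1 Z1 E1 \<mu>1 \<Sigma>1 A2 Z2 E2 \<mu>2 \<Sigma>2 P \<Lambda> N H \<xi> \<Delta> \<longrightarrow>
             (AE \<omega> in M \<Otimes>\<^sub>M N. H \<omega> = \<xi>) \<and> \<Delta> = 0 \<and>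
             distr M borel Z2 =
               distr M borel (\<lambda>\<omega>. matrix_inv \<Lambda> *v (matrix_inv P *v (Z1 \<omega> + \<xi>))) \<and>
             distr M borel E2 = distr M borel (\<lambda>\<omega>. E1 \<omega> - A1 *v \<xi>) \<and>
             \<Sigma>2 = \<Sigma>1)))"
proof -
  obtain \<pi> :: "'l \<Rightarrow> 'k" and \<kappa> where \<pi>: "bij \<pi>" and \<kappa>: "\<And>l. \<kappa> l \<noteq> 0"
    "\<And>l. column l A2 = \<kappa> l *\<^sub>R column (\<pi> l) A1"
    using columns_correspond[OF assms] by blast
  have "CARD('k) = CARD('l)" using bij_betw_same_card[OF \<pi>] by simp
  moreover have "rank A1 = rank A2" by (rule rank_eq_of_columns[OF \<pi> \<kappa>])
  moreover have "\<exists>(P :: real ^ 'l ^ 'k) \<Lambda> (N :: (real ^ 'k) measure) H \<xi> \<Delta>.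
      gaussian_shift_relation M A1 Z1 E1 \<mu>1 \<Sigma>1 A2 Z2 E2 \<mu>2 \<Sigma>2 P \<Lambda> N H \<xi> \<Delta>"
    if "rank A1 = CARD('k)" "\<forall>j. gaussian_free M (\<lambda>\<omega>. Z1 \<omega> $ j)"
    using that by (intro gaussian_shift_exists[OF assms]) auto
  moreover have "(AE \<omega> in M \<Otimes>\<^sub>M N. H \<omega> = \<xi>) \<and> \<Delta> = 0 \<and>
      distr M borel Z2 = distr M borel (\<lambda>\<omega>. matrix_inv \<Lambda> *v (matrix_inv P *v (Z1 \<omega> + \<xi>))) \<and>
      distr M borel E2 = distr M borel (\<lambda>\<omega>. E1 \<omega> - A1 *v \<xi>) \<and> \<Sigma>2 = \<Sigma>1"
    if free: "\<forall>j. gaussian_free M (\<lambda>\<omega>. Z2 \<omega> $ j)"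
      and rel: "gaussian_shift_relation M A1 Z1 E1 \<mu>1 \<Sigma>1 A2 Z2 E2 \<mu>2 \<Sigma>2 P \<Lambda> N H \<xi> \<Delta>"
    for P :: "real ^ 'l ^ 'k" and \<Lambda> and N :: "(real ^ 'k) measure" and H \<xi> \<Delta>
  proof -
    note meas = representation_measurable[OF assms(3)] representation_measurable[OF assms(4)]
    have "\<Delta> = 0"
      by (rule gaussian_shift_covariance_zero[OF assms(1) meas(1) meas(4) _ rel]) (use free in simp)
    then show ?thesis
      using gaussian_shift_deterministic[OF assms(1) meas(1,2,5)] rel by blast
  qed
  ultimately show ?thesis by blast
qed

end
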